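(* \textsc{Block Graph Vertex Deletion} admits a factor four approximation algorithm: there is a polynomial-time algorithm that, given a graph $G$, outputs a set $S\subseteq V(G)$ such that $G\setminus S$ is a block graph and $|S|\le 4\cdot\mathrm{OPT}$, where $\mathrm{OPT}$ is the minimum size of a set $S^*\subseteq V(G)$ for which $G\setminus S^*$ is a block graph.
   Context: A block graph is a graph in which every maximal $2$-connected subgraph is a clique; equivalently, a graph with no induced cycle of length at least four and no induced $K_4-e$. *)

theory Defs
  imports
    "Graph_Theory.Graph_Theory"
    "HOL-Computational_Algebra.Polynomial"
begin

section \<open>Block graphs\<close>

text \<open>
  Finite simple undirected graphs are the symmetric, loop-free digraphs without parallel arcs of
  the locale \<^locale>\<open>graph\<close>; every undirected edge is a pair of opposite arcs.
\<close>

definition two_connected :: "('a, 'b) pre_digraph \<Rightarrow> bool" where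
  "two_connected H \<longleftrightarrow> graph H \<and> 3 \<le> card (verts H) \<and> connected H \<and>
     (\<forall>v \<in> verts H. connected (pre_digraph.del_vert H v))"

text \<open>
  The bound \<open>3 \<le> card (verts H)\<close> is the usual one. Counting a single edge or a single vertex as
  2-connected as well would not change the notion of a block graph, since both are cliques.
\<close>

definition block_graph :: "('a, 'b) pre_digraph \<Rightarrow> bool" where
  "block_graph G \<longleftrightarrow> graph G \<and>
     (\<forall>H. pre_digraph.max_subgraph G two_connected H \<longrightarrow> complete_digraph (card (verts H)) H)"

definition block_deletion_set :: "'a pair_pre_digraph \<Rightarrow> 'a set \<Rightarrow> bool" where
  "block_deletion_set G S \<longleftrightarrow> S \<subseteq> pverts G \<and> block_graph (with_proj G \<restriction> (pverts G - S))"

definition block_deletion_opt :: "'a pair_pre_digraph \<Rightarrow> nat" where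
  "block_deletion_opt G = Min (card ` {S. block_deletion_set G S})"


section \<open>Polynomial-time algorithms\<close>

text \<open>
  Algorithms are structured programs for a random access machine with finitely many named registers
  and a random access memory, both holding natural numbers, under the uniform cost measure. The only
  arithmetic operations are addition and truncated subtraction. A run of \<open>t\<close> steps can therefore
  lengthen the binary representation of the numbers involved by \<open>O(t)\<close> bits only, and polynomial
  time on this machine coincides with polynomial time on Turing machines. (A unit-cost
  multiplication would destroy this equivalence.)
\<close>

datatype expr = Const nat | Reg nat | Mem expr | Plus expr expr | Minus expr expr

datatype com =
    Skip
  | Assign nat expr
  | Store expr expr  \<comment> \<open>address, value\<close>
  | Seq com com
  | If expr com com
  | While expr com

type_synonym state = "(nat \<Rightarrow> nat) \<times> (nat \<Rightarrow> nat)"  \<comment> \<open>registers and memory\<close>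

primrec expr_val :: "expr \<Rightarrow> state \<Rightarrow> nat" where
  "expr_val (Const c) s = c"
| "expr_val (Reg r) s = fst s r"
| "expr_val (Mem a) s = snd s (expr_val a s)"
| "expr_val (Plus a b) s = expr_val a s + expr_val b s"
| "expr_val (Minus a b) s = expr_val a s - expr_val b s"

primrec expr_cost :: "expr \<Rightarrow> nat" where
  "expr_cost (Const c) = 1"
| "expr_cost (Reg r) = 1"
| "expr_cost (Mem a) = expr_cost a + 1"
| "expr_cost (Plus a b) = expr_cost a + expr_cost b + 1"
| "expr_cost (Minus a b) = expr_cost a + expr_cost b + 1"

text \<open>
  \<open>exec c s t s'\<close>: started in state \<open>s\<close>, the program \<open>c\<close> halts in state \<open>s'\<close> after \<open>t\<close> steps.
  Nonzero values count as true.
\<close>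

inductive exec :: "com \<Rightarrow> state \<Rightarrow> nat \<Rightarrow> state \<Rightarrow> bool" where
  exec_Skip: "exec Skip s 1 s"
| exec_Assign: "exec (Assign r e) s (expr_cost e + 1) ((fst s)(r := expr_val e s), snd s)"
| exec_Store: "exec (Store a e) s (expr_cost a + expr_cost e + 1)
    (fst s, (snd s)(expr_val a s := expr_val e s))"
| exec_Seq: "exec c1 s t1 s' \<Longrightarrow> exec c2 s' t2 s'' \<Longrightarrow> exec (Seq c1 c2) s (t1 + t2) s''"
| exec_IfTrue: "expr_val b s \<noteq> 0 \<Longrightarrow> exec c1 s t s' \<Longrightarrow> exec (If b c1 c2) s (expr_cost b + 1 + t) s'"
| exec_IfFalse: "expr_val b s = 0 \<Longrightarrow> exec c2 s t s' \<Longrightarrow> exec (If b c1 c2) s (expr_cost b + 1 + t) s'"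
| exec_WhileFalse: "expr_val b s = 0 \<Longrightarrow> exec (While b c) s (expr_cost b + 1) s"
| exec_WhileTrue: "expr_val b s \<noteq> 0 \<Longrightarrow> exec c s t1 s' \<Longrightarrow> exec (While b c) s' t2 s'' \<Longrightarrow>
    exec (While b c) s (expr_cost b + 1 + t1 + t2) s''"

inductive_cases exec_SkipE: "exec Skip s t s'"
inductive_cases exec_AssignE: "exec (Assign r e) s t s'"
inductive_cases exec_StoreE: "exec (Store a e) s t s'"
inductive_cases exec_SeqE: "exec (Seq c1 c2) s t s'"
inductive_cases exec_IfE: "exec (If b c1 c2) s t s'"
inductive_cases exec_WhileE: "exec (While b c) s t s'"

lemma exec_deterministic:
  "exec c s t s' \<Longrightarrow> exec c s u s'' \<Longrightarrow> t = u \<and> s' = s''"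
proof (induction arbitrary: u s'' rule: exec.induct)
  case (exec_Skip s)
  then show ?case by (auto elim: exec_SkipE)
next
  case (exec_Assign r e s)
  then show ?case by (auto elim: exec_AssignE)
next
  case (exec_Store a e s)
  then show ?case by (auto elim: exec_StoreE)
next
  case (exec_Seq c1 s t1 s1 c2 t2 s2)
  from exec_Seq.prems obtain u1 r u2
    where u: "u = u1 + u2" and r: "exec c1 s u1 r" "exec c2 r u2 s''"
    by (rule exec_SeqE)
  with exec_Seq.IH(1) have "t1 = u1 \<and> s1 = r" by blast
  with u r(2) exec_Seq.IH(2) show ?case by blast
next
  case (exec_IfTrue b s c1 t s1 c2)
  from exec_IfTrue.prems show ?case
    by (rule exec_IfE) (auto simp: exec_IfTrue.hyps(1) dest: exec_IfTrue.IH)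
next
  case (exec_IfFalse b s c2 t s1 c1)
  from exec_IfFalse.prems show ?case
    by (rule exec_IfE) (auto simp: exec_IfFalse.hyps(1) dest: exec_IfFalse.IH)
next
  case (exec_WhileFalse b s c)
  from exec_WhileFalse.prems show ?case
    by (rule exec_WhileE) (auto simp: exec_WhileFalse.hyps)
next
  case (exec_WhileTrue b s c t1 s1 t2 s2)
  from exec_WhileTrue.prems exec_WhileTrue.hyps(1) obtain u1 r u2
    where u: "u = expr_cost b + 1 + u1 + u2" and r: "exec c s u1 r" "exec (While b c) r u2 s''"
    by (auto elim: exec_WhileE)
  with exec_WhileTrue.IH(1) have "t1 = u1 \<and> s1 = r" by blast
  with u r(2) exec_WhileTrue.IH(2) show ?case by blast
qed

text \<open>
  A graph with \<open>n\<close> vertices is presented to the machine by an arbitrary enumeration \<open>vs\<close> of its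
  vertices: register 0 holds \<open>n\<close>, and memory cells \<open>0\<close> to \<open>n * n - 1\<close> hold the adjacency matrix, row by
  row. All other registers and cells are 0. The output is a vertex set, read off from the first \<open>n\<close>
  memory cells as a characteristic vector.
\<close>

definition input_state :: "'a pair_pre_digraph \<Rightarrow> 'a list \<Rightarrow> state" where
  "input_state G vs =
     (let n = length vs in
       (\<lambda>r. if r = 0 then n else 0,
        \<lambda>a. if a < n * n \<and> (vs ! (a div n), vs ! (a mod n)) \<in> parcs G then 1 else 0))"

definition output_set :: "'a list \<Rightarrow> state \<Rightarrow> 'a set" where
  "output_set vs s = {vs ! i | i. i < length vs \<and> snd s i \<noteq> 0}"

text \<open>
  Vertices are natural numbers so that the quantification over all finite graphs can take place
  below the choice of the program; every finite graph is isomorphic to one of these. The input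
  consists of \<open>n * n + 1\<close> numbers, so a polynomial bound in the number \<open>n\<close> of vertices is the same as
  one in the input size.
\<close>

definition poly_time_graph_algorithm :: "com \<Rightarrow> (nat pair_pre_digraph \<Rightarrow> nat set \<Rightarrow> bool) \<Rightarrow> bool" where
  "poly_time_graph_algorithm c R \<longleftrightarrow>
     (\<exists>p :: nat poly. \<forall>G vs. pair_graph G \<and> distinct vs \<and> set vs = pverts G \<longrightarrow>
        (\<exists>t s. exec c (input_state G vs) t s \<and> t \<le> poly p (card (pverts G)) \<and>
               R G (output_set vs s)))"

end

theory Submission
  imports Defs
begin

text \<open>
  Every solution contains a vertex of each induced \<open>K\<^sub>4 - e\<close> (diamond), so greedily deleting all
  four vertices of a diamond costs a factor of four. In the remaining graph every edge lies in a
  unique maximal clique, and a vertex set \<open>X\<close> induces a block graph iff the incidence graph of \<open>X\<close>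
  and the cliques is a forest, that is, iff its cycle rank \<open>cyc X\<close> is zero; it is then dismantled by
  repeatedly deleting vertices that lie in at most one clique. What is left is a feedback vertex set
  problem in which cliques may not be deleted. It is solved by local ratio with the weights
  \<open>hdeg U v\<close>, the number of cliques at \<open>v\<close>. If all of these are at least two, then double counting
  bounds the weight of any solution \<open>F\<close> by \<open>2 * excess U + 2 * card F \<le> 2 * cyc U + 2 * card F\<close>. A
  minimal \<open>F\<close> has at most \<open>cyc U\<close> elements, as each of them closes a cycle, so its weight is at most
  \<open>4 * cyc U\<close>. Deleting \<open>v\<close> lowers the cycle rank by at most \<open>hdeg U v\<close>, so every solution has weight
  at least \<open>cyc U\<close>. Minimality is achieved by reverse delete. Weights are kept integral by multiplying
  through instead of dividing.
\<close>

section \<open>Cycle rank of set families\<close>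

text \<open>The local ratio argument needs the final solution to be minimal for every set
  \<open>U\<close> from which weight was split off, not just for the last one. For this reason each
  pushed vertex carries a stamp: up to leaves, the set \<open>U\<close> of a round is
  \<open>V\<close> without the vertices stamped before it, and reverse delete tests a vertex while
  all vertices of smaller stamp still count as deleted. A failed test stays failed when the solution
  shrinks further, so one pass yields all minimality conditions. The constant four arises twice,
  independently: from the size of a diamond and from the local ratio bound. The two phases act on
  disjoint vertex sets, so their bounds are simply added. As the machine only adds and subtracts,
  ratios are compared by cross multiplication, and a product is a sum of at most \<open>n\<close>
  terms because one factor is a degree. The weights stay below or at \<open>n ^ n\<close>, hence of
  polynomial length.\<close>

locale set_family =
  fixes K :: "'a set set"
  assumes finite_K: "finite K"
begin

text \<open>Sets that meet \<open>X\<close> in \<open>v\<close> alone are left out: in the incidence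
  graph they are pendant and lie on no cycle. The value is the same whether or not \<open>v\<close>
  belongs to \<open>X\<close>.\<close>

definition hdeg :: "'a set \<Rightarrow> 'a \<Rightarrow> nat" where
  "hdeg X v = card {L \<in> K. v \<in> L \<and> L \<inter> (X - {v}) \<noteq> {}}"

definition linked :: "'a set \<Rightarrow> ('a \<times> 'a) set" where
  "linked X = {(a, b). a \<in> X \<and> b \<in> X \<and> (\<exists>L\<in>K. a \<in> L \<and> b \<in> L)}"

definition comp_of :: "'a set \<Rightarrow> 'a \<Rightarrow> 'a set" where
  "comp_of X v = {u. (v, u) \<in> (linked X)\<^sup>*}"

definition comps :: "'a set \<Rightarrow> 'a set set" where
  "comps X = comp_of X ` X"

definition touched :: "'a set \<Rightarrow> 'a \<Rightarrow> 'a set set" where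
  "touched X v = {C \<in> comps X. \<exists>L\<in>K. v \<in> L \<and> L \<inter> C \<noteq> {}}"

text \<open>Edges minus nodes of the incidence graph of \<open>X\<close> with the sets that meet
  \<open>X\<close>; truncated subtraction lets a set that misses \<open>X\<close> contribute zero.
  Adding the number of components gives the cyclomatic number.\<close>

definition excess :: "'a set \<Rightarrow> int" where
  "excess X = (\<Sum>L\<in>K. int (card (L \<inter> X) - 1)) - int (card X)"

definition cyc :: "'a set \<Rightarrow> int" where
  "cyc X = excess X + int (card (comps X))"

lemma finite_hdeg [simp]: "finite {L \<in> K. P L}"
  using finite_K by simp

lemma hdeg_mono:
  assumes "X \<subseteq> Y"
  shows "hdeg X v \<le> hdeg Y v"
  unfolding hdeg_def by (rule card_mono) (use assms in auto)

lemma hdeg_insert_same [simp]: "hdeg (insert v X) v = hdeg X v"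
  by (simp add: hdeg_def)

lemma hdeg_Diff_same [simp]: "hdeg (X - {v}) v = hdeg X v"
  by (simp add: hdeg_def)

lemma sym_linked: "sym (linked X)"
  by (auto simp: linked_def sym_def)

lemma reach_sym: "(a, b) \<in> (linked X)\<^sup>* \<Longrightarrow> (b, a) \<in> (linked X)\<^sup>*"
  using sym_linked sym_rtrancl by (metis symD)

lemma linked_mono: "X \<subseteq> Y \<Longrightarrow> linked X \<subseteq> linked Y"
  by (auto simp: linked_def)

lemma comp_of_mono: "X \<subseteq> Y \<Longrightarrow> comp_of X v \<subseteq> comp_of Y v"
  using rtrancl_mono[OF linked_mono] by (auto simp: comp_of_def)

lemma comp_of_refl [simp]: "v \<in> comp_of X v"
  by (simp add: comp_of_def)

lemma comp_of_eq: "u \<in> comp_of X v \<Longrightarrow> comp_of X u = comp_of X v"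
  unfolding comp_of_def by (auto intro: rtrancl_trans reach_sym)

lemma comp_of_least:
  assumes "v \<in> C" "\<And>a b. a \<in> C \<Longrightarrow> (a, b) \<in> linked X \<Longrightarrow> b \<in> C"
  shows "comp_of X v \<subseteq> C"
proof
  fix u assume "u \<in> comp_of X v"
  then have "(v, u) \<in> (linked X)\<^sup>*" by (simp add: comp_of_def)
  then show "u \<in> C" by induction (use assms in auto)
qed

lemma comp_of_closed: "a \<in> comp_of X v \<Longrightarrow> (a, b) \<in> linked X \<Longrightarrow> b \<in> comp_of X v"
  by (auto simp: comp_of_def)

lemma comp_of_subset: "v \<in> X \<Longrightarrow> comp_of X v \<subseteq> X"
  by (rule comp_of_least) (auto simp: linked_def)

lemma finite_comps: "finite X \<Longrightarrow> finite (comps X)"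
  by (simp add: comps_def)

section \<open>Effect of adding a vertex on components and cycle rank\<close>

lemma comps_insert:
  assumes v: "v \<notin> X"
  shows "comps (insert v X) = insert (insert v (\<Union>(touched X v))) (comps X - touched X v)"
proof -
  let ?M = "insert v (\<Union>(touched X v))"
  have comp_eq: "C = comp_of X a" if "C \<in> comps X" "a \<in> C" for C a
    using that comp_of_eq by (auto simp: comps_def)
  have M_X: "?M \<subseteq> insert v X"
    using comp_of_subset by (fastforce simp: touched_def comps_def)
  have Mv: "comp_of (insert v X) v = ?M"
  proof
    \<comment> \<open>\<open>?M\<close> is closed under links: from \<open>v\<close> they lead into
      touched components, and from an old component they stay inside or lead to
      \<open>v\<close>.\<close>
    show "comp_of (insert v X) v \<subseteq> ?M"
    proof (rule comp_of_least)
      fix a b assume a: "a \<in> ?M" and ab: "(a, b) \<in> linked (insert v X)"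
      show "b \<in> ?M"
      proof (cases "b = v")
        case False
        then have b: "b \<in> X" using ab by (auto simp: linked_def)
        show ?thesis
        proof (cases "a = v")
          case True
          then obtain L where "L \<in> K" "v \<in> L" "b \<in> L" using ab by (auto simp: linked_def)
          then have "comp_of X b \<in> touched X v"
            using b by (auto simp: touched_def comps_def intro!: bexI[of _ L])
          then show ?thesis using comp_of_refl by blast
        next
          case False
          then obtain C where C: "C \<in> touched X v" "a \<in> C" using a by auto
          then have "C = comp_of X a" using comp_eq by (auto simp: touched_def)
          moreover have "a \<in> X" using M_X a False by auto
          ultimately have "b \<in> C" using ab b by (auto simp: linked_def comp_of_def)
          then show ?thesis using C by auto
        qed
      qed simp
    qed simp
  next
    show "?M \<subseteq> comp_of (insert v X) v"
    proof
      fix a assume "a \<in> ?M"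
      then consider "a = v" | C where "C \<in> touched X v" "a \<in> C" by auto
      then show "a \<in> comp_of (insert v X) v"
      proof cases
        case 2
        then obtain L c where L: "L \<in> K" "v \<in> L" "c \<in> L" "c \<in> C" "C \<in> comps X"
          by (auto simp: touched_def)
        then have c: "c \<in> X" using comp_of_subset by (fastforce simp: comps_def)
        have "(v, c) \<in> linked (insert v X)" using L c by (auto simp: linked_def)
        then have "c \<in> comp_of (insert v X) v" by (auto simp: comp_of_def)
        moreover have "a \<in> comp_of X c" using comp_eq[OF L(5) L(4)] 2 by simp
        ultimately show ?thesis
          using comp_of_mono[of X "insert v X" c] comp_of_eq by blast
      qed simp
    qed
  qed
  have in_M: "comp_of (insert v X) u = ?M" if "comp_of X u \<in> touched X v" for u
  proof -
    have "u \<in> ?M" using that comp_of_refl by blast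
    then show ?thesis using Mv comp_of_eq by metis
  qed
  have out: "comp_of (insert v X) u = comp_of X u" if u: "u \<in> X" "comp_of X u \<notin> touched X v" for u
  proof
    show "comp_of (insert v X) u \<subseteq> comp_of X u"
    proof (rule comp_of_least)
      fix a b assume a: "a \<in> comp_of X u" and ab: "(a, b) \<in> linked (insert v X)"
      have aX: "a \<in> X" using a comp_of_subset u by auto
      have "b \<noteq> v" using u a ab by (auto simp: touched_def comps_def linked_def)
      then show "b \<in> comp_of X u"
        using comp_of_closed[OF a] ab aX by (auto simp: linked_def)
    qed simp
  qed (rule comp_of_mono, auto)
  have "comps (insert v X) = insert ?M (comp_of (insert v X) ` X)"
    by (simp add: comps_def Mv)
  also have "\<dots> = insert ?M (comps X - touched X v)"
  proof -
    have "comp_of (insert v X) u \<in> insert ?M (comps X - touched X v)" if "u \<in> X" for u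
      using in_M[of u] out[OF that] that by (cases "comp_of X u \<in> touched X v") (auto simp: comps_def)
    moreover have "C \<in> comp_of (insert v X) ` X" if C: "C \<in> comps X - touched X v" for C
    proof -
      obtain u where "u \<in> X" "C = comp_of X u" using C by (auto simp: comps_def)
      then show ?thesis using out[of u] C by auto
    qed
    ultimately show ?thesis by blast
  qed
  finally show ?thesis .
qed

lemma card_comps_insert:
  assumes "v \<notin> X" "finite X"
  shows "int (card (comps (insert v X))) = int (card (comps X)) + 1 - int (card (touched X v))"
proof -
  have "insert v (\<Union>(touched X v)) \<notin> comps X"
  proof
    assume "insert v (\<Union>(touched X v)) \<in> comps X"
    then have "insert v (\<Union>(touched X v)) \<subseteq> X" using comp_of_subset unfolding comps_def by blast
    then show False using assms by blast
  qed
  moreover have "touched X v \<subseteq> comps X" by (auto simp: touched_def)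
  ultimately show ?thesis
    using assms card_mono[OF finite_comps[OF assms(2)], of "touched X v"]
      finite_subset[OF _ finite_comps[OF assms(2)], of "touched X v"]
    by (simp add: comps_insert finite_comps card_Diff_subset of_nat_diff)
qed

text \<open>A set through \<open>v\<close> that already has a vertex of \<open>X\<close> gains an
  edge; one first met at \<open>v\<close> gains an edge and a node, which cancel. The final
  \<open>- 1\<close> is the node \<open>v\<close>.\<close>

lemma excess_insert:
  assumes v: "v \<notin> X" and fin: "finite X"
  shows "excess (insert v X) = excess X + int (hdeg X v) - 1"
proof -
  have *: "int (card (L \<inter> insert v X) - 1) =
      int (card (L \<inter> X) - 1) + (if v \<in> L \<and> L \<inter> (X - {v}) \<noteq> {} then 1 else 0)" for L
  proof (cases "v \<in> L")
    case True
    then have "L \<inter> insert v X = insert v (L \<inter> X)" by auto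
    then have "card (L \<inter> insert v X) = Suc (card (L \<inter> X))" using v fin by simp
    moreover have "L \<inter> (X - {v}) = L \<inter> X" using v by auto
    moreover have "card (L \<inter> X) = 0 \<longleftrightarrow> L \<inter> X = {}" using fin by simp
    ultimately show ?thesis using True by (cases "card (L \<inter> X)") auto
  qed simp
  have "(\<Sum>L\<in>K. if v \<in> L \<and> L \<inter> (X - {v}) \<noteq> {} then 1 else (0::int)) = int (hdeg X v)"
    using finite_K by (simp add: hdeg_def flip: sum.inter_filter)
  then have "(\<Sum>L\<in>K. int (card (L \<inter> insert v X) - 1)) =
      (\<Sum>L\<in>K. int (card (L \<inter> X) - 1)) + int (hdeg X v)"
    by (simp only: * sum.distrib)
  then show ?thesis
    using v fin by (simp add: excess_def)
qed

text \<open>The new node and the new component cancel. Of the edges at \<open>v\<close>, one per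
  touched component joins that component to \<open>v\<close>; every further edge closes a
  cycle.\<close>

lemma cyc_insert:
  assumes "v \<notin> X" "finite X"
  shows "cyc (insert v X) = cyc X + int (hdeg X v) - int (card (touched X v))"
  using excess_insert[OF assms] card_comps_insert[OF assms] by (simp add: cyc_def)

text \<open>A set of \<open>K\<close> that meets \<open>X\<close> meets just one component, so the
  union over all its vertices in \<open>X\<close> is that component, and no representative has to be
  selected.\<close>

definition comp_at :: "'a set \<Rightarrow> 'a set \<Rightarrow> 'a set" where
  "comp_at X L = (\<Union>u\<in>L \<inter> X. comp_of X u)"

lemma comp_at_eq:
  assumes "L \<in> K" "u \<in> L" "u \<in> X"
  shows "comp_at X L = comp_of X u"
proof -
  have "comp_of X w = comp_of X u" if "w \<in> L" "w \<in> X" for w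
    by (rule comp_of_eq) (use assms that in \<open>auto simp: comp_of_def linked_def\<close>)
  then show ?thesis using assms(2,3) unfolding comp_at_def by blast
qed

text \<open>Hence \<open>card (touched X v)\<close> is at most the degree, with equality exactly if
  \<open>comp_at X\<close> is injective on the sets counted at \<open>v\<close>; this is how a
  closed cycle is recognised.\<close>

lemma touched_eq:
  assumes "v \<notin> X"
  shows "touched X v = comp_at X ` {L \<in> K. v \<in> L \<and> L \<inter> (X - {v}) \<noteq> {}}"
proof -
  have "X - {v} = X" using assms by auto
  moreover have "touched X v \<subseteq> comp_at X ` {L \<in> K. v \<in> L \<and> L \<inter> X \<noteq> {}}"
  proof
    fix C assume "C \<in> touched X v"
    then obtain u L w where u: "u \<in> X" "C = comp_of X u" "L \<in> K" "v \<in> L" "w \<in> L" "w \<in> C"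
      by (auto simp: touched_def comps_def)
    then have "w \<in> X" using comp_of_subset by blast
    moreover have "C = comp_of X w" using u comp_of_eq by blast
    ultimately have "C = comp_at X L" using comp_at_eq u by blast
    then show "C \<in> comp_at X ` {L \<in> K. v \<in> L \<and> L \<inter> X \<noteq> {}}"
      using u \<open>w \<in> X\<close> by blast
  qed
  moreover have "comp_at X ` {L \<in> K. v \<in> L \<and> L \<inter> X \<noteq> {}} \<subseteq> touched X v"
  proof
    fix C assume "C \<in> comp_at X ` {L \<in> K. v \<in> L \<and> L \<inter> X \<noteq> {}}"
    then obtain L u where L: "C = comp_at X L" "L \<in> K" "v \<in> L" "u \<in> L" "u \<in> X" by blast
    then have "C = comp_of X u" using comp_at_eq by blast
    then show "C \<in> touched X v"
      using L comp_of_refl unfolding touched_def comps_def by blast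
  qed
  ultimately show ?thesis by auto
qed

lemma card_touched_le: "v \<notin> X \<Longrightarrow> card (touched X v) \<le> hdeg X v"
  by (simp add: touched_eq hdeg_def card_image_le)

section \<open>Monotonicity of the cycle rank and removal of leaves\<close>

lemma cyc_insert_mono:
  assumes "finite X"
  shows "cyc X \<le> cyc (insert v X)"
proof (cases "v \<in> X")
  case False
  then show ?thesis using cyc_insert[OF _ assms] card_touched_le[of v X] by simp
qed (simp add: insert_absorb)

lemma cyc_mono:
  assumes "finite Y" "X \<subseteq> Y"
  shows "cyc X \<le> cyc Y"
proof -
  have X: "finite X" using assms finite_subset by blast
  have "cyc X \<le> cyc (X \<union> Z)" if "finite Z" for Z
    using that
  proof induction
    case (insert z Z)
    then show ?case using cyc_insert_mono[of "X \<union> Z" z] X by simp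
  qed simp
  from this[of Y] show ?thesis using assms by (simp add: Un_absorb1)
qed

lemma cyc_empty [simp]: "cyc {} = 0"
  by (simp add: cyc_def excess_def comps_def)

lemma cyc_nonneg: "finite X \<Longrightarrow> 0 \<le> cyc X"
  using cyc_mono[of X "{}"] by simp

lemma touched_nonempty:
  assumes "v \<notin> X" "finite X" "0 < hdeg X v"
  shows "0 < card (touched X v)"
proof -
  have "{L \<in> K. v \<in> L \<and> L \<inter> (X - {v}) \<noteq> {}} \<noteq> {}"
    using assms(3) unfolding hdeg_def by force
  then show ?thesis using assms by (simp add: touched_eq card_gt_0_iff)
qed

lemma cyc_insert_leaf:
  assumes "finite X" "hdeg X v \<le> 1"
  shows "cyc (insert v X) = cyc X"
proof (cases "v \<in> X")
  case False
  have "card (touched X v) = hdeg X v"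
    using card_touched_le[OF False] touched_nonempty[OF False assms(1)] assms(2) by linarith
  then show ?thesis
    using cyc_insert[OF False assms(1)] by linarith
qed (simp add: insert_absorb)

lemma cyc_remove_leaf:
  assumes "finite X" "hdeg X v \<le> 1"
  shows "cyc (X - {v}) = cyc X"
  using cyc_insert_leaf[of "X - {v}" v] assms by (cases "v \<in> X") (auto simp: insert_absorb)

text \<open>A vertex closes a cycle exactly if two of its sets reach the same component. This survives
  enlarging the vertex set.\<close>

lemma cyc_insert_less_mono:
  assumes fin: "finite Y" and XY: "X \<subseteq> Y" and v: "v \<notin> Y" and less: "cyc X < cyc (insert v X)"
  shows "cyc Y < cyc (insert v Y)"
proof -
  let ?S = "\<lambda>X. {L \<in> K. v \<in> L \<and> L \<inter> (X - {v}) \<noteq> {}}"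
  have finX: "finite X" and vX: "v \<notin> X" using fin XY v finite_subset by auto
  have "card (touched X v) < hdeg X v" using less cyc_insert[OF vX finX] by simp
  then have "card (comp_at X ` ?S X) \<noteq> card (?S X)" by (simp add: touched_eq[OF vX] hdeg_def)
  then have "\<not> inj_on (comp_at X) (?S X)" using card_image by blast
  then obtain L L' where L: "L \<in> ?S X" "L' \<in> ?S X" "L \<noteq> L'" "comp_at X L = comp_at X L'"
    by (auto simp: inj_on_def)
  then obtain u u' where u: "u \<in> L" "u \<in> X" "u' \<in> L'" "u' \<in> X" by auto
  then have "comp_of X u = comp_of X u'" using L comp_at_eq[of L u X] comp_at_eq[of L' u' X] by auto
  then have "u' \<in> comp_of Y u" using comp_of_mono[OF XY, of u] comp_of_refl by blast
  then have "comp_at Y L = comp_at Y L'"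
    using u L XY comp_at_eq[of L u Y] comp_at_eq[of L' u' Y] comp_of_eq by blast
  moreover have "L \<in> ?S Y" "L' \<in> ?S Y" using L XY by auto
  ultimately have "\<not> inj_on (comp_at Y) (?S Y)" using L(3) by (auto simp: inj_on_def)
  then have "card (touched Y v) \<noteq> hdeg Y v"
    unfolding touched_eq[OF v] hdeg_def using eq_card_imp_inj_on[of "?S Y" "comp_at Y"] finite_K by auto
  then show ?thesis using cyc_insert[OF v fin] card_touched_le[OF v] by linarith
qed

text \<open>A set with \<open>k\<close> vertices in \<open>X\<close> is counted once at each of them
  if \<open>k\<close> is at least two, and then \<open>k\<close> is at most
  \<open>2 * (k - 1)\<close>; otherwise it is not counted at all.\<close>

lemma sum_hdeg_le:
  assumes fin: "finite X"
  shows "(\<Sum>v\<in>X. int (hdeg X v)) \<le> 2 * (excess X + int (card X))"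
proof -
  have "(\<Sum>v\<in>X. int (hdeg X v)) =
      (\<Sum>v\<in>X. \<Sum>L\<in>K. if v \<in> L \<and> L \<inter> (X - {v}) \<noteq> {} then 1 else 0)"
    using finite_K by (simp add: hdeg_def flip: sum.inter_filter)
  also have "\<dots> = (\<Sum>L\<in>K. \<Sum>v\<in>X. if v \<in> L \<and> L \<inter> (X - {v}) \<noteq> {} then 1 else 0)"
    by (rule sum.swap)
  also have "\<dots> \<le> (\<Sum>L\<in>K. 2 * int (card (L \<inter> X) - 1))"
  proof (rule sum_mono)
    fix L
    have "(\<Sum>v\<in>X. if v \<in> L \<and> L \<inter> (X - {v}) \<noteq> {} then 1 else (0::int)) =
        int (card {v \<in> X. v \<in> L \<and> L \<inter> (X - {v}) \<noteq> {}})"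
      using fin by (simp flip: sum.inter_filter)
    also have "\<dots> \<le> 2 * int (card (L \<inter> X) - 1)"
    proof (cases "card (L \<inter> X) \<le> 1")
      case True
      then have "{v \<in> X. v \<in> L \<and> L \<inter> (X - {v}) \<noteq> {}} = {}"
        using card_le_Suc0_iff_eq[of "L \<inter> X"] fin by auto
      then have "card {v \<in> X. v \<in> L \<and> L \<inter> (X - {v}) \<noteq> {}} = 0" by (simp only: card.empty)
      then show ?thesis by linarith
    next
      case False
      have "card {v \<in> X. v \<in> L \<and> L \<inter> (X - {v}) \<noteq> {}} \<le> card (L \<inter> X)"
        by (rule card_mono) (use fin in auto)
      then show ?thesis using False by linarith
    qed
    finally show "(\<Sum>v\<in>X. if v \<in> L \<and> L \<inter> (X - {v}) \<noteq> {} then 1 else (0::int)) \<le>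
        2 * int (card (L \<inter> X) - 1)" .
  qed
  also have "\<dots> = 2 * (excess X + int (card X))"
    by (simp add: excess_def sum_distrib_left)
  finally show ?thesis .
qed

text \<open>Degrees of at least two everywhere would make \<open>excess X\<close> nonnegative, and
  the existence of a component would then make the cycle rank positive.\<close>

lemma ex_leaf:
  assumes "finite X" "X \<noteq> {}" "cyc X = 0"
  shows "\<exists>v\<in>X. hdeg X v \<le> 1"
proof (rule ccontr)
  assume "\<not> ?thesis"
  then have "(\<Sum>v\<in>X. 2) \<le> (\<Sum>v\<in>X. int (hdeg X v))" by (intro sum_mono) force
  then have "0 \<le> excess X" using sum_hdeg_le[OF assms(1)] by simp
  moreover have "card (comps X) > 0" using assms by (simp add: comps_def card_gt_0_iff)
  ultimately show False using assms by (simp add: cyc_def)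
qed

lemma excess_le_cyc: "excess X \<le> cyc X"
  by (simp add: cyc_def)

lemma cyc_Un_le:
  assumes "finite Y" "finite F" "Y \<inter> F = {}"
  shows "cyc (Y \<union> F) \<le> cyc Y + (\<Sum>v\<in>F. int (hdeg (Y \<union> F) v))"
  using assms(2,3)
proof induction
  case (insert v F)
  have "cyc (insert v (Y \<union> F)) \<le> cyc (Y \<union> F) + int (hdeg (Y \<union> F) v)"
    using insert assms by (subst cyc_insert) auto
  moreover have "(\<Sum>v\<in>F. int (hdeg (Y \<union> F) v)) \<le> (\<Sum>u\<in>F. int (hdeg (Y \<union> insert v F) u))"
    by (rule sum_mono) (auto intro: hdeg_mono)
  moreover have "hdeg (Y \<union> F) v \<le> hdeg (Y \<union> insert v F) v" by (rule hdeg_mono) auto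
  ultimately show ?case using insert by simp
qed simp

text \<open>The vertices of \<open>F\<close> are put back one at a time. Each closes a cycle over
  \<open>U - F\<close>, and by \<open>cyc_insert_less_mono\<close> still does so over whatever has
  been restored by then.\<close>

lemma card_le_cyc:
  assumes U: "finite U" and F: "F \<subseteq> U" and minimal: "\<And>v. v \<in> F \<Longrightarrow> cyc (U - F) < cyc (insert v (U - F))"
  shows "int (card F) \<le> cyc U"
proof -
  have "int (card F') \<le> cyc ((U - F) \<union> F')" if "finite F'" "F' \<subseteq> F" for F'
    using that
  proof induction
    case empty
    then show ?case using cyc_nonneg U by simp
  next
    case (insert v F')
    have "cyc (U - F \<union> F') < cyc (insert v (U - F \<union> F'))"
      by (rule cyc_insert_less_mono[OF _ _ _ minimal]) (use insert U in auto)
    then show ?case using insert by simp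
  qed
  moreover have "(U - F) \<union> F = U" using F by auto
  ultimately show ?thesis using finite_subset[OF F U] by (metis order_refl)
qed

text \<open>Both sums are compared with \<open>cyc U\<close>, the cycle rank of the incidence graph of \<open>U\<close> and \<open>K\<close>.\<close>

theorem local_ratio:
  assumes U: "finite U" and deg: "\<And>v. v \<in> U \<Longrightarrow> 2 \<le> hdeg U v"
    and F: "F \<subseteq> U" "cyc (U - F) = 0" "\<And>v. v \<in> F \<Longrightarrow> cyc (U - (F - {v})) \<noteq> 0"
    and H: "H \<subseteq> U" "cyc (U - H) = 0"
  shows "(\<Sum>v\<in>F. hdeg U v) \<le> 4 * (\<Sum>v\<in>H. hdeg U v)"
proof -
  have finF: "finite F" "finite H" using finite_subset[OF _ U] F(1) H(1) by auto
  have "cyc (U - F) < cyc (insert v (U - F))" if "v \<in> F" for v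
  proof -
    have "insert v (U - F) = U - (F - {v})" using that F by auto
    then show ?thesis using F that cyc_nonneg[of "insert v (U - F)"] U by force
  qed
  then have "int (card F) \<le> cyc U" using card_le_cyc U F by blast
  \<comment> \<open>The vertices outside \<open>F\<close> account for at least two each; moving them
    to the other side turns \<open>2 * card U\<close> into \<open>2 * card F\<close>.\<close>
  moreover have "(\<Sum>v\<in>F. int (hdeg U v)) + (\<Sum>v\<in>U - F. 2) \<le> 2 * (excess U + int (card U))"
  proof -
    have "(\<Sum>v\<in>U - F. 2) \<le> (\<Sum>v\<in>U - F. int (hdeg U v))" by (rule sum_mono) (use deg in force)
    then show ?thesis using sum_hdeg_le[OF U] sum.subset_diff[OF F(1) U, of "\<lambda>v. int (hdeg U v)"] by simp
  qed
  moreover have "card (U - F) + card F = card U"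
    using U F finF by (simp add: card_Diff_subset card_mono)
  moreover have "cyc U \<le> (\<Sum>v\<in>H. int (hdeg U v))"
  proof -
    have "(U - H) \<inter> H = {}" "(U - H) \<union> H = U" using H by auto
    then show ?thesis using cyc_Un_le[of "U - H" H] U H finF by simp
  qed
  ultimately have "(\<Sum>v\<in>F. int (hdeg U v)) \<le> 4 * (\<Sum>v\<in>H. int (hdeg U v))"
    using excess_le_cyc[of U] by simp
  then have "int (\<Sum>v\<in>F. hdeg U v) \<le> int (4 * (\<Sum>v\<in>H. hdeg U v))" by simp
  then show ?thesis by (simp only: of_nat_le_iff)
qed

end

section \<open>Block graphs without diamonds\<close>

locale simple_graph =
  fixes E :: "'a \<Rightarrow> 'a \<Rightarrow> bool"
  assumes E_sym: "E a b \<Longrightarrow> E b a" and E_irrefl: "\<not> E a a"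
begin

text \<open>The empty set counts as connected, unlike with \<open>connected\<close>; the translation
  to digraphs therefore asks for nonempty sets.\<close>

definition conn :: "'a set \<Rightarrow> bool" where
  "conn W \<longleftrightarrow> (\<forall>x\<in>W. \<forall>y\<in>W. (x, y) \<in> {(a, b). a \<in> W \<and> b \<in> W \<and> E a b}\<^sup>*)"

text \<open>The cardinality bound also forces \<open>W\<close> to be finite, as infinite sets have
  cardinality zero.\<close>

definition biconn :: "'a set \<Rightarrow> bool" where
  "biconn W \<longleftrightarrow> 3 \<le> card W \<and> conn W \<and> (\<forall>v\<in>W. conn (W - {v}))"

definition clique :: "'a set \<Rightarrow> bool" where
  "clique W \<longleftrightarrow> (\<forall>a\<in>W. \<forall>b\<in>W. a \<noteq> b \<longrightarrow> E a b)"

text \<open>All biconnected subsets are taken, not only maximal ones, so that the property is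
  visibly hereditary; \<open>block_graph_iff\<close> restores the maximal form.\<close>

definition block_set :: "'a set \<Rightarrow> bool" where
  "block_set X \<longleftrightarrow> (\<forall>W\<subseteq>X. biconn W \<longrightarrow> clique W)"

definition diamond :: "'a \<Rightarrow> 'a \<Rightarrow> 'a \<Rightarrow> 'a \<Rightarrow> bool" where
  "diamond a b c d \<longleftrightarrow> E a b \<and> E a c \<and> E b c \<and> E b d \<and> E c d \<and> a \<noteq> d \<and> \<not> E a d"

definition diamond_free :: "'a set \<Rightarrow> bool" where
  "diamond_free X \<longleftrightarrow> (\<forall>a\<in>X. \<forall>b\<in>X. \<forall>c\<in>X. \<forall>d\<in>X. \<not> diamond a b c d)"

lemma E_neq: "E a b \<Longrightarrow> a \<noteq> b"
  using E_irrefl by auto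

lemma block_setD: "block_set X \<Longrightarrow> W \<subseteq> X \<Longrightarrow> biconn W \<Longrightarrow> clique W"
  by (simp add: block_set_def)

lemma block_set_mono: "block_set X \<Longrightarrow> Y \<subseteq> X \<Longrightarrow> block_set Y"
  by (auto simp: block_set_def)

lemma conn_path:
  assumes "successively E xs"
  shows "conn (set xs)"
proof -
  let ?R = "\<lambda>xs. {(a, b). a \<in> set xs \<and> b \<in> set xs \<and> E a b}"
  have "xs = [] \<or> (\<forall>y\<in>set xs. (hd xs, y) \<in> (?R xs)\<^sup>*)" using assms
  proof (induction xs)
    case (Cons x xs)
    show ?case
    proof (cases xs)
      case (Cons z zs)
      have "E x z" "successively E xs" using Cons.prems Cons by auto
      then have "\<forall>y\<in>set xs. (z, y) \<in> (?R xs)\<^sup>*" using Cons.IH Cons by auto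
      moreover have "(?R xs)\<^sup>* \<subseteq> (?R (x # xs))\<^sup>*" by (rule rtrancl_mono) auto
      moreover have "(x, z) \<in> ?R (x # xs)" using \<open>E x z\<close> Cons by auto
      ultimately have "\<forall>y\<in>set xs. (x, y) \<in> (?R (x # xs))\<^sup>*"
        by (meson converse_rtrancl_into_rtrancl subsetD)
      then show ?thesis by simp
    qed simp
  qed simp
  moreover have "sym ((?R xs)\<^sup>*)" by (rule sym_rtrancl) (auto simp: sym_def E_sym)
  ultimately show ?thesis unfolding conn_def
    by (metis (no_types, lifting) list.set(1) empty_iff rtrancl_trans symD)
qed

text \<open>A cycle cut at \<open>v\<close> becomes a path: the part after \<open>v\<close> and
  then, across the closing edge, the part before it.\<close>

lemma biconn_cycle:
  assumes path: "successively E xs" and closing: "E (last xs) (hd xs)"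
    and dist: "distinct xs" and len: "3 \<le> length xs"
  shows "biconn (set xs)"
  unfolding biconn_def
proof (intro conjI ballI)
  show "3 \<le> card (set xs)" using dist len by (simp add: distinct_card)
  show "conn (set xs)" by (rule conn_path[OF path])
  fix v assume "v \<in> set xs"
  then obtain ys zs where xs: "xs = ys @ v # zs" by (auto simp: in_set_conv_decomp)
  have "successively E (zs @ ys)"
    using path closing unfolding xs
    by (cases "zs = []"; cases "ys = []") (auto simp: successively_append_iff successively_Cons)
  from conn_path[OF this] show "conn (set xs - {v})"
    using dist xs by (simp add: Un_commute insert_Diff_if)
qed

text \<open>The vertices of a diamond lie on the cycle \<open>a, b, d, c\<close>, so they are
  biconnected, while \<open>a\<close> and \<open>d\<close> are not adjacent.\<close>

lemma block_set_diamond_free: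
  assumes "block_set X"
  shows "diamond_free X"
  unfolding diamond_free_def
proof (intro ballI notI)
  fix a b c d assume X: "a \<in> X" "b \<in> X" "c \<in> X" "d \<in> X" and d: "diamond a b c d"
  have "biconn (set [a, b, d, c])"
    by (rule biconn_cycle) (use d E_neq E_sym in \<open>auto simp: diamond_def\<close>)
  then have "clique (set [a, b, d, c])" using X assms unfolding block_set_def by auto
  then show False using d by (auto simp: clique_def diamond_def)
qed

end

section \<open>Maximal cliques of a diamond-free graph\<close>

locale diamond_free_graph = simple_graph +
  fixes V :: "'a set"
  assumes fin_V: "finite V" and no_diamond: "diamond_free V"
begin

text \<open>For an edge \<open>uv\<close> of a diamond-free graph this is the only maximal clique
  containing it. The name alludes to partial linear spaces: two such sets share at most one
  vertex.\<close>

definition line :: "'a \<Rightarrow> 'a \<Rightarrow> 'a set" where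
  "line u v = {w \<in> V. w = u \<or> w = v \<or> (E w u \<and> E w v)}"

definition lines :: "'a set set" where
  "lines = {line u v | u v. u \<in> V \<and> v \<in> V \<and> E u v}"

sublocale set_family lines
proof
  have "lines \<subseteq> Pow V" by (auto simp: lines_def line_def)
  then show "finite lines" using fin_V finite_subset by auto
qed

lemma no_diamondD:
  "\<lbrakk>a \<in> V; b \<in> V; c \<in> V; d \<in> V; E a b; E a c; E b c; E b d; E c d; a \<noteq> d\<rbrakk> \<Longrightarrow> E a d"
  using no_diamond by (auto simp: diamond_free_def diamond_def)

text \<open>Two nonadjacent common neighbours of \<open>a\<close> and \<open>b\<close> would span a
  diamond on the edge \<open>ab\<close>.\<close>

lemma line_adj:
  assumes "L \<in> lines" "x \<in> L" "y \<in> L" "x \<noteq> y"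
  shows "E x y"
proof -
  obtain a b where "L = line a b" "a \<in> V" "b \<in> V" "E a b"
    using assms by (auto simp: lines_def)
  then show ?thesis using assms no_diamondD[of x a b y] by (auto simp: line_def intro: E_sym)
qed

lemma line_subset: "L \<in> lines \<Longrightarrow> L \<subseteq> V"
  by (auto simp: lines_def line_def)

lemma line_eq:
  assumes L: "L \<in> lines" and xy: "x \<in> L" "y \<in> L" "x \<noteq> y"
  shows "line x y = L"
proof
  show "L \<subseteq> line x y"
    using line_subset[OF L] line_adj[OF L] xy by (auto simp: line_def)
  have V: "x \<in> V" "y \<in> V" using line_subset[OF L] xy by auto
  have Exy: "E x y" using line_adj L xy by auto
  obtain a b where ab: "L = line a b" "a \<in> V" "b \<in> V" "E a b"
    using L by (auto simp: lines_def)
  have abL: "a \<in> L" "b \<in> L" using ab by (auto simp: line_def)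
  show "line x y \<subseteq> L"
  proof
    fix w assume w: "w \<in> line x y"
    \<comment> \<open>If \<open>w\<close> is adjacent to \<open>x\<close> and \<open>y\<close> but
      not to \<open>c\<close>, there is a diamond with middle edge \<open>xy\<close>. Taking for
      \<open>c\<close> the two vertices that define \<open>L\<close> puts \<open>w\<close> into
      \<open>L\<close>.\<close>
    have "w = c \<or> E w c" if "c \<in> L" for c
    proof (cases "c = x \<or> c = y \<or> w = x \<or> w = y")
      case True
      then show ?thesis using w line_adj[OF L _ that] xy Exy by (auto simp: line_def intro: E_sym)
    next
      case False
      then show ?thesis
        using no_diamondD[of w x y c] w that V Exy line_adj[OF L] xy line_subset[OF L]
        by (auto simp: line_def)
    qed
    then show "w \<in> L" using w abL ab by (auto simp: line_def)
  qed
qed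

lemma line_in_lines: "u \<in> V \<Longrightarrow> v \<in> V \<Longrightarrow> E u v \<Longrightarrow> line u v \<in> lines"
  by (auto simp: lines_def)

lemma in_line [simp]: "u \<in> V \<Longrightarrow> u \<in> line u v" "v \<in> V \<Longrightarrow> v \<in> line u v"
  by (auto simp: line_def)

text \<open>Each neighbour determines one line through \<open>v\<close>, and two neighbours
  determine the same one exactly if they are adjacent. The right-hand side says that
  \<open>v\<close> is simplicial, which is the form used in connectivity arguments.\<close>

lemma hdeg_le_1_iff:
  assumes X: "X \<subseteq> V" and v: "v \<in> V"
  shows "hdeg X v \<le> 1 \<longleftrightarrow> clique {u \<in> X. E v u}"
proof -
  let ?S = "{L \<in> lines. v \<in> L \<and> L \<inter> (X - {v}) \<noteq> {}}"
  have "hdeg X v \<le> 1 \<longleftrightarrow> (\<forall>L\<in>?S. \<forall>L'\<in>?S. L = L')"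
    unfolding hdeg_def by (simp add: card_le_Suc0_iff_eq)
  also have "\<dots> \<longleftrightarrow> clique {u \<in> X. E v u}"
  proof
    assume eq: "\<forall>L\<in>?S. \<forall>L'\<in>?S. L = L'"
    show "clique {u \<in> X. E v u}"
      unfolding clique_def
    proof (intro ballI impI)
      fix a b assume ab: "a \<in> {u \<in> X. E v u}" "b \<in> {u \<in> X. E v u}" "a \<noteq> b"
      have "line v c \<in> ?S" if "c \<in> {u \<in> X. E v u}" for c
      proof -
        have "c \<in> line v c \<inter> (X - {v})" using that X E_neq[of v c] by auto
        moreover have "line v c \<in> lines" by (rule line_in_lines) (use that X v in auto)
        moreover have "v \<in> line v c" using v by simp
        ultimately show ?thesis by blast
      qed
      then have *: "line v a \<in> ?S" "line v b \<in> ?S" using ab(1,2) by blast+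
      then have eq': "line v a = line v b" using eq by blast
      have "a \<in> line v a" "b \<in> line v b" by (rule in_line, use ab X in auto)+
      then have "b \<in> line v a" by (simp only: eq')
      show "E a b" by (rule line_adj[OF _ _ \<open>b \<in> line v a\<close> ab(3)]) (use * \<open>a \<in> line v a\<close> in auto)
    qed
  next
    assume c: "clique {u \<in> X. E v u}"
    show "\<forall>L\<in>?S. \<forall>L'\<in>?S. L = L'"
    proof (intro ballI)
      fix L L' assume L: "L \<in> ?S" "L' \<in> ?S"
      then obtain a b where ab: "a \<in> L" "a \<in> X" "a \<noteq> v" "b \<in> L'" "b \<in> X" "b \<noteq> v" by auto
      then have E: "E v a" "E v b" using line_adj[of L v a] line_adj[of L' v b] L by auto
      then have "b = a \<or> E b a" using c ab by (auto simp: clique_def)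
      then have "b \<in> line v a" using ab X E by (auto simp: line_def intro: E_sym)
      then have "line v b = line v a" using line_eq[of "line v a" v b] line_in_lines[of v a] ab E v X by auto
      then show "L = L'" using line_eq[of L v a] line_eq[of L' v b] L ab by auto
    qed
  qed
  finally show ?thesis .
qed

text \<open>A longest path in \<open>X\<close> ends at a vertex \<open>v\<close> whose neighbours
  all lie on it. If \<open>v\<close> is not simplicial, some neighbour \<open>w\<close> is not
  adjacent to the vertex \<open>u\<close> next to \<open>v\<close> on the path, and the segment from
  \<open>v\<close> to \<open>w\<close> closes to a cycle that is no clique.\<close>

lemma block_set_leaf:
  assumes X: "X \<subseteq> V" and ne: "X \<noteq> {}" and block: "block_set X"
  shows "\<exists>v\<in>X. hdeg X v \<le> 1"
proof (rule ccontr)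
  assume "\<not> ?thesis"
  then have noleaf: "\<not> clique {u \<in> X. E v u}" if "v \<in> X" for v
    using hdeg_le_1_iff[OF X, of v] that X by auto
  have finX: "finite X" using X fin_V finite_subset by blast
  let ?P = "\<lambda>xs. distinct xs \<and> set xs \<subseteq> X \<and> successively E xs"
  have bound: "length xs < Suc (card X)" if "?P xs" for xs
    using that card_mono[OF finX, of "set xs"] by (auto simp: distinct_card)
  have nonnil: "\<exists>xs. ?P xs \<and> 1 < length xs"
  proof -
    obtain v where v: "v \<in> X" using ne by auto
    then obtain a where "a \<in> X" "E v a" using noleaf[OF v] by (auto simp: clique_def)
    then show ?thesis using v E_neq[of v a] by (intro exI[of _ "[v, a]"]) auto
  qed
  define xs where "xs = (ARG_MAX length xs. ?P xs)"
  obtain ys where ys: "?P ys" "1 < length ys" using nonnil by blast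
  have P: "?P xs" and longest: "\<And>zs. ?P zs \<Longrightarrow> length zs \<le> length xs"
    using arg_max_nat_lemma[of ?P ys length "Suc (card X)"] ys bound unfolding xs_def by blast+
  have "1 < length xs" using longest[OF ys(1)] ys(2) by simp
  define p where "p = rev xs"
  obtain v u r where p: "p = v # u # r"
    using \<open>1 < length xs\<close> unfolding p_def by (metis One_nat_def length_rev list.size(3,4) not_less_zero
        less_Suc0 list.exhaust add_0 less_irrefl plus_1_eq_Suc add.commute)
  have Pp: "distinct p" "set p \<subseteq> X" "successively E p"
    using P E_sym unfolding p_def by (auto simp: successively_rev intro: successively_mono)
  have vX: "v \<in> X" and uX: "u \<in> X" and vu: "E v u" using Pp p by auto
  \<comment> \<open>Otherwise all neighbours of \<open>v\<close> other than \<open>u\<close> are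
    adjacent to \<open>u\<close>, hence to each other by diamond-freeness, and \<open>v\<close>
    would be simplicial.\<close>
  have "\<exists>w\<in>X. E v w \<and> w \<noteq> u \<and> \<not> E w u"
  proof (rule ccontr)
    assume "\<not> ?thesis"
    then have *: "w = u \<or> E w u" if "w \<in> X" "E v w" for w using that by blast
    have "E a b" if "a \<in> X" "E v a" "b \<in> X" "E v b" "a \<noteq> b" for a b
    proof (cases "a = u \<or> b = u")
      case True
      then show ?thesis using *[of a] *[of b] that by (auto intro: E_sym)
    next
      case False
      then show ?thesis
        using no_diamondD[of a v u b] *[of a] *[of b] that vX uX vu X by (auto intro: E_sym)
    qed
    then show False using noleaf[OF vX] by (auto simp: clique_def)
  qed
  then obtain w where w: "w \<in> X" "E v w" "w \<noteq> u" "\<not> E w u" by blast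
  have "w \<in> set p"
  proof (rule ccontr)
    assume "w \<notin> set p"
    then have "distinct (w # p)" "set (w # p) \<subseteq> X" "successively E (w # p)"
      using Pp w p by (auto intro: E_sym)
    then have "?P (rev (w # p))"
      using E_sym by (auto simp: successively_rev simp del: successively.simps rev.simps intro: successively_mono)
    from longest[OF this] show False by (simp add: p_def)
  qed
  then have "w \<in> set r" using w p E_neq[of v w] by auto
  then obtain r1 r2 where r: "r = r1 @ w # r2" by (auto simp: in_set_conv_decomp)
  define c where "c = v # u # r1 @ [w]"
  have pc: "p = c @ r2" by (simp add: c_def p r)
  have "biconn (set c)"
  proof (rule biconn_cycle)
    show "successively E c" using Pp(3) unfolding pc by (simp add: successively_append_iff)
    show "distinct c" using Pp(1) unfolding pc by simp
    show "E (last c) (hd c)" using w E_sym by (simp add: c_def)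
    show "3 \<le> length c" by (simp add: c_def)
  qed
  moreover have "set c \<subseteq> X" using Pp(2) unfolding pc by simp
  ultimately have "clique (set c)" using block by (simp add: block_set_def)
  then show False using w by (auto simp: clique_def c_def)
qed

lemma block_set_cyc_0:
  assumes "X \<subseteq> V" "block_set X"
  shows "cyc X = 0"
proof -
  have "finite X" using assms fin_V finite_subset by blast
  then show ?thesis using assms
  proof (induction X rule: finite_psubset_induct)
    case (psubset X)
    show ?case
    proof (cases "X = {}")
      case False
      then obtain v where v: "v \<in> X" "hdeg X v \<le> 1"
        using block_set_leaf psubset.prems by blast
      then have "cyc (X - {v}) = 0"
        using psubset.prems block_set_mono[of X "X - {v}"] by (intro psubset.IH) auto
      then show ?thesis using cyc_remove_leaf[OF psubset.hyps(1) v(2)] by simp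
    qed simp
  qed
qed

text \<open>Two neighbours of a simplicial vertex are adjacent, so a path through \<open>v\<close>
  can bypass it.\<close>

lemma conn_remove_simplicial:
  assumes "conn W" "clique {u \<in> W. E v u}"
  shows "conn (W - {v})"
  unfolding conn_def
proof (intro ballI)
  let ?R = "{(a, b). a \<in> W \<and> b \<in> W \<and> E a b}"
  let ?R' = "{(a, b). a \<in> W - {v} \<and> b \<in> W - {v} \<and> E a b}"
  fix x y assume x: "x \<in> W - {v}" and y: "y \<in> W - {v}"
  have "(x, y) \<in> ?R\<^sup>*" using assms x y by (auto simp: conn_def)
  \<comment> \<open>While the path is at \<open>v\<close>, the induction keeps a neighbour of
    \<open>v\<close> reached without \<open>v\<close>; it equals or is adjacent to the next vertex
    of the path.\<close>
  then have "(y \<noteq> v \<longrightarrow> (x, y) \<in> ?R'\<^sup>*) \<and>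
      (y = v \<longrightarrow> (\<exists>z\<in>W - {v}. E v z \<and> (x, z) \<in> ?R'\<^sup>*))"
  proof induction
    case base
    then show ?case using x by auto
  next
    case (step y z)
    have yz: "y \<in> W" "z \<in> W" "E y z" using step.hyps by auto
    show ?case
    proof (cases "z = v")
      case True
      then have "y \<noteq> v" using yz E_neq[of y z] by auto
      then show ?thesis using step.IH yz True by (auto intro: E_sym)
    next
      case z: False
      show ?thesis
      proof (cases "y = v")
        case True
        then obtain t where t: "t \<in> W - {v}" "E v t" "(x, t) \<in> ?R'\<^sup>*" using step.IH by auto
        have "t = z \<or> E t z" using assms(2) t yz True by (auto simp: clique_def)
        then show ?thesis using t z yz by (auto intro: rtrancl_into_rtrancl)
      next
        case False
        then have "(y, z) \<in> ?R'" using yz z by auto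
        then show ?thesis using step.IH False z by (auto intro: rtrancl_into_rtrancl)
      qed
    qed
  qed
  then show "(x, y) \<in> ?R'\<^sup>*" using y by auto
qed

lemma conn_ex_adj:
  assumes "conn W" "v \<in> W" "u \<in> W" "u \<noteq> v"
  shows "\<exists>w\<in>W. E v w"
proof -
  have "(v, u) \<in> {(a, b). a \<in> W \<and> b \<in> W \<and> E a b}\<^sup>*" using assms by (auto simp: conn_def)
  then show ?thesis using assms(4) by (cases rule: converse_rtranclE) auto
qed

text \<open>The second neighbour comes from the connectivity of \<open>W - {a}\<close>, where
  \<open>a\<close> is the first.\<close>

lemma biconn_two_adj:
  assumes "biconn W" "v \<in> W"
  shows "\<exists>a\<in>W. \<exists>b\<in>W. a \<noteq> b \<and> E v a \<and> E v b"
proof -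
  have W: "finite W" "3 \<le> card W" using assms card_ge_0_finite[of W] by (auto simp: biconn_def)
  have other: "\<exists>u\<in>W - {v} - B. True" if "card B \<le> 1" "finite B" for B
  proof (rule ccontr)
    assume "\<not> ?thesis"
    then have "W \<subseteq> insert v B" by auto
    then have "card W \<le> card (insert v B)" using that by (intro card_mono) auto
    also have "\<dots> \<le> Suc (card B)" by (rule card_insert_le_m1) auto
    finally show False using W that by simp
  qed
  obtain u where u: "u \<in> W" "u \<noteq> v" using other[of "{}"] by auto
  then obtain a where a: "a \<in> W" "E v a" using conn_ex_adj[of W v u] assms by (auto simp: biconn_def)
  obtain t where t: "t \<in> W - {a}" "t \<noteq> v" using other[of "{a}"] by auto
  moreover have "v \<in> W - {a}" using assms a E_neq by auto
  ultimately obtain b where "b \<in> W - {a}" "E v b"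
    using conn_ex_adj[of "W - {a}" v t] assms a by (auto simp: biconn_def)
  then show ?thesis using a by auto
qed

text \<open>Induction along leaves. If a leaf \<open>v\<close> lies in a biconnected
  \<open>W\<close>, then \<open>W - {v}\<close> is a clique, and a vertex of it not adjacent to
  \<open>v\<close> would form a diamond with \<open>v\<close> and two adjacent neighbours of
  \<open>v\<close>.\<close>

lemma cyc_0_block_set:
  assumes "X \<subseteq> V" "cyc X = 0"
  shows "block_set X"
proof -
  have "finite X" using assms fin_V finite_subset by blast
  then show ?thesis using assms
  proof (induction X rule: finite_psubset_induct)
    case (psubset X)
    show ?case
    proof (cases "X = {}")
      case True
      then show ?thesis by (auto simp: block_set_def clique_def)
    next
      case False
      then obtain v where v: "v \<in> X" "hdeg X v \<le> 1"
        using ex_leaf psubset by blast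
      have IH: "block_set (X - {v})"
        using psubset.prems cyc_remove_leaf[OF psubset.hyps(1) v(2)] v by (intro psubset.IH) auto
      have simplicial: "clique {u \<in> X. E v u}"
        using hdeg_le_1_iff[of X v] v psubset.prems by auto
      show ?thesis
        unfolding block_set_def
      proof (intro allI impI)
        fix W assume WX: "W \<subseteq> X" and W: "biconn W"
        show "clique W"
        proof (cases "v \<in> W")
          case False
          then show ?thesis by (intro block_setD[OF IH _ W]) (use WX in auto)
        next
          case vW: True
          have finW: "finite W" using WX psubset.hyps finite_subset by blast
          obtain a b where ab: "a \<in> W" "b \<in> W" "a \<noteq> b" "E v a" "E v b"
            using biconn_two_adj[OF W vW] by auto
          have Eab: "E a b" using ab simplicial WX by (auto simp: clique_def)
          have simpW: "clique {u \<in> W'. E v u}" if "W' \<subseteq> W" for W'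
            using simplicial WX that by (auto simp: clique_def)
          have "clique (W - {v})"
          \<comment> \<open>With three vertices, \<open>W - {v}\<close> is just the edge
            \<open>ab\<close> and too small to be biconnected.\<close>
          proof (cases "card W = 3")
            case True
            then have "card (W - {v}) = 2" using vW finW by simp
            moreover have "{a, b} \<subseteq> W - {v}" using ab E_neq[of v a] E_neq[of v b] by auto
            ultimately have "W - {v} = {a, b}"
              using card_subset_eq[of "W - {v}" "{a, b}"] finW ab by auto
            then show ?thesis using Eab by (auto simp: clique_def intro: E_sym)
          next
            case False
            have "biconn (W - {v})"
              unfolding biconn_def
            proof (intro conjI ballI)
              show "3 \<le> card (W - {v})" using False W vW finW by (auto simp: biconn_def)
              show "conn (W - {v})" using W vW by (auto simp: biconn_def)
              fix u assume u: "u \<in> W - {v}"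
              have "conn (W - {u} - {v})"
              proof (rule conn_remove_simplicial)
                show "conn (W - {u})" using W u by (auto simp: biconn_def)
                show "clique {w \<in> W - {u}. E v w}" by (rule simpW) auto
              qed
              moreover have "W - {u} - {v} = W - {v} - {u}" by auto
              ultimately show "conn (W - {v} - {u})" by simp
            qed
            then show ?thesis by (rule block_setD[OF IH, rotated]) (use WX in auto)
          qed
          then have cl: "E x y" if "x \<in> W" "y \<in> W" "x \<noteq> v" "y \<noteq> v" "x \<noteq> y" for x y
            using that by (auto simp: clique_def)
          have adj: "E v c" if c: "c \<in> W" "c \<noteq> v" for c
          proof (cases "c = a \<or> c = b")
            case True
            then show ?thesis using ab by auto
          next
            case False
            have WV: "W \<subseteq> V" using WX psubset.prems by auto
            have nv: "a \<noteq> v" "b \<noteq> v" using ab E_neq by auto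
            have "E a c" "E b c" using cl ab(1,2) c nv False by auto
            then show ?thesis
              using no_diamondD[of v a b c] ab Eab c vW WV by blast
          qed
          show ?thesis
            unfolding clique_def using cl adj E_sym by blast
        qed
      qed
    qed
  qed
qed

end

text \<open>Neighbourhoods are disjoint unions of cliques, which are counted by their least elements.\<close>

lemma (in diamond_free_graph) hdeg_eq_card_least:
  fixes ord :: "'a \<Rightarrow> nat"
  assumes X: "X \<subseteq> V" and v: "v \<in> V" and inj: "inj_on ord V"
  shows "hdeg X v = card {u \<in> X. E v u \<and> \<not> (\<exists>t\<in>X. ord t < ord u \<and> E v t \<and> E u t)}"
proof -
  let ?S = "{L \<in> lines. v \<in> L \<and> L \<inter> (X - {v}) \<noteq> {}}"
  let ?R = "{u \<in> X. E v u \<and> \<not> (\<exists>t\<in>X. ord t < ord u \<and> E v t \<and> E u t)}"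
  have "bij_betw (line v) ?R ?S"
    unfolding bij_betw_def
  proof
    show "inj_on (line v) ?R"
    proof (rule inj_onI)
      fix a b assume ab: "a \<in> ?R" "b \<in> ?R" "line v a = line v b"
      have "a \<in> line v a" by (rule in_line) (use ab X in auto)
      then have "a \<in> line v b" using ab(3) by simp
      then have "a = b \<or> E a b" using ab E_neq[of v a] by (auto simp: line_def)
      moreover have "\<not> ord a < ord b" if "E a b" using ab that by (auto intro: E_sym)
      moreover have "\<not> ord b < ord a" if "E a b" using ab that by (auto intro: E_sym)
      moreover have "ord a = ord b \<Longrightarrow> a = b" using inj_onD[OF inj, of a b] ab(1,2) X by auto
      ultimately show "a = b" by (meson linorder_neqE_nat)
    qed
    show "line v ` ?R = ?S"
    proof
      show "line v ` ?R \<subseteq> ?S"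
      proof
        fix L assume "L \<in> line v ` ?R"
        then obtain u where u: "L = line v u" "u \<in> X" "E v u" by auto
        then have "u \<in> L \<inter> (X - {v})" "v \<in> L" using X v E_neq[of v u] by auto
        then show "L \<in> ?S" using u line_in_lines[of v u] v X by auto
      qed
      show "?S \<subseteq> line v ` ?R"
      proof
        fix L assume L: "L \<in> ?S"
        obtain u where u: "u \<in> L \<inter> (X - {v})" and least: "\<And>t. t \<in> L \<inter> (X - {v}) \<Longrightarrow> ord u \<le> ord t"
          using L arg_min_nat_lemma[of "\<lambda>t. t \<in> L \<inter> (X - {v})" _ ord] by blast
        have Evu: "E v u" using line_adj[of L v u] L u by auto
        have Leq: "line v u = L" using line_eq[of L v u] L u by auto
        have "\<not> (ord t < ord u \<and> E v t \<and> E u t)" if "t \<in> X" for t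
        proof
          assume t: "ord t < ord u \<and> E v t \<and> E u t"
          then have "t \<in> line v u" using that X by (auto simp: line_def intro: E_sym)
          then show False using least[of t] t that Leq E_neq[of v t] by auto
        qed
        then show "L \<in> line v ` ?R" using u Evu Leq by blast
      qed
    qed
  qed
  from bij_betw_same_card[OF this] show ?thesis unfolding hdeg_def by (rule sym)
qed

section \<open>Block graphs as digraphs\<close>

definition pair_induced :: "'a pair_pre_digraph \<Rightarrow> 'a set \<Rightarrow> 'a pair_pre_digraph" where
  "pair_induced G W = \<lparr>pverts = W, parcs = {(a, b) \<in> parcs G. a \<in> W \<and> b \<in> W}\<rparr>"

lemma pair_induced_simps [simp]:
  "pverts (pair_induced G W) = W"
  "parcs (pair_induced G W) = {(a, b) \<in> parcs G. a \<in> W \<and> b \<in> W}"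
  by (simp_all add: pair_induced_def)

lemma induce_with_proj: "with_proj G \<restriction> W = with_proj (pair_induced G W)"
  by (auto simp: induce_subgraph_def with_proj_def pair_induced_def)

lemma del_vert_pair_induced:
  "pre_digraph.del_vert (with_proj (pair_induced G W)) v = with_proj (pair_induced G (W - {v}))"
  by (auto simp: pre_digraph.del_vert_def with_proj_def pair_induced_def)

lemma pair_graph_induced:
  assumes "pair_graph G" "W \<subseteq> pverts G"
  shows "pair_graph (pair_induced G W)"
proof -
  interpret G: pair_graph G by fact
  show ?thesis
  proof unfold_locales
    show "finite (pverts (pair_induced G W))"
      using finite_subset[OF assms(2) G.pair_finite_verts] by simp
    show "finite (parcs (pair_induced G W))"
      by (rule finite_subset[OF _ G.pair_finite_arcs]) auto
    show "symmetric (with_proj (pair_induced G W))"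
      by (auto simp: symmetric_def sym_def intro: G.arcs_symmetric)
  qed (auto dest: G.no_loops')
qed

locale pair_graph_adj = pair_graph G for G :: "'a pair_pre_digraph"
begin

abbreviation adj :: "'a \<Rightarrow> 'a \<Rightarrow> bool" where
  "adj a b \<equiv> (a, b) \<in> parcs G"

sublocale sg: simple_graph adj
  by unfold_locales (auto intro: arcs_symmetric dest: no_loops')

abbreviation ind :: "'a set \<Rightarrow> ('a, 'a \<times> 'a) pre_digraph" where
  "ind W \<equiv> with_proj (pair_induced G W)"

lemma graph_ind: "W \<subseteq> pverts G \<Longrightarrow> graph (ind W)"
  using pair_graph.pair_graphD_graph[OF pair_graph_induced] pair_graph_axioms by blast

text \<open>\<open>connected\<close> refers to the symmetric closure of \<open>H\<close>. Its arcs
  are edges of the symmetric \<open>G\<close>, so the closure leads to no new adjacency.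
  \<open>H\<close> may be any subgraph, induced or not.\<close>

lemma connected_imp_conn:
  assumes "connected H" and ends: "arcs_ends H \<subseteq> parcs G" and W: "verts H = W"
  shows "sg.conn W"
  unfolding sg.conn_def
proof (intro ballI)
  fix x y assume "x \<in> W" "y \<in> W"
  then have "(x, y) \<in> rtrancl_on W (parcs (mk_symmetric H))"
    using assms(1) W by (auto simp: connected_def strongly_connected_def reachable_def)
  then show "(x, y) \<in> {(a, b). a \<in> W \<and> b \<in> W \<and> adj a b}\<^sup>*"
  proof (induction rule: rtrancl_on_induct)
    case (step y z)
    have "adj y z" using step(2) ends arcs_symmetric
      by (auto simp: parcs_mk_symmetric arcs_ends_conv)
    then show ?case using step by (auto intro: rtrancl_into_rtrancl)
  qed simp
qed

lemma conn_imp_connected: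
  assumes "sg.conn W" "W \<noteq> {}"
  shows "connected (ind W)"
  unfolding connected_def
proof (rule strongly_connectedI)
  fix x y assume "x \<in> verts (with_proj (mk_symmetric (ind W)))" "y \<in> verts (with_proj (mk_symmetric (ind W)))"
  then have xy: "x \<in> W" "y \<in> W" by auto
  then have "(x, y) \<in> {(a, b). a \<in> W \<and> b \<in> W \<and> adj a b}\<^sup>*"
    using assms by (auto simp: sg.conn_def)
  then have "(x, y) \<in> rtrancl_on W (parcs (mk_symmetric (ind W)))"
  proof induction
    case (step y z)
    then have "(y, z) \<in> parcs (mk_symmetric (ind W))"
      by (auto simp: parcs_mk_symmetric intro!: bexI[of _ "(y, z)"])
    then show ?case using step by (auto intro: rtrancl_on_into_rtrancl_on)
  qed (use xy in simp)
  then show "x \<rightarrow>\<^sup>*\<^bsub>with_proj (mk_symmetric (ind W))\<^esub> y" by (simp add: reachable_def)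
qed (use assms in simp)

lemma two_connected_imp_biconn:
  assumes two: "two_connected H" and ends: "arcs_ends H \<subseteq> parcs G"
  shows "sg.biconn (verts H)"
  unfolding sg.biconn_def
proof (intro conjI ballI)
  show "3 \<le> card (verts H)" using two by (simp add: two_connected_def)
  show "sg.conn (verts H)"
    by (rule connected_imp_conn[OF _ ends]) (use two in \<open>auto simp: two_connected_def\<close>)
  fix v assume "v \<in> verts H"
  then have "connected (pre_digraph.del_vert H v)" using two by (simp add: two_connected_def)
  moreover have "arcs_ends (pre_digraph.del_vert H v) \<subseteq> parcs G"
    using ends by (auto simp: arcs_ends_conv pre_digraph.del_vert_def)
  moreover have "verts (pre_digraph.del_vert H v) = verts H - {v}"
    by (simp add: pre_digraph.del_vert_def)
  ultimately show "sg.conn (verts H - {v})" by (rule connected_imp_conn)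
qed

lemma biconn_imp_two_connected:
  assumes W: "W \<subseteq> pverts G" and bi: "sg.biconn W"
  shows "two_connected (ind W)"
proof -
  have "W \<noteq> {}" using bi by (auto simp: sg.biconn_def)
  moreover have "W - {v} \<noteq> {}" for v
  proof
    assume "W - {v} = {}"
    then have "card W \<le> card {v}" by (intro card_mono) auto
    then show False using bi by (simp add: sg.biconn_def)
  qed
  ultimately show ?thesis
    unfolding two_connected_def
    using graph_ind[OF W] bi
    by (auto simp: sg.biconn_def del_vert_pair_induced intro!: conn_imp_connected)
qed

lemma subgraph_ind:
  assumes "W \<subseteq> X" "X \<subseteq> pverts G"
  shows "subgraph (ind W) (ind X)"
proof -
  have "wf_digraph (ind Y)" if "Y \<subseteq> pverts G" for Y
    using graph_ind[OF that] unfolding graph_def digraph_def fin_digraph_def by blast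
  then show ?thesis using assms by (intro subgraphI) auto
qed

lemma subgraph_ind_ends:
  assumes "subgraph H (ind X)"
  shows "verts H \<subseteq> X" "arcs_ends H \<subseteq> parcs G" "arcs H \<subseteq> parcs (pair_induced G (verts H))"
proof -
  have *: "arcs H \<subseteq> parcs (pair_induced G X)" "tail H = fst" "head H = snd"
    using assms by (auto simp: subgraph_def compatible_def)
  show "verts H \<subseteq> X" using assms by (auto simp: subgraph_def)
  show "arcs_ends H \<subseteq> parcs G" using * by (auto simp: arcs_ends_conv)
  have "wf_digraph H" using assms by (auto simp: subgraph_def)
  then show "arcs H \<subseteq> parcs (pair_induced G (verts H))"
    using * wf_digraph.tail_in_verts[of H] wf_digraph.head_in_verts[of H] by fastforce
qed

lemma subgraph_ind_eqI:
  assumes "subgraph H (ind X)" "subgraph (ind (verts H)) H"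
  shows "H = ind (verts H)"
proof -
  have "arcs H = parcs (pair_induced G (verts H))"
    using subgraph_ind_ends(3)[OF assms(1)] assms(2) by (auto simp: subgraph_def)
  moreover have "tail H = fst" "head H = snd" using assms(1) by (auto simp: subgraph_def compatible_def)
  ultimately show ?thesis
    by (intro pre_digraph.equality) (auto simp: with_proj_def)
qed

text \<open>A 2-connected subgraph stays so when all edges between its vertices are added; hence the
  maximal ones are induced and amount to vertex sets. Conversely every biconnected set extends to a
  maximal one, and cliques pass to subsets.\<close>

lemma block_graph_iff:
  assumes X: "X \<subseteq> pverts G"
  shows "block_graph (with_proj G \<restriction> X) \<longleftrightarrow> sg.block_set X"
proof
  assume block: "block_graph (with_proj G \<restriction> X)"
  show "sg.block_set X"
    unfolding sg.block_set_def
  proof (intro allI impI)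
    fix W assume WX: "W \<subseteq> X" and W: "sg.biconn W"
    have fin: "finite {W'. W' \<subseteq> X \<and> sg.biconn W'}"
      using finite_subset[OF X] pair_finite_verts by simp
    obtain M where M: "M \<subseteq> X" "sg.biconn M" "W \<subseteq> M"
      and "\<forall>W'\<in>{W'. W' \<subseteq> X \<and> sg.biconn W'}. M \<subseteq> W' \<longrightarrow> M = W'"
      using finite_has_maximal2[OF fin, of W] WX W by blast
    then have maximal: "\<And>W'. W' \<subseteq> X \<Longrightarrow> sg.biconn W' \<Longrightarrow> M \<subseteq> W' \<Longrightarrow> W' = M"
      by blast
    have "pre_digraph.max_subgraph (ind X) two_connected (ind M)"
      unfolding pre_digraph.max_subgraph_def
    proof (intro conjI allI impI notI)
      show "subgraph (ind M) (ind X)" by (rule subgraph_ind[OF M(1) X])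
      show "two_connected (ind M)" by (rule biconn_imp_two_connected) (use M X in auto)
      fix H assume H: "H \<noteq> ind M \<and> subgraph (ind M) H" "subgraph H (ind X) \<and> two_connected H"
      have "verts H = M"
      proof (rule maximal)
        show "verts H \<subseteq> X" "sg.biconn (verts H)"
          using H two_connected_imp_biconn subgraph_ind_ends by blast+
        show "M \<subseteq> verts H" using H by (auto simp: subgraph_def)
      qed
      then show False using subgraph_ind_eqI[of H X] H by simp
    qed
    then have "complete_digraph (card M) (ind M)"
      using block by (auto simp: block_graph_def induce_with_proj)
    then have "parcs (pair_induced G M) = {(u, v). (u, v) \<in> M \<times> M \<and> u \<noteq> v}"
      by (simp add: complete_digraph_def del: pair_induced_simps(2))
    then show "sg.clique W" using M(3) by (auto simp: sg.clique_def set_eq_iff)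
  qed
next
  assume block: "sg.block_set X"
  show "block_graph (with_proj G \<restriction> X)"
    unfolding block_graph_def induce_with_proj
  proof (intro conjI allI impI)
    show "graph (ind X)" by (rule graph_ind[OF X])
    fix H assume H: "pre_digraph.max_subgraph (ind X) two_connected H"
    then have sub: "subgraph H (ind X)" and two: "two_connected H"
      by (auto simp: pre_digraph.max_subgraph_def)
    let ?W = "verts H"
    have WX: "?W \<subseteq> X" by (rule subgraph_ind_ends[OF sub])
    have bi: "sg.biconn ?W" using two_connected_imp_biconn two subgraph_ind_ends[OF sub] by blast
    then have clique: "sg.clique ?W" using block WX by (simp add: sg.block_set_def)
    have "subgraph H (ind ?W)"
    proof (rule subgraphI)
      show "arcs H \<subseteq> arcs (ind ?W)" using subgraph_ind_ends[OF sub] by simp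
      show "compatible (ind ?W) H" using sub by (auto simp: subgraph_def compatible_def)
      show "wf_digraph H" using sub by (auto simp: subgraph_def)
      show "wf_digraph (ind ?W)" using subgraph_ind[OF WX X] by (auto simp: subgraph_def)
    qed simp
    moreover have "two_connected (ind ?W)" by (rule biconn_imp_two_connected) (use bi WX X in auto)
    moreover have "subgraph (ind ?W) (ind X)" by (rule subgraph_ind[OF WX X])
    ultimately have "H = ind ?W" using H unfolding pre_digraph.max_subgraph_def by metis
    moreover have "complete_digraph (card ?W) (ind ?W)"
      unfolding complete_digraph_def
      using graph_ind[of ?W] WX X clique no_loops' by (auto simp: sg.clique_def sg.E_irrefl)
    ultimately show "complete_digraph (card ?W) H" by simp
  qed
qed

end

section \<open>Transport of block sets along injections\<close>

lemma rtrancl_map: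
  assumes "(x, y) \<in> R\<^sup>*" "\<And>a b. (a, b) \<in> R \<Longrightarrow> (f a, f b) \<in> S"
  shows "(f x, f y) \<in> S\<^sup>*"
  using assms(1) by induction (auto intro: rtrancl_into_rtrancl assms(2))

text \<open>The program works on positions in the enumeration \<open>vs\<close>, the theorem on
  vertices; this passes from one to the other.\<close>

lemma block_set_image:
  assumes sg: "simple_graph E" "simple_graph (\<lambda>a b. E (f a) (f b))" and inj: "inj_on f X"
  shows "simple_graph.block_set E (f ` X) \<longleftrightarrow> simple_graph.block_set (\<lambda>a b. E (f a) (f b)) X"
proof -
  interpret A: simple_graph E by fact
  interpret B: simple_graph "\<lambda>a b. E (f a) (f b)" by fact
  have conn: "A.conn (f ` W) \<longleftrightarrow> B.conn W" if W: "W \<subseteq> X" for W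
  proof -
    let ?R = "{(a, b). a \<in> f ` W \<and> b \<in> f ` W \<and> E a b}"
    let ?S = "{(a, b). a \<in> W \<and> b \<in> W \<and> E (f a) (f b)}"
    have injW: "inj_on f W" using inj W inj_on_subset by blast
    have "(f x, f y) \<in> ?R\<^sup>* \<longleftrightarrow> (x, y) \<in> ?S\<^sup>*" if xy: "x \<in> W" "y \<in> W" for x y
    proof
      assume "(f x, f y) \<in> ?R\<^sup>*"
      then have "(the_inv_into W f (f x), the_inv_into W f (f y)) \<in> ?S\<^sup>*"
        by (rule rtrancl_map) (use injW in \<open>auto simp: the_inv_into_f_f\<close>)
      then show "(x, y) \<in> ?S\<^sup>*" using injW xy by (simp add: the_inv_into_f_f)
    next
      assume "(x, y) \<in> ?S\<^sup>*"
      then show "(f x, f y) \<in> ?R\<^sup>*" by (rule rtrancl_map) auto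
    qed
    then show ?thesis by (auto simp: A.conn_def B.conn_def)
  qed
  have biconn: "A.biconn (f ` W) \<longleftrightarrow> B.biconn W" if W: "W \<subseteq> X" for W
  proof -
    have injW: "inj_on f W" using inj W inj_on_subset by blast
    have "f ` W - {f v} = f ` (W - {v})" if "v \<in> W" for v
      using injW that by (auto simp: inj_on_def)
    moreover have "card (f ` W) = card W" by (rule card_image[OF injW])
    moreover have "A.conn (f ` (W - {v})) \<longleftrightarrow> B.conn (W - {v})" for v by (rule conn) (use W in auto)
    ultimately show ?thesis using conn[OF W] by (simp add: A.biconn_def B.biconn_def)
  qed
  have clique: "A.clique (f ` W) \<longleftrightarrow> B.clique W" if W: "W \<subseteq> X" for W
  proof -
    have "f a = f b \<longleftrightarrow> a = b" if "a \<in> W" "b \<in> W" for a b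
      using inj W that by (auto simp: inj_on_def)
    then show ?thesis by (auto simp: A.clique_def B.clique_def)
  qed
  have "A.block_set (f ` X) \<longleftrightarrow> (\<forall>W\<subseteq>X. A.biconn (f ` W) \<longrightarrow> A.clique (f ` W))"
    unfolding A.block_set_def using subset_image_iff[of _ f X] by metis
  also have "\<dots> \<longleftrightarrow> B.block_set X" unfolding B.block_set_def using biconn clique by blast
  finally show ?thesis .
qed

section \<open>Local ratio with reverse delete\<close>

context diamond_free_graph
begin

definition feasible :: "'a set \<Rightarrow> 'a set \<Rightarrow> bool" where
  "feasible W F \<longleftrightarrow> cyc (W - F) = 0"

text \<open>One set \<open>F\<close> is measured against many sets \<open>W\<close>, so its vertices
  outside \<open>W\<close> are ignored instead of being excluded.\<close>

definition minimal_feasible :: "'a set \<Rightarrow> 'a set \<Rightarrow> bool" where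
  "minimal_feasible W F \<longleftrightarrow> feasible W F \<and> (\<forall>v\<in>F \<inter> W. \<not> feasible W (F - {v}))"

lemma feasible_mono:
  assumes "feasible W F" "W' - F' \<subseteq> W - F" "W \<subseteq> V"
  shows "feasible W' F'"
proof -
  have fin: "finite (W - F)" "finite (W' - F')"
    using assms finite_subset[OF assms(3) fin_V] by (auto intro: finite_subset)
  then show ?thesis
    using cyc_mono[OF fin(1) assms(2)] cyc_nonneg[OF fin(2)] assms(1) by (simp add: feasible_def)
qed

text \<open>A vertex of degree at most one in \<open>U\<close> keeps this property in
  \<open>U - Y\<close>, whatever \<open>Y\<close> is, so no feasibility question depends on
  it.\<close>

lemma feasible_remove_leaf:
  assumes "U \<subseteq> V" "hdeg U v \<le> 1"
  shows "feasible (U - {v}) Y \<longleftrightarrow> feasible U Y"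
proof -
  have fin: "finite (U - Y)" using finite_subset[OF assms(1) fin_V] by simp
  have "hdeg (U - Y) v \<le> 1" using hdeg_mono[of "U - Y" U v] assms(2) by auto
  moreover have "U - {v} - Y = U - Y - {v}" by auto
  ultimately show ?thesis using cyc_remove_leaf[OF fin, of v] by (simp add: feasible_def)
qed

text \<open>Stamp zero means that the vertex is not on the stack, in agreement with an array of
  zeros at the start.\<close>

definition stamped :: "('a \<Rightarrow> nat) \<Rightarrow> nat \<Rightarrow> 'a set" where
  "stamped T t = {v. 0 < T v \<and> T v \<le> t}"

text \<open>
  The invariant of the local ratio phase after \<open>t\<close> steps: \<open>U\<close> is the remaining vertex set, \<open>w\<close> the
  remaining weight, and the vertices put on the stack so far carry as stamp \<open>T\<close> the number of the
  step. The ghost set \<open>Ws\<close> records the sets \<open>U\<close> from which a weight function was split off, that is,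
  those for which the final solution has to be minimal.
\<close>

definition recorded :: "nat \<Rightarrow> ('a \<Rightarrow> nat) \<Rightarrow> ('a set \<times> nat) set \<Rightarrow> bool" where
  "recorded t T Ws \<longleftrightarrow> (\<forall>W \<tau>. (W, \<tau>) \<in> Ws \<longrightarrow> \<tau> \<le> t \<and> W \<inter> stamped T \<tau> = {} \<and>
     (\<forall>Y. feasible (V - stamped T \<tau>) Y \<longleftrightarrow> feasible W Y))"

text \<open>Local ratio read backwards: the bound on \<open>card F\<close> is promised provided that
  \<open>F\<close> is good for the remaining weights on \<open>U\<close>. Each split passes to the
  new weights, and for empty \<open>U\<close> the proviso is trivially true.\<close>

definition ratio_bound :: "('a set \<times> nat) set \<Rightarrow> 'a set \<Rightarrow> 'a set \<Rightarrow> ('a \<Rightarrow> nat) \<Rightarrow> bool" where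
  "ratio_bound Ws P U w \<longleftrightarrow> (\<forall>F H. F \<subseteq> U \<union> P \<longrightarrow> (\<forall>W \<tau>. (W, \<tau>) \<in> Ws \<longrightarrow> minimal_feasible W F) \<longrightarrow>
     feasible V H \<longrightarrow> sum w (F \<inter> U) \<le> 4 * sum w (H \<inter> U) \<longrightarrow> card F \<le> 4 * card (H \<inter> V))"

definition ratio_inv :: "nat \<Rightarrow> 'a set \<Rightarrow> ('a \<Rightarrow> nat) \<Rightarrow> ('a \<Rightarrow> nat) \<Rightarrow> bool" where
  "ratio_inv t U w T \<longleftrightarrow>
     U \<subseteq> V \<and> (\<forall>v\<in>U. T v = 0) \<and> (\<forall>v. T v \<le> t) \<and> (\<forall>v. 0 < T v \<longrightarrow> v \<in> V) \<and>
     (\<forall>Y. feasible (V - stamped T t) Y \<longleftrightarrow> feasible U Y) \<and>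
     (\<exists>Ws. recorded t T Ws \<and> ratio_bound Ws (stamped T t) U w)"

lemma recordedD:
  assumes "recorded t T Ws" "(W, \<tau>) \<in> Ws"
  shows "\<tau> \<le> t" "W \<inter> stamped T \<tau> = {}" "feasible (V - stamped T \<tau>) Y \<longleftrightarrow> feasible W Y"
  using assms by (auto simp: recorded_def)

lemma recorded_mono: "recorded t T Ws \<Longrightarrow> t \<le> t' \<Longrightarrow> recorded t' T Ws"
  unfolding recorded_def by (meson order_trans)

lemma ratio_boundI:
  assumes "\<And>F H. F \<subseteq> U \<union> P \<Longrightarrow> (\<And>W \<tau>. (W, \<tau>) \<in> Ws \<Longrightarrow> minimal_feasible W F) \<Longrightarrow>
     feasible V H \<Longrightarrow> sum w (F \<inter> U) \<le> 4 * sum w (H \<inter> U) \<Longrightarrow> card F \<le> 4 * card (H \<inter> V)"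
  shows "ratio_bound Ws P U w"
  unfolding ratio_bound_def using assms by blast

lemma ratio_boundD:
  assumes "ratio_bound Ws P U w" "F \<subseteq> U \<union> P" "\<And>W \<tau>. (W, \<tau>) \<in> Ws \<Longrightarrow> minimal_feasible W F"
    "feasible V H" "sum w (F \<inter> U) \<le> 4 * sum w (H \<inter> U)"
  shows "card F \<le> 4 * card (H \<inter> V)"
  using assms unfolding ratio_bound_def by blast

lemma ratio_invD:
  assumes "ratio_inv t U w T"
  shows "U \<subseteq> V" "\<And>v. v \<in> U \<Longrightarrow> T v = 0" "\<And>v. T v \<le> t" "\<And>v. 0 < T v \<Longrightarrow> v \<in> V"
    "\<And>Y. feasible (V - stamped T t) Y \<longleftrightarrow> feasible U Y"
  using assms by (simp_all add: ratio_inv_def)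

lemma ratio_invI:
  assumes "U \<subseteq> V" "\<And>v. v \<in> U \<Longrightarrow> T v = 0" "\<And>v. T v \<le> t" "\<And>v. 0 < T v \<Longrightarrow> v \<in> V"
    "\<And>Y. feasible (V - stamped T t) Y \<longleftrightarrow> feasible U Y"
    "recorded t T Ws" "ratio_bound Ws (stamped T t) U w"
  shows "ratio_inv t U w T"
  using assms unfolding ratio_inv_def by blast

section \<open>Transitions of the local ratio invariant\<close>

lemma ratio_inv_init:
  assumes "\<And>v. v \<in> V \<Longrightarrow> w v = 1"
  shows "ratio_inv 0 V w (\<lambda>_. 0)"
proof (rule ratio_invI)
  have *: "sum w (A \<inter> V) = card (A \<inter> V)" for A using assms by simp
  show "ratio_bound {} (stamped (\<lambda>_. 0) 0) V w"
    by (rule ratio_boundI) (simp add: * stamped_def, simp add: Int_absorb2)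
qed (auto simp: stamped_def recorded_def)

lemma stamped_Suc: "(\<And>v. T v \<le> t) \<Longrightarrow> stamped T (Suc t) = stamped T t"
  by (auto simp: stamped_def intro: le_SucI)

text \<open>A leaf is dropped without a stamp, so \<open>F\<close> cannot contain it. Counting it
  again changes nothing for \<open>F\<close> and can only help \<open>H\<close>.\<close>

lemma ratio_inv_leaf:
  assumes inv: "ratio_inv t U w T" and v: "v \<in> U" "hdeg U v \<le> 1"
  shows "ratio_inv (Suc t) (U - {v}) w T"
proof -
  note D = ratio_invD[OF inv]
  obtain Ws where Ws: "recorded t T Ws" and bound: "ratio_bound Ws (stamped T t) U w"
    using inv unfolding ratio_inv_def by blast
  have St: "stamped T (Suc t) = stamped T t" by (rule stamped_Suc) (rule D)
  show ?thesis
  proof (rule ratio_invI)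
    show "recorded (Suc t) T Ws" by (rule recorded_mono[OF Ws]) simp
    show "ratio_bound Ws (stamped T (Suc t)) (U - {v}) w"
      unfolding St
    proof (rule ratio_boundI)
      fix F H
      assume F: "F \<subseteq> (U - {v}) \<union> stamped T t" "\<And>W \<tau>. (W, \<tau>) \<in> Ws \<Longrightarrow> minimal_feasible W F"
        and H: "feasible V H" "sum w (F \<inter> (U - {v})) \<le> 4 * sum w (H \<inter> (U - {v}))"
      show "card F \<le> 4 * card (H \<inter> V)"
      proof (rule ratio_boundD[OF bound _ F(2) H(1)])
        show "F \<subseteq> U \<union> stamped T t" using F(1) by auto
        have "v \<notin> F" using F(1) D(2)[OF v(1)] by (auto simp: stamped_def)
        then have "F \<inter> U = F \<inter> (U - {v})" by auto
        moreover have "sum w (H \<inter> (U - {v})) \<le> sum w (H \<inter> U)"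
          using finite_subset[OF D(1) fin_V] by (intro sum_mono2) auto
        ultimately show "sum w (F \<inter> U) \<le> 4 * sum w (H \<inter> U)" using H(2) by simp
      qed
    qed
    show "feasible (V - stamped T (Suc t)) Y \<longleftrightarrow> feasible (U - {v}) Y" for Y
      unfolding St using D(5) feasible_remove_leaf[OF D(1) v(2)] by simp
    show "T u \<le> Suc t" for u using D(3)[of u] by simp
  qed (use D(1,2,4) in auto)
qed

text \<open>The loop always makes \<open>n\<close> rounds; those after \<open>U\<close> has become
  empty only advance the step count.\<close>

lemma ratio_inv_idle:
  assumes inv: "ratio_inv t {} w T"
  shows "ratio_inv (Suc t) {} w T"
proof -
  note D = ratio_invD[OF inv]
  obtain Ws where Ws: "recorded t T Ws" and bound: "ratio_bound Ws (stamped T t) {} w"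
    using inv unfolding ratio_inv_def by blast
  have St: "stamped T (Suc t) = stamped T t" by (rule stamped_Suc) (rule D)
  show ?thesis
  proof (rule ratio_invI)
    show "recorded (Suc t) T Ws" by (rule recorded_mono[OF Ws]) simp
    show "ratio_bound Ws (stamped T (Suc t)) {} w" unfolding St by (rule bound)
    show "feasible (V - stamped T (Suc t)) Y \<longleftrightarrow> feasible {} Y" for Y unfolding St by (rule D)
    show "T u \<le> Suc t" for u using D(3)[of u] by simp
  qed (use D(4) in auto)
qed

text \<open>Instead of subtracting \<open>w v / hdeg U v\<close> times the degrees, all weights are
  first scaled by \<open>hdeg U v\<close>. The least ratio keeps the new weights nonnegative and
  makes that of \<open>v\<close> zero. The pair \<open>(U, t)\<close> is recorded because
  \<open>local_ratio\<close> needs \<open>F\<close> minimal for \<open>U\<close>.\<close>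

lemma ratio_inv_push:
  assumes inv: "ratio_inv t U w T" and deg: "\<And>u. u \<in> U \<Longrightarrow> 2 \<le> hdeg U u"
    and v: "v \<in> U" and least: "\<And>u. u \<in> U \<Longrightarrow> w v * hdeg U u \<le> w u * hdeg U v"
    and w': "\<And>u. u \<in> U \<Longrightarrow> w' u = w u * hdeg U v - w v * hdeg U u"
  shows "ratio_inv (Suc t) (U - {v}) w' (T(v := Suc t))"
proof -
  let ?T = "T(v := Suc t)"
  note D = ratio_invD[OF inv]
  obtain Ws where Ws: "recorded t T Ws" and bound: "ratio_bound Ws (stamped T t) U w"
    using inv unfolding ratio_inv_def by blast
  have finU: "finite U" using finite_subset[OF D(1) fin_V] .
  have old: "stamped ?T \<tau> = stamped T \<tau>" if "\<tau> \<le> t" for \<tau>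
    using that D(2)[OF v] by (auto simp: stamped_def)
  have new: "stamped ?T (Suc t) = insert v (stamped T t)"
    using D(3) by (auto simp: stamped_def intro: le_SucI)
  have "card F \<le> 4 * card (H \<inter> V)"
    if F: "F \<subseteq> (U - {v}) \<union> stamped ?T (Suc t)"
        "\<And>W \<tau>. (W, \<tau>) \<in> insert (U, t) Ws \<Longrightarrow> minimal_feasible W F"
      and H: "feasible V H" "sum w' (F \<inter> (U - {v})) \<le> 4 * sum w' (H \<inter> (U - {v}))" for F H
  proof (rule ratio_boundD[OF bound _ _ H(1)])
    show "F \<subseteq> U \<union> stamped T t" using F(1) v unfolding new by auto
    show "minimal_feasible W F" if "(W, \<tau>) \<in> Ws" for W \<tau> using F(2) that by auto
    have min: "minimal_feasible U F" using F(2) by auto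
    \<comment> \<open>The weight of \<open>v\<close> has become zero, so taking \<open>v\<close> out
      of \<open>U\<close> costs nothing, whether or not \<open>F\<close> contains it.\<close>
    have drop: "sum w' (A \<inter> (U - {v})) = sum w' (A \<inter> U)" for A
    proof (rule sum.mono_neutral_left)
      show "\<forall>i\<in>A \<inter> U - A \<inter> (U - {v}). w' i = 0" using w'[of v] by auto
    qed (use finU in auto)
    \<comment> \<open>By \<open>least\<close> the truncated subtraction in \<open>w'\<close> is
      exact.\<close>
    have split: "sum w (A \<inter> U) * hdeg U v = sum w' (A \<inter> U) + w v * (\<Sum>u\<in>A \<inter> U. hdeg U u)" for A
    proof -
      have "w u * hdeg U v = w' u + w v * hdeg U u" if "u \<in> A \<inter> U" for u
        using that w'[of u] least[of u] by auto
      then show ?thesis by (simp add: sum_distrib_right sum_distrib_left flip: sum.distrib)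
    qed
    have "(\<Sum>u\<in>F \<inter> U. hdeg U u) \<le> 4 * (\<Sum>u\<in>H \<inter> U. hdeg U u)"
    proof (rule local_ratio[OF finU deg])
      have "U - (F \<inter> U) = U - F" by auto
      then show "cyc (U - (F \<inter> U)) = 0" using min by (simp add: minimal_feasible_def feasible_def)
      show "cyc (U - (F \<inter> U - {u})) \<noteq> 0" if "u \<in> F \<inter> U" for u
      proof -
        have "U - (F \<inter> U - {u}) = U - (F - {u})" by auto
        then show ?thesis using min that by (simp add: minimal_feasible_def feasible_def)
      qed
      have "U - (H \<inter> U) = U - H" by auto
      moreover have "feasible U H" by (rule feasible_mono[OF H(1)]) (use D(1) in auto)
      ultimately show "cyc (U - (H \<inter> U)) = 0" by (simp add: feasible_def)
    qed auto
    then have *: "w v * (\<Sum>u\<in>F \<inter> U. hdeg U u) \<le> 4 * (w v * (\<Sum>u\<in>H \<inter> U. hdeg U u))"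
      by (metis mult.left_commute mult_le_mono2)
    have "sum w (F \<inter> U) * hdeg U v \<le> 4 * (sum w (H \<inter> U) * hdeg U v)"
      using add_mono[OF H(2)[unfolded drop] *] unfolding split by (simp only: distrib_left)
    then have "sum w (F \<inter> U) * hdeg U v \<le> (4 * sum w (H \<inter> U)) * hdeg U v"
      by (simp only: mult.assoc)
    then show "sum w (F \<inter> U) \<le> 4 * sum w (H \<inter> U)"
      using deg[OF v] by simp
  qed
  then have bound': "ratio_bound (insert (U, t) Ws) (stamped ?T (Suc t)) (U - {v}) w'"
    by (rule ratio_boundI)
  have rec: "recorded (Suc t) ?T (insert (U, t) Ws)"
    unfolding recorded_def
  proof (intro allI impI)
    fix W \<tau> assume "(W, \<tau>) \<in> insert (U, t) Ws"
    then consider "W = U" "\<tau> = t" | "(W, \<tau>) \<in> Ws" by auto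
    then show "\<tau> \<le> Suc t \<and> W \<inter> stamped ?T \<tau> = {} \<and>
        (\<forall>Y. feasible (V - stamped ?T \<tau>) Y \<longleftrightarrow> feasible W Y)"
    proof cases
      case 1
      then show ?thesis using D(2,5) unfolding 1 old[OF order_refl] by (auto simp: stamped_def)
    next
      case 2
      have "\<tau> \<le> t" by (rule recordedD[OF Ws 2])
      then show ?thesis using recordedD[OF Ws 2] by (simp add: old)
    qed
  qed
  show ?thesis
  proof (rule ratio_invI[OF _ _ _ _ _ rec bound'])
    show "feasible (V - stamped ?T (Suc t)) Y \<longleftrightarrow> feasible (U - {v}) Y" for Y
    proof -
      have "V - insert v (stamped T t) - Y = V - stamped T t - insert v Y"
        "U - {v} - Y = U - insert v Y"
        by auto
      then show ?thesis using D(5)[of "insert v Y"] by (simp add: new feasible_def)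
    qed
    show "?T u \<le> Suc t" for u using D(3)[of u] by auto
    show "u \<in> V" if "0 < ?T u" for u using that D(1,4) v by (auto split: if_splits)
  qed (use D(1,2) in auto)
qed

text \<open>For a recorded pair \<open>(W, \<tau>)\<close>, a vertex \<open>v\<close> of
  \<open>F\<close> in \<open>W\<close> was stamped after \<tau>. All vertices stamped up to \<tau>
  have smaller stamps than \<open>v\<close>, so the single test of \<open>v\<close>, with every
  smaller stamp deleted, covers all such \<open>W\<close> at once.\<close>

lemma ratio_inv_final:
  assumes inv: "ratio_inv t {} w T"
    and F: "F \<subseteq> stamped T t" "feasible V F"
    and minimal: "\<And>v. v \<in> F \<Longrightarrow> \<not> feasible V ((F - {v}) \<union> {u. 0 < T u \<and> T u < T v})"
    and H: "feasible V H"
  shows "card F \<le> 4 * card (H \<inter> V)"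
proof -
  obtain Ws where Ws: "recorded t T Ws" and bound: "ratio_bound Ws (stamped T t) {} w"
    using inv unfolding ratio_inv_def by blast
  have "minimal_feasible W F" if W: "(W, \<tau>) \<in> Ws" for W \<tau>
    unfolding minimal_feasible_def
  proof (intro conjI ballI)
    have "feasible (V - stamped T \<tau>) F" by (rule feasible_mono[OF F(2)]) auto
    then show "feasible W F" using recordedD[OF Ws W] by simp
    fix v assume v: "v \<in> F \<inter> W"
    then have "\<tau> < T v" using recordedD[OF Ws W] F(1) by (auto simp: stamped_def)
    have "\<not> feasible (V - stamped T \<tau>) (F - {v})"
    proof
      assume "feasible (V - stamped T \<tau>) (F - {v})"
      then have "feasible V ((F - {v}) \<union> {u. 0 < T u \<and> T u < T v})"
        by (rule feasible_mono) (use \<open>\<tau> < T v\<close> in \<open>auto simp: stamped_def\<close>)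
      then show False using minimal v by auto
    qed
    then show "\<not> feasible W (F - {v})" using recordedD[OF Ws W] by simp
  qed
  then show ?thesis using F H by (intro ratio_boundD[OF bound]) auto
qed

end

section \<open>Loop programs\<close>

text \<open>
  The algorithm is written in a language whose only loops run through the numbers below \<open>n\<close>, so that
  its running time on the machine is polynomial by construction.
\<close>

datatype aexp = Num nat | Var nat | Arr nat nat | Adj nat nat | Add aexp aexp | Sub aexp aexp

datatype prog =
    PSkip
  | Set nat aexp
  | Put nat nat aexp
  | PSeq prog prog
  | Cond aexp prog prog
  | For nat prog

type_synonym astate = "(nat \<Rightarrow> nat) \<times> (nat \<Rightarrow> nat \<Rightarrow> nat)"

abbreviation upd :: "nat \<Rightarrow> nat \<Rightarrow> astate \<Rightarrow> astate" where
  "upd r x s \<equiv> ((fst s)(r := x), snd s)"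

primrec aval :: "(nat \<Rightarrow> nat \<Rightarrow> bool) \<Rightarrow> aexp \<Rightarrow> astate \<Rightarrow> nat" where
  "aval adj (Num k) s = k"
| "aval adj (Var r) s = fst s r"
| "aval adj (Arr c i) s = snd s c (fst s i)"
| "aval adj (Adj i j) s = of_bool (adj (fst s i) (fst s j))"
| "aval adj (Add a b) s = aval adj a s + aval adj b s"
| "aval adj (Sub a b) s = aval adj a s - aval adj b s"

primrec run :: "nat \<Rightarrow> (nat \<Rightarrow> nat \<Rightarrow> bool) \<Rightarrow> prog \<Rightarrow> astate \<Rightarrow> astate" where
  "run n adj PSkip s = s"
| "run n adj (Set r a) s = upd r (aval adj a s) s"
| "run n adj (Put c i a) s = (fst s, (snd s)(c := (snd s c)(fst s i := aval adj a s)))"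
| "run n adj (PSeq p q) s = run n adj q (run n adj p s)"
| "run n adj (Cond b p q) s = (if aval adj b s \<noteq> 0 then run n adj p s else run n adj q s)"
| "run n adj (For r p) s = upd r n (fold (\<lambda>i s. run n adj p (upd r i s)) [0..<n] s)"

text \<open>Arrays are indexed by the counters of enclosing loops only, which keeps all indices below
  the number of vertices.\<close>

primrec wf_aexp :: "nat set \<Rightarrow> aexp \<Rightarrow> bool" where
  "wf_aexp I (Num k) = True"
| "wf_aexp I (Var r) = True"
| "wf_aexp I (Arr c i) = (i \<in> I)"
| "wf_aexp I (Adj i j) = (i \<in> I \<and> j \<in> I)"
| "wf_aexp I (Add a b) = (wf_aexp I a \<and> wf_aexp I b)"
| "wf_aexp I (Sub a b) = (wf_aexp I a \<and> wf_aexp I b)"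

primrec wf_prog :: "nat set \<Rightarrow> prog \<Rightarrow> bool" where
  "wf_prog I PSkip = True"
| "wf_prog I (Set r a) = (r \<notin> I \<and> wf_aexp I a)"
| "wf_prog I (Put c i a) = (i \<in> I \<and> wf_aexp I a)"
| "wf_prog I (PSeq p q) = (wf_prog I p \<and> wf_prog I q)"
| "wf_prog I (Cond b p q) = (wf_aexp I b \<and> wf_prog I p \<and> wf_prog I q)"
| "wf_prog I (For r p) = (r \<notin> I \<and> wf_prog (insert r I) p)"

text \<open>
  Register 0 holds \<open>n\<close> and register 1 holds \<open>n * n\<close>. The cells from \<open>n * n\<close> on hold the row
  offsets \<open>i * n\<close> of the adjacency matrix, followed by the arrays.
\<close>

primrec base :: "nat \<Rightarrow> expr" where
  "base 0 = Reg 1"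
| "base (Suc c) = Plus (base c) (Reg 0)"

text \<open>Variable \<open>r\<close> lives in register \<open>r + 2\<close>. The product of
  \<open>n\<close> and a row number cannot be formed in constant time by additions, so a matrix
  access first looks up the row offset.\<close>

primrec comp_aexp :: "aexp \<Rightarrow> expr" where
  "comp_aexp (Num k) = Const k"
| "comp_aexp (Var r) = Reg (r + 2)"
| "comp_aexp (Arr c i) = Mem (Plus (base (Suc c)) (Reg (i + 2)))"
| "comp_aexp (Adj i j) = Mem (Plus (Mem (Plus (Reg 1) (Reg (i + 2)))) (Reg (j + 2)))"
| "comp_aexp (Add a b) = Plus (comp_aexp a) (comp_aexp b)"
| "comp_aexp (Sub a b) = Minus (comp_aexp a) (comp_aexp b)"

definition for_com :: "nat \<Rightarrow> com \<Rightarrow> com" where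
  "for_com r c = Seq (Assign r (Const 0))
     (While (Minus (Reg 0) (Reg r)) (Seq c (Assign r (Plus (Reg r) (Const 1)))))"

primrec comp_prog :: "prog \<Rightarrow> com" where
  "comp_prog PSkip = Skip"
| "comp_prog (Set r a) = Assign (r + 2) (comp_aexp a)"
| "comp_prog (Put c i a) = Store (Plus (base (Suc c)) (Reg (i + 2))) (comp_aexp a)"
| "comp_prog (PSeq p q) = Seq (comp_prog p) (comp_prog q)"
| "comp_prog (Cond b p q) = If (comp_aexp b) (comp_prog p) (comp_prog q)"
| "comp_prog (For r p) = for_com (r + 2) (comp_prog p)"

text \<open>A conditional is charged for both branches. Each iteration adds eight steps for loop
  test and increment; six cover the initialisation and the last test.\<close>

primrec time :: "prog \<Rightarrow> nat poly" where
  "time PSkip = 1"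
| "time (Set r a) = [:expr_cost (comp_aexp a) + 1:]"
| "time (Put c i a) = [:expr_cost (Plus (base (Suc c)) (Reg (i + 2))) + expr_cost (comp_aexp a) + 1:]"
| "time (PSeq p q) = time p + time q"
| "time (Cond b p q) = [:expr_cost (comp_aexp b) + 1:] + time p + time q"
| "time (For r p) = [:0, 1:] * (time p + [:8:]) + [:6:]"

section \<open>Machine runs with time bounds\<close>

definition bounded_exec :: "com \<Rightarrow> state \<Rightarrow> nat \<Rightarrow> (state \<Rightarrow> bool) \<Rightarrow> bool" where
  "bounded_exec c s T Q \<longleftrightarrow> (\<exists>t s'. exec c s t s' \<and> t \<le> T \<and> Q s')"

lemma bounded_exec_Seq:
  assumes "bounded_exec c s T Q" "\<And>s'. Q s' \<Longrightarrow> bounded_exec d s' T' Q'"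
  shows "bounded_exec (Seq c d) s (T + T') Q'"
  using assms unfolding bounded_exec_def by (meson add_mono exec_Seq)

lemma bounded_exec_Assign:
  "expr_cost e + 1 \<le> T \<Longrightarrow> Q ((fst s)(r := expr_val e s), snd s) \<Longrightarrow> bounded_exec (Assign r e) s T Q"
  unfolding bounded_exec_def using exec_Assign by blast

lemma bounded_exec_Store:
  "expr_cost a + expr_cost e + 1 \<le> T \<Longrightarrow> Q (fst s, (snd s)(expr_val a s := expr_val e s)) \<Longrightarrow>
    bounded_exec (Store a e) s T Q"
  unfolding bounded_exec_def using exec_Store by blast

lemma bounded_exec_mono:
  "bounded_exec c s T Q \<Longrightarrow> T \<le> T' \<Longrightarrow> (\<And>s'. Q s' \<Longrightarrow> Q' s') \<Longrightarrow> bounded_exec c s T' Q'"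
  unfolding bounded_exec_def by (meson order_trans)

lemma bounded_exec_for:
  assumes counter: "\<And>i s. P i s \<Longrightarrow> fst s 0 = n \<and> fst s r = i"
    and body: "\<And>i s. i < n \<Longrightarrow> P i s \<Longrightarrow>
      bounded_exec c s T (\<lambda>s'. P (Suc i) ((fst s')(r := Suc (fst s' r)), snd s'))"
    and init: "P 0 ((fst s)(r := 0), snd s)"
  shows "bounded_exec (for_com r c) s (n * (T + 8) + 6) (P n)"
proof -
  let ?w = "While (Minus (Reg 0) (Reg r)) (Seq c (Assign r (Plus (Reg r) (Const 1))))"
  \<comment> \<open>Induction on the number \<open>k\<close> of remaining iterations; the guard is a
    truncated difference, nonzero exactly while iterations remain.\<close>
  have loop: "bounded_exec ?w s (k * (T + 8) + 4) (P n)" if "P (n - k) s" "k \<le> n" for k s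
    using that
  proof (induction k arbitrary: s)
    case 0
    then have "expr_val (Minus (Reg 0) (Reg r)) s = 0" using counter[of n s] by simp
    from exec_WhileFalse[OF this] show ?case
      using 0 unfolding bounded_exec_def by (intro exI conjI) auto
  next
    case (Suc k)
    have "expr_val (Minus (Reg 0) (Reg r)) s \<noteq> 0" using counter[OF Suc.prems(1)] Suc.prems by simp
    note step = exec_WhileTrue[OF this]
    have "bounded_exec c s T (\<lambda>s'. P (n - k) ((fst s')(r := Suc (fst s' r)), snd s'))"
      using body[OF _ Suc.prems(1)] Suc.prems(2) by (simp add: Suc_diff_Suc)
    then have "bounded_exec (Seq c (Assign r (Plus (Reg r) (Const 1)))) s (T + 4) (P (n - k))"
      by (rule bounded_exec_Seq) (rule bounded_exec_Assign, auto)
    then obtain t s' where 1: "exec (Seq c (Assign r (Plus (Reg r) (Const 1)))) s t s'" "t \<le> T + 4" "P (n - k) s'"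
      unfolding bounded_exec_def by blast
    obtain u s'' where 2: "exec ?w s' u s''" "u \<le> k * (T + 8) + 4" "P n s''"
      using Suc.IH[OF 1(3)] Suc.prems(2) unfolding bounded_exec_def by auto
    have "expr_cost (Minus (Reg 0) (Reg r)) + 1 + t + u \<le> Suc k * (T + 8) + 4"
      using 1(2) 2(2) by (simp add: algebra_simps)
    then show ?case using step[OF 1(1) 2(1)] 2(3) unfolding bounded_exec_def by blast
  qed
  have "bounded_exec (for_com r c) s (2 + (n * (T + 8) + 4)) (P n)"
    unfolding for_com_def
  proof (rule bounded_exec_Seq)
    show "bounded_exec (Assign r (Const 0)) s 2 (P 0)"
      by (rule bounded_exec_Assign) (use init in auto)
    show "bounded_exec ?w s' (n * (T + 8) + 4) (P n)" if "P 0 s'" for s'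
      by (rule loop) (use that in auto)
  qed
  then show ?thesis by (rule bounded_exec_mono) auto
qed

section \<open>Simulation of loop programs on the machine\<close>

context
  fixes n :: nat and adj :: "nat \<Rightarrow> nat \<Rightarrow> bool"
begin

definition sim :: "astate \<Rightarrow> state \<Rightarrow> bool" where
  "sim s m \<longleftrightarrow> fst m 0 = n \<and> fst m 1 = n * n \<and> (\<forall>r. fst m (r + 2) = fst s r) \<and>
     (\<forall>i<n. snd m (n * n + i) = i * n) \<and>
     (\<forall>c. \<forall>i<n. snd m (n * n + Suc c * n + i) = snd s c i) \<and>
     (\<forall>i<n. \<forall>j<n. snd m (i * n + j) = of_bool (adj i j))"

lemma base_val: "sim s m \<Longrightarrow> expr_val (base c) m = n * n + c * n"
  by (induction c) (auto simp: sim_def)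

lemma comp_aexp_val:
  assumes "sim s m" "wf_aexp I a" "\<forall>i\<in>I. fst s i < n"
  shows "expr_val (comp_aexp a) m = aval adj a s"
  using assms(2)
proof (induction a)
  case (Arr c i)
  have "expr_val (base (Suc c)) m = n * n + Suc c * n" by (rule base_val[OF assms(1)])
  moreover have "fst s i < n" using Arr assms by auto
  moreover have "fst m (i + 2) = fst s i" using assms(1) by (simp add: sim_def)
  ultimately have "expr_val (comp_aexp (Arr c i)) m = snd m (n * n + Suc c * n + fst s i)"
    by (simp del: base.simps)
  then show ?case using assms(1) \<open>fst s i < n\<close> by (simp add: sim_def del: mult_Suc)
next
  case (Adj i j)
  then have "fst s i < n" "fst s j < n" using assms by auto
  then show ?case using assms(1) by (auto simp: sim_def)
qed (use assms(1) in \<open>auto simp: sim_def\<close>)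

lemma row_index_less:
  assumes "i < n" "j < (n::nat)"
  shows "i * n + j < n * n"
proof -
  have "Suc i * n \<le> n * n" using assms by (intro mult_le_mono1) simp
  then show ?thesis using assms by simp
qed

lemma array_index_eq_iff:
  assumes "i < n" "j < n"
  shows "c * n + i = d * n + j \<longleftrightarrow> c = d \<and> i = j"
proof
  assume eq: "c * n + i = d * n + j"
  have "(c * n + i) div n = c" "(d * n + j) div n = d" "(c * n + i) mod n = i" "(d * n + j) mod n = j"
    using assms by auto
  then show "c = d \<and> i = j" using eq by metis
qed simp

text \<open>The written address lies beyond the matrix and the offsets, and by division with
  remainder it belongs to one array cell only.\<close>

lemma sim_put:
  assumes sim: "sim s m" and i: "i < n"
  shows "sim (fst s, (snd s)(c := (snd s c)(i := x))) (fst m, (snd m)(n * n + Suc c * n + i := x))"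
  unfolding sim_def
proof (intro conjI allI impI)
  fix j assume j: "j < n"
  have "n * n + j \<noteq> n * n + Suc c * n + i" using j by simp
  then show "snd (fst m, (snd m)(n * n + Suc c * n + i := x)) (n * n + j) = j * n"
    using sim j by (simp add: sim_def)
next
  fix d j assume j: "j < n"
  have "n * n + Suc d * n + j = n * n + Suc c * n + i \<longleftrightarrow> d = c \<and> j = i"
    using array_index_eq_iff[OF j i, of "Suc d" "Suc c"] by (simp add: add.assoc)
  then show "snd (fst m, (snd m)(n * n + Suc c * n + i := x)) (n * n + Suc d * n + j) =
      snd (fst s, (snd s)(c := (snd s c)(i := x))) d j"
    using sim j by (auto simp: sim_def)
next
  fix k j assume kj: "k < n" "j < n"
  have "k * n + j \<noteq> n * n + Suc c * n + i" using row_index_less[OF kj] by simp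
  then show "snd (fst m, (snd m)(n * n + Suc c * n + i := x)) (k * n + j) = of_bool (adj k j)"
    using sim kj by (simp add: sim_def)
qed (use sim in \<open>auto simp: sim_def\<close>)

lemma sim_upd: "sim s m \<Longrightarrow> sim (upd r x s) ((fst m)(r + 2 := x), snd m)"
  by (simp add: sim_def)

lemma run_preserves_counters: "wf_prog I p \<Longrightarrow> r \<in> I \<Longrightarrow> fst (run n adj p s) r = fst s r"
proof (induction p arbitrary: I s)
  case (For q p)
  have "r \<noteq> q" using For.prems by auto
  have "fst (fold (\<lambda>i s. run n adj p (upd q i s)) xs s) r = fst s r" for xs s
    using For.IH[of "insert q I"] For.prems \<open>r \<noteq> q\<close> by (induction xs arbitrary: s) auto
  then show ?case using \<open>r \<noteq> q\<close> by simp
next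
  case (PSeq p q)
  then show ?case by (metis run.simps(4) wf_prog.simps(4))
qed auto

text \<open>The counters in \<open>I\<close> stay below \<open>n\<close>: no well-formed program
  writes to its enclosing counters, and a loop adds its own counter to \<open>I\<close>.\<close>

lemma comp_prog_sim:
  assumes "sim s m" "wf_prog I p" "\<forall>i\<in>I. fst s i < n"
  shows "bounded_exec (comp_prog p) m (poly (time p) n) (sim (run n adj p s))"
  using assms
proof (induction p arbitrary: I s m)
  case PSkip
  then show ?case unfolding bounded_exec_def using exec_Skip by (intro exI[of _ 1] exI[of _ m]) auto
next
  case (Set r a)
  have "expr_val (comp_aexp a) m = aval adj a s" by (rule comp_aexp_val) (use Set in auto)
  moreover have "sim (upd r (aval adj a s) s) ((fst m)(r + 2 := aval adj a s), snd m)"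
    using sim_upd Set.prems(1) .
  ultimately show ?case
    unfolding comp_prog.simps by (intro bounded_exec_Assign) auto
next
  case (Put c i a)
  have "expr_val (comp_aexp a) m = aval adj a s" by (rule comp_aexp_val) (use Put in auto)
  moreover have "expr_val (Plus (base (Suc c)) (Reg (i + 2))) m = n * n + Suc c * n + fst s i"
    using base_val[OF Put.prems(1), of "Suc c"] Put.prems(1) by (simp add: sim_def)
  moreover have "fst s i < n" using Put.prems by auto
  ultimately show ?case
    unfolding comp_prog.simps
    using sim_put[OF Put.prems(1), of "fst s i" c "aval adj a s"]
    by (intro bounded_exec_Store) (auto simp del: base.simps)
next
  case (PSeq p q)
  have 1: "bounded_exec (comp_prog p) m (poly (time p) n) (sim (run n adj p s))"
    by (rule PSeq.IH(1)) (use PSeq.prems in auto)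
  have "fst (run n adj p s) i = fst s i" if "i \<in> I" for i
    by (rule run_preserves_counters[OF _ that]) (use PSeq.prems in simp)
  then have 2: "bounded_exec (comp_prog q) m' (poly (time q) n) (sim (run n adj q (run n adj p s)))"
    if "sim (run n adj p s) m'" for m'
    by (intro PSeq.IH(2)[OF that]) (use PSeq.prems in auto)
  show ?case using bounded_exec_Seq[OF 1 2] by simp
next
  case (Cond b p q)
  have b: "expr_val (comp_aexp b) m = aval adj b s" by (rule comp_aexp_val) (use Cond in auto)
  show ?case
  proof (cases "aval adj b s \<noteq> 0")
    case True
    have "bounded_exec (comp_prog p) m (poly (time p) n) (sim (run n adj p s))"
      by (rule Cond.IH(1)) (use Cond.prems in auto)
    then obtain t m' where t: "exec (comp_prog p) m t m'" "t \<le> poly (time p) n" "sim (run n adj p s) m'"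
      unfolding bounded_exec_def by blast
    have "expr_val (comp_aexp b) m \<noteq> 0" using b True by simp
    from exec_IfTrue[OF this t(1), of "comp_prog q"] show ?thesis
      using t True unfolding bounded_exec_def
      by (intro exI[of _ "expr_cost (comp_aexp b) + 1 + t"] exI[of _ m']) auto
  next
    case False
    have "bounded_exec (comp_prog q) m (poly (time q) n) (sim (run n adj q s))"
      by (rule Cond.IH(2)) (use Cond.prems in auto)
    then obtain t m' where t: "exec (comp_prog q) m t m'" "t \<le> poly (time q) n" "sim (run n adj q s) m'"
      unfolding bounded_exec_def by blast
    have "expr_val (comp_aexp b) m = 0" using b False by simp
    from exec_IfFalse[OF this t(1), of "comp_prog p"] show ?thesis
      using t False unfolding bounded_exec_def
      by (intro exI[of _ "expr_cost (comp_aexp b) + 1 + t"] exI[of _ m']) auto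
  qed
next
  case (For r p)
  define F where "F i = fold (\<lambda>i s. run n adj p (upd r i s)) [0..<i] s" for i
  have F_Suc: "F (Suc i) = run n adj p (upd r i (F i))" for i by (simp add: F_def)
  have F_keep: "fst (F i) j = fst s j" if "j \<in> I" for i j
  proof (induction i)
    case (Suc i)
    have "j \<noteq> r" using For.prems that by auto
    then show ?case using Suc run_preserves_counters[of "insert r I" p j] For.prems that by (simp add: F_Suc)
  qed (simp add: F_def)
  have "bounded_exec (for_com (r + 2) (comp_prog p)) m (n * (poly (time p) n + 8) + 6) (sim (upd r n (F n)))"
  proof (rule bounded_exec_for[where P = "\<lambda>i. sim (upd r i (F i))"])
    show "fst m 0 = n \<and> fst m (r + 2) = i" if "sim (upd r i (F i)) m" for i m
      using that by (simp add: sim_def)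
    show "sim (upd r 0 (F 0)) ((fst m)(r + 2 := 0), snd m)"
      using sim_upd[OF For.prems(1)] by (simp add: F_def)
    fix i m assume i: "i < n" and m: "sim (upd r i (F i)) m"
    have "bounded_exec (comp_prog p) m (poly (time p) n) (sim (F (Suc i)))"
      unfolding F_Suc
      by (rule For.IH[of _ _ "insert r I"]) (use i m For.prems F_keep in auto)
    then show "bounded_exec (comp_prog p) m (poly (time p) n)
        (\<lambda>m'. sim (upd r (Suc i) (F (Suc i))) ((fst m')(r + 2 := Suc (fst m' (r + 2))), snd m'))"
    proof (rule bounded_exec_mono)
      fix m' assume m': "sim (F (Suc i)) m'"
      have "fst (F (Suc i)) r = i"
        using run_preserves_counters[of "insert r I" p r "upd r i (F i)"] For.prems by (simp add: F_Suc)
      then have "fst m' (r + 2) = i" using m' by (simp add: sim_def)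
      then show "sim (upd r (Suc i) (F (Suc i))) ((fst m')(r + 2 := Suc (fst m' (r + 2))), snd m')"
        using sim_upd[OF m', of r "Suc i"] by simp
    qed simp
  qed
  then show ?case by (simp add: F_def add.commute)
qed

end

section \<open>Preparation of the input and delivery of the output\<close>

definition prelude :: com where
  "prelude = Seq (for_com 2 (Assign 1 (Plus (Reg 1) (Reg 0))))
     (Seq (for_com 2 (Seq (Store (Plus (Reg 1) (Reg 2)) (Reg 3)) (Assign 3 (Plus (Reg 3) (Reg 0)))))
       (Seq (Assign 2 (Const 0)) (Assign 3 (Const 0))))"

definition postlude :: "nat \<Rightarrow> com" where
  "postlude c = for_com 2 (Store (Reg 2) (Mem (Plus (base (Suc c)) (Reg 2))))"

text \<open>The square of \<open>n\<close> and the offsets are running sums. Registers 2 and 3 serve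
  as scratch and are cleared at the end, since they hold the variables 0 and 1 of the loop
  program.\<close>

lemma prelude_exec:
  assumes n: "n = length vs" and adj: "adj = (\<lambda>i j. (vs ! i, vs ! j) \<in> parcs G)"
  shows "bounded_exec prelude (input_state G vs) (n * 30 + 30) (sim n adj (\<lambda>_. 0, \<lambda>_ _. 0))"
proof -
  define M where "M = snd (input_state G vs)"
  have M: "M a = 0" if "n * n \<le> a" for a
    using that by (simp add: M_def input_state_def Let_def n)
  have M_adj: "M (i * n + j) = of_bool (adj i j)" if "i < n" "j < n" for i j
  proof -
    have "(i * n + j) div n = i" "(i * n + j) mod n = j" using that by auto
    then show ?thesis
      using row_index_less[OF that] by (simp add: M_def input_state_def Let_def adj flip: n)
  qed
  let ?s1 = "((\<lambda>r. if r = 0 \<or> r = 2 then n else if r = 1 then n * n else 0), M)"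
  let ?P = "\<lambda>i s. s = ((\<lambda>r. if r = 0 then n else if r = 1 then i * n else if r = 2 then i else 0), M)"
  let ?Q = "\<lambda>i s. s = ((\<lambda>r. if r = 0 then n else if r = 1 then n * n else if r = 2 then i
      else if r = 3 then i * n else 0), \<lambda>a. if n * n \<le> a \<and> a < n * n + i then (a - n * n) * n else M a)"
  have 1: "bounded_exec (for_com 2 (Assign 1 (Plus (Reg 1) (Reg 0)))) (input_state G vs)
      (n * (4 + 8) + 6) (?P n)"
  proof (rule bounded_exec_for[where P = ?P])
    show "bounded_exec (Assign 1 (Plus (Reg 1) (Reg 0))) s 4
        (\<lambda>s'. ?P (Suc i) ((fst s')(2 := Suc (fst s' 2)), snd s'))" if "?P i s" for i s
      by (rule bounded_exec_Assign) (use that in \<open>auto simp: fun_eq_iff\<close>)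
    show "?P 0 ((fst (input_state G vs))(2 := 0), snd (input_state G vs))"
      by (auto simp: M_def input_state_def Let_def n fun_eq_iff)
  qed auto
  have 2: "bounded_exec (for_com 2 (Seq (Store (Plus (Reg 1) (Reg 2)) (Reg 3))
      (Assign 3 (Plus (Reg 3) (Reg 0))))) s (n * ((5 + 4) + 8) + 6) (?Q n)" if s: "?P n s" for s
  proof (rule bounded_exec_for[where P = ?Q])
    fix i and s :: state assume Q: "?Q i s"
    show "bounded_exec (Seq (Store (Plus (Reg 1) (Reg 2)) (Reg 3)) (Assign 3 (Plus (Reg 3) (Reg 0))))
        s (5 + 4) (\<lambda>s'. ?Q (Suc i) ((fst s')(2 := Suc (fst s' 2)), snd s'))"
    proof (rule bounded_exec_Seq)
      show "bounded_exec (Store (Plus (Reg 1) (Reg 2)) (Reg 3)) s 5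
          (\<lambda>s'. s' = (fst s, (snd s)(n * n + i := i * n)))"
        by (rule bounded_exec_Store) (use Q in auto)
      fix s' assume s': "s' = (fst s, (snd s)(n * n + i := i * n))"
      show "bounded_exec (Assign 3 (Plus (Reg 3) (Reg 0))) s' 4
          (\<lambda>s'. ?Q (Suc i) ((fst s')(2 := Suc (fst s' 2)), snd s'))"
        by (rule bounded_exec_Assign) (use Q s' in \<open>auto simp: fun_eq_iff\<close>)
    qed
  next
    show "?Q 0 ((fst s)(2 := 0), snd s)" using s by (auto simp: fun_eq_iff)
  qed auto
  have 3: "bounded_exec (Seq (Assign 2 (Const 0)) (Assign 3 (Const 0))) s (2 + 2)
      (sim n adj (\<lambda>_. 0, \<lambda>_ _. 0))" if s: "?Q n s" for s
  proof (rule bounded_exec_Seq)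
    show "bounded_exec (Assign 2 (Const 0)) s 2 (\<lambda>s'. s' = ((fst s)(2 := 0), snd s))"
      by (rule bounded_exec_Assign) auto
    fix s' assume s': "s' = ((fst s)(2 := 0), snd s)"
    show "bounded_exec (Assign 3 (Const 0)) s' 2 (sim n adj (\<lambda>_. 0, \<lambda>_ _. 0))"
    proof (rule bounded_exec_Assign)
      have "\<not> n * n \<le> i * n + j" if "i < n" "j < n" for i j
        using row_index_less[OF that] by simp
      then show "sim n adj (\<lambda>_. 0, \<lambda>_ _. 0) ((fst s')(3 := expr_val (Const 0) s'), snd s')"
        unfolding sim_def using s s' M M_adj by (auto simp del: not_le)
    qed simp
  qed
  have "bounded_exec prelude (input_state G vs)
      ((n * (4 + 8) + 6) + ((n * ((5 + 4) + 8) + 6) + (2 + 2))) (sim n adj (\<lambda>_. 0, \<lambda>_ _. 0))"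
    unfolding prelude_def by (intro bounded_exec_Seq[OF 1] bounded_exec_Seq[OF 2] 3)
  then show ?thesis by (rule bounded_exec_mono) auto
qed

text \<open>The copy overwrites memory from the front, while each cell read lies behind all cells
  already written.\<close>

lemma postlude_exec:
  assumes sim: "sim n adj s m"
  shows "bounded_exec (postlude c) m (n * (expr_cost (base (Suc c)) + 13) + 6)
    (\<lambda>m'. \<forall>i<n. snd m' i = snd s c i)"
proof -
  let ?P = "\<lambda>i m'. fst m' 0 = n \<and> fst m' 1 = n * n \<and> fst m' 2 = i \<and>
    (\<forall>a. snd m' a = (if a < i then snd s c a else snd m a))"
  have "bounded_exec (for_com 2 (Store (Reg 2) (Mem (Plus (base (Suc c)) (Reg 2))))) m
      (n * ((expr_cost (base (Suc c)) + 5) + 8) + 6) (?P n)"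
  proof (rule bounded_exec_for[where P = ?P])
    show "?P 0 ((fst m)(2 := 0), snd m)" using sim by (auto simp: sim_def)
    fix i and m' :: state assume i: "i < n" and P: "?P i m'"
    have "expr_val (base d) m' = n * n + d * n" for d using P by (induction d) auto
    from this[of "Suc c"] have "expr_val (Plus (base (Suc c)) (Reg 2)) m' = n * n + Suc c * n + i"
      using P by simp
    moreover have "\<not> n * n + Suc c * n + i < i" by simp
    ultimately have "expr_val (Mem (Plus (base (Suc c)) (Reg 2))) m' = snd m (n * n + Suc c * n + i)"
      using P by (simp del: base.simps mult_Suc)
    also have "\<dots> = snd s c i" using sim i by (simp add: sim_def del: mult_Suc)
    finally show "bounded_exec (Store (Reg 2) (Mem (Plus (base (Suc c)) (Reg 2)))) m'
        (expr_cost (base (Suc c)) + 5) (\<lambda>s'. ?P (Suc i) ((fst s')(2 := Suc (fst s' 2)), snd s'))"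
      using P by (intro bounded_exec_Store) (auto simp del: base.simps)
  qed auto
  then show ?thesis unfolding postlude_def by (rule bounded_exec_mono) auto
qed

text \<open>Only the result under \<open>run\<close> remains to be shown for a loop program: the
  time bound comes from \<open>time p\<close>, which does not depend on the graph.\<close>

lemma poly_time_graph_algorithmI:
  assumes wf: "wf_prog {} p"
    and correct: "\<And>G vs. pair_graph G \<Longrightarrow> distinct vs \<Longrightarrow> set vs = pverts G \<Longrightarrow>
      R G {vs ! i | i. i < length vs \<and>
        snd (run (length vs) (\<lambda>i j. (vs ! i, vs ! j) \<in> parcs G) p (\<lambda>_. 0, \<lambda>_ _. 0)) c i \<noteq> 0}"
  shows "poly_time_graph_algorithm (Seq prelude (Seq (comp_prog p) (postlude c))) R"
proof -
  let ?T = "[:30, 30:] + (time p + [:6, expr_cost (base (Suc c)) + 13:])"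
  have "\<exists>t s. exec (Seq prelude (Seq (comp_prog p) (postlude c))) (input_state G vs) t s \<and>
      t \<le> poly ?T (card (pverts G)) \<and> R G (output_set vs s)"
    if G: "pair_graph G" "distinct vs" "set vs = pverts G" for G :: "nat pair_pre_digraph" and vs
  proof -
    let ?n = "length vs" and ?adj = "\<lambda>i j. (vs ! i, vs ! j) \<in> parcs G"
    let ?s = "run ?n ?adj p (\<lambda>_. 0, \<lambda>_ _. 0)"
    have n: "card (pverts G) = ?n" using G distinct_card by metis
    have "bounded_exec (Seq prelude (Seq (comp_prog p) (postlude c))) (input_state G vs)
        ((?n * 30 + 30) + (poly (time p) ?n + (?n * (expr_cost (base (Suc c)) + 13) + 6)))
        (\<lambda>m'. \<forall>i<?n. snd m' i = snd ?s c i)"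
      by (rule bounded_exec_Seq[OF prelude_exec[OF refl refl]],
          rule bounded_exec_Seq[OF comp_prog_sim[OF _ wf]], assumption, simp, rule postlude_exec)
    then obtain t m where "exec (Seq prelude (Seq (comp_prog p) (postlude c))) (input_state G vs) t m"
      "t \<le> poly ?T ?n" and m: "\<forall>i<?n. snd m i = snd ?s c i"
      unfolding bounded_exec_def by (auto simp: algebra_simps)
    moreover have "output_set vs m = {vs ! i | i. i < ?n \<and> snd ?s c i \<noteq> 0}"
      using m by (auto simp: output_set_def)
    ultimately show ?thesis
      using correct[OF G] by (intro exI[of _ t] exI[of _ m]) (simp add: n)
  qed
  then show ?thesis unfolding poly_time_graph_algorithm_def by blast
qed

section \<open>Modified variables and guarded commands\<close>

primrec vmods :: "prog \<Rightarrow> nat set" where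
  "vmods PSkip = {}"
| "vmods (Set r a) = {r}"
| "vmods (Put c i a) = {}"
| "vmods (PSeq p q) = vmods p \<union> vmods q"
| "vmods (Cond b p q) = vmods p \<union> vmods q"
| "vmods (For r p) = insert r (vmods p)"

primrec amods :: "prog \<Rightarrow> nat set" where
  "amods PSkip = {}"
| "amods (Set r a) = {}"
| "amods (Put c i a) = {c}"
| "amods (PSeq p q) = amods p \<union> amods q"
| "amods (Cond b p q) = amods p \<union> amods q"
| "amods (For r p) = amods p"

primrec avars :: "aexp \<Rightarrow> nat set" where
  "avars (Num k) = {}"
| "avars (Var r) = {r}"
| "avars (Arr c i) = {i}"
| "avars (Adj i j) = {i, j}"
| "avars (Add a b) = avars a \<union> avars b"
| "avars (Sub a b) = avars a \<union> avars b"

abbreviation Neg :: "aexp \<Rightarrow> aexp" where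
  "Neg e \<equiv> Sub (Num 1) e"

primrec guard :: "aexp list \<Rightarrow> prog \<Rightarrow> prog" where
  "guard [] p = p"
| "guard (b # bs) p = Cond b (guard bs p) PSkip"

lemma vmods_guard [simp]: "vmods (guard bs p) = vmods p"
  by (induction bs) auto

lemma amods_guard [simp]: "amods (guard bs p) = amods p"
  by (induction bs) auto

lemma wf_guard [simp]: "wf_prog I (guard bs p) \<longleftrightarrow> (\<forall>b\<in>set bs. wf_aexp I b) \<and> wf_prog I p"
  by (induction bs) auto

lemma run_guard [simp]:
  "run n adj (guard bs p) s = (if \<forall>b\<in>set bs. aval adj b s \<noteq> 0 then run n adj p s else s)"
  by (induction bs) auto

lemma aval_cong:
  assumes "\<And>x. x \<in> avars a \<Longrightarrow> fst s x = fst s' x" "snd s = snd s'"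
  shows "aval adj a s = aval adj a s'"
  using assms(1) by (induction a) (auto simp: assms(2))

section \<open>The algorithm\<close>

text \<open>
  Arrays: 2 vertices of deleted diamonds, 3 vertices no longer in \<open>U\<close>, 4 degrees \<open>hdeg U v\<close>,
  5 weights, 6 stamps, 7 the solution, 8 vertices eliminated while testing a set.
  Variables: 2 to 7, 10 and 11 loop counters, 9 the number \<open>n\<close>, 12 to 15 intermediate results
  (13 a degree, 14 and 15 products), 20 to 24 flags and saved values.
\<close>

definition least_prog :: "nat \<Rightarrow> nat \<Rightarrow> prog" where
  "least_prog q v = For 11 (guard [Neg (Arr q 11), Adj v 11, Adj 10 11, Sub (Var 10) (Var 11)] (Set 12 (Num 0)))"

text \<open>The degree is counted as in \<open>hdeg_eq_card_least\<close>: variable 10 runs through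
  the neighbours of \<open>v\<close>, and variable 12 is cleared if a smaller one lies in the same
  clique. No clique is ever constructed.\<close>

definition deg_prog :: "nat \<Rightarrow> nat \<Rightarrow> prog" where
  "deg_prog q v = PSeq (Set 13 (Num 0)) (For 10 (guard [Neg (Arr q 10), Adj v 10]
     (PSeq (Set 12 (Num 1)) (PSeq (least_prog q v) (Set 13 (Add (Var 13) (Var 12)))))))"

lemma mods_least_prog [simp]: "vmods (least_prog q v) = {11, 12}" "amods (least_prog q v) = {}"
  by (auto simp: least_prog_def)

lemma mods_deg_prog [simp]: "vmods (deg_prog q v) = {10, 11, 12, 13}" "amods (deg_prog q v) = {}"
  by (auto simp: deg_prog_def)

text \<open>Repeated addition in a loop of \<open>n\<close> rounds gives the product only if the
  value of \<open>a\<close> is at most \<open>n\<close>; in all uses \<open>a\<close> is a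
  degree.\<close>

definition mul_prog :: "nat \<Rightarrow> aexp \<Rightarrow> aexp \<Rightarrow> prog" where
  "mul_prog t a b = PSeq (Set t (Num 0)) (For 10 (guard [Sub a (Var 10)] (Set t (Add (Var t) b))))"

lemma mods_mul_prog [simp]: "vmods (mul_prog t a b) = {10, t}" "amods (mul_prog t a b) = {}"
  by (auto simp: mul_prog_def)

definition degrees_prog :: prog where
  "degrees_prog = For 2 (guard [Neg (Arr 3 2)] (PSeq (deg_prog 3 2) (Put 4 2 (Var 13))))"

lemma mods_degrees_prog [simp]: "vmods degrees_prog = {2, 10, 11, 12, 13}" "amods degrees_prog = {4}"
  by (auto simp: degrees_prog_def)

text \<open>Flag 20 limits a round to a single removal, as the stored degrees belong to
  \<open>U\<close> before it, and suppresses the push that follows.\<close>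

definition leaf_prog :: prog where
  "leaf_prog = For 2 (guard [Neg (Var 20), Neg (Arr 3 2), Sub (Num 2) (Arr 4 2)]
     (PSeq (Set 20 (Num 1)) (Put 3 2 (Num 1))))"

lemma mods_leaf_prog [simp]: "vmods leaf_prog = {2, 20}" "amods leaf_prog = {3}"
  by (auto simp: leaf_prog_def)

definition min_prog :: prog where
  "min_prog = PSeq (Set 21 (Num 1)) (For 3 (guard [Neg (Arr 3 3)]
     (PSeq (mul_prog 14 (Arr 4 3) (Arr 5 2)) (PSeq (mul_prog 15 (Arr 4 2) (Arr 5 3))
       (guard [Sub (Var 14) (Var 15)] (Set 21 (Num 0)))))))"

lemma mods_min_prog [simp]: "vmods min_prog = {3, 10, 14, 15, 21}" "amods min_prog = {}"
  by (auto simp: min_prog_def)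

text \<open>The weight of the chosen vertex is saved beforehand, because the loop overwrites it too.
  The stamp is one more than the round number, hence never zero.\<close>

definition split_prog :: prog where
  "split_prog = PSeq (Set 22 (Arr 5 2)) (PSeq (Set 23 (Arr 4 2)) (PSeq (For 3 (guard [Neg (Arr 3 3)]
     (PSeq (mul_prog 14 (Arr 4 3) (Var 22)) (PSeq (mul_prog 15 (Var 23) (Arr 5 3))
       (Put 5 3 (Sub (Var 15) (Var 14)))))))
     (PSeq (Put 3 2 (Num 1)) (Put 6 2 (Add (Var 6) (Num 1))))))"

lemma mods_split_prog [simp]: "vmods split_prog = {3, 10, 14, 15, 22, 23}" "amods split_prog = {3, 5, 6}"
  by (auto simp: split_prog_def)

definition push_prog :: prog where
  "push_prog = For 2 (guard [Neg (Var 20), Neg (Arr 3 2)] (PSeq min_prog (guard [Var 21]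
     (PSeq (Set 20 (Num 1)) split_prog))))"

lemma mods_push_prog [simp]: "vmods push_prog = {2, 3, 10, 14, 15, 20, 21, 22, 23}" "amods push_prog = {3, 5, 6}"
  by (auto simp: push_prog_def)

definition ratio_step_prog :: prog where
  "ratio_step_prog = PSeq degrees_prog (PSeq (Set 20 (Num 0)) (PSeq leaf_prog push_prog))"

lemma mods_ratio_step_prog [simp]:
  "vmods ratio_step_prog = {2, 3, 10, 11, 12, 13, 14, 15, 20, 21, 22, 23}"
  "amods ratio_step_prog = {3, 4, 5, 6}"
  by (auto simp: ratio_step_prog_def)

text \<open>The two truncated differences add up to the distance of the numbers, nonzero exactly if
  they differ. Distinctness of the other pairs follows from adjacency.\<close>

definition diamond_step_prog :: prog where
  "diamond_step_prog = guard [Neg (Arr 2 2), Neg (Arr 2 3), Neg (Arr 2 4), Neg (Arr 2 5),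
     Adj 2 3, Adj 2 4, Adj 3 4, Adj 3 5, Adj 4 5, Add (Sub (Var 2) (Var 5)) (Sub (Var 5) (Var 2)), Neg (Adj 2 5)]
     (PSeq (Put 2 2 (Num 1)) (PSeq (Put 2 3 (Num 1)) (PSeq (Put 2 4 (Num 1)) (Put 2 5 (Num 1)))))"

definition diamond_prog :: prog where
  "diamond_prog = For 2 (For 3 (For 4 (For 5 diamond_step_prog)))"

lemma mods_diamond_prog [simp]: "vmods diamond_prog = {2, 3, 4, 5}" "amods diamond_prog = {2}"
  by (auto simp: diamond_prog_def diamond_step_prog_def)

definition sweep_prog :: prog where
  "sweep_prog = For 2 (guard [Neg (Arr 8 2)] (PSeq (deg_prog 8 2)
     (guard [Sub (Num 2) (Var 13)] (Put 8 2 (Num 1)))))"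

lemma mods_sweep_prog [simp]: "vmods sweep_prog = {2, 10, 11, 12, 13}" "amods sweep_prog = {8}"
  by (auto simp: sweep_prog_def)

definition eliminate_prog :: prog where
  "eliminate_prog = For 4 sweep_prog"

lemma mods_eliminate_prog [simp]: "vmods eliminate_prog = {2, 4, 10, 11, 12, 13}" "amods eliminate_prog = {8}"
  by (auto simp: eliminate_prog_def)

text \<open>Array 8 is the current solution without the tested vertex. Leaf elimination leaves
  nothing exactly if deleting that set is feasible; variable 24 reports whether something is
  left.\<close>

definition test_prog :: prog where
  "test_prog = PSeq (For 2 (Put 8 2 (Arr 7 2))) (PSeq (Put 8 7 (Num 0)) (PSeq eliminate_prog
     (PSeq (Set 24 (Num 0)) (For 2 (guard [Neg (Arr 8 2)] (Set 24 (Num 1)))))))"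

lemma mods_test_prog [simp]: "vmods test_prog = {2, 4, 10, 11, 12, 13, 24}" "amods test_prog = {8}"
  by (auto simp: test_prog_def)

definition ratio_prog :: prog where
  "ratio_prog = For 6 ratio_step_prog"

lemma mods_ratio_prog [simp]:
  "vmods ratio_prog = {6, 2, 3, 10, 11, 12, 13, 14, 15, 20, 21, 22, 23}"
  "amods ratio_prog = {3, 4, 5, 6}"
  by (simp_all add: ratio_prog_def)

text \<open>The guard asks for a stamp equal to \<open>n\<close> minus the round number, expressed
  as a vanishing distance.\<close>

definition reverse_step_prog :: prog where
  "reverse_step_prog = guard
     [Neg (Add (Sub (Arr 6 7) (Sub (Var 9) (Var 6))) (Sub (Sub (Var 9) (Var 6)) (Arr 6 7)))]
     (PSeq test_prog (guard [Neg (Var 24)] (Put 7 7 (Num 0))))"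

text \<open>A completed loop leaves \<open>n\<close> in its counter; \<open>For 9 PSkip\<close> is
  there to obtain \<open>n\<close>, which expressions cannot mention.\<close>

definition reverse_prog :: prog where
  "reverse_prog = PSeq (For 9 PSkip) (For 6 (For 7 reverse_step_prog))"

lemma mods_reverse_step_prog [simp]:
  "vmods reverse_step_prog = {2, 4, 10, 11, 12, 13, 24}" "amods reverse_step_prog = {7, 8}"
  by (auto simp: reverse_step_prog_def)

definition init_prog :: prog where
  "init_prog = For 2 (PSeq (Put 3 2 (Arr 2 2)) (Put 5 2 (Num 1)))"

lemma mods_init_prog [simp]: "vmods init_prog = {2}" "amods init_prog = {3, 5}"
  by (auto simp: init_prog_def)

text \<open>The initial solution consists of the deleted diamonds and everything pushed; vertices
  removed as leaves belong to the remaining graph from the start.\<close>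

definition mark_prog :: prog where
  "mark_prog = For 2 (Put 7 2 (Add (Arr 2 2) (Arr 6 2)))"

lemma mods_mark_prog [simp]: "vmods mark_prog = {2}" "amods mark_prog = {7}"
  by (simp_all add: mark_prog_def)

definition block_deletion_prog :: prog where
  "block_deletion_prog = PSeq diamond_prog (PSeq init_prog
     (PSeq ratio_prog (PSeq mark_prog reverse_prog)))"

lemma wf_block_deletion_prog: "wf_prog {} block_deletion_prog"
  by (simp add: least_prog_def deg_prog_def mul_prog_def degrees_prog_def leaf_prog_def min_prog_def split_prog_def push_prog_def ratio_step_prog_def diamond_step_prog_def diamond_prog_def sweep_prog_def eliminate_prog_def test_prog_def ratio_prog_def reverse_step_prog_def reverse_prog_def init_prog_def mark_prog_def block_deletion_prog_def)

section \<open>Correctness\<close>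

locale graph_program = simple_graph adj for adj :: "nat \<Rightarrow> nat \<Rightarrow> bool" +
  fixes n :: nat
begin

abbreviation exe :: "prog \<Rightarrow> astate \<Rightarrow> astate" where
  "exe \<equiv> run n adj"

lemma frame_var [simp]: "x \<notin> vmods p \<Longrightarrow> fst (exe p s) x = fst s x"
proof (induction p arbitrary: s)
  case (For r p)
  have "fst (fold (\<lambda>i s. exe p (upd r i s)) xs s) x = fst s x" for xs s
    using For by (induction xs arbitrary: s) auto
  then show ?case using For by simp
qed auto

lemma frame_arr [simp]: "c \<notin> amods p \<Longrightarrow> snd (exe p s) c = snd s c"
proof (induction p arbitrary: s)
  case (For r p)
  have "snd (fold (\<lambda>i s. exe p (upd r i s)) xs s) c = snd s c" for xs s
    using For by (induction xs arbitrary: s) auto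
  then show ?case using For by simp
qed auto

lemma frame_arrs: "amods p = {} \<Longrightarrow> snd (exe p s) = snd s"
  by (rule ext) simp

text \<open>The frame conditions of the body are supplied to the step, so an invariant mentions only
  what the loop changes. The final state has the counter set to \<open>n\<close>, hence the separate
  postcondition.\<close>

lemma For_rule:
  assumes init: "P 0 s"
    and step: "\<And>i s'. i < n \<Longrightarrow> (\<And>x. x \<notin> insert r (vmods p) \<Longrightarrow> fst s' x = fst s x) \<Longrightarrow>
      (\<And>c. c \<notin> amods p \<Longrightarrow> snd s' c = snd s c) \<Longrightarrow> P i s' \<Longrightarrow> P (Suc i) (exe p (upd r i s'))"
    and final: "\<And>s'. P n s' \<Longrightarrow> Q (upd r n s')"
  shows "Q (exe (For r p) s)"
proof -
  define F where "F i = fold (\<lambda>i s. exe p (upd r i s)) [0..<i] s" for i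
  have F_Suc: "F (Suc i) = exe p (upd r i (F i))" for i by (simp add: F_def)
  have "(\<forall>x. x \<notin> insert r (vmods p) \<longrightarrow> fst (F i) x = fst s x) \<and>
      (\<forall>c. c \<notin> amods p \<longrightarrow> snd (F i) c = snd s c) \<and> P i (F i)" if "i \<le> n" for i
    using that
  proof (induction i)
    case 0
    then show ?case using init by (simp add: F_def)
  next
    case (Suc i)
    then have "P (Suc i) (F (Suc i))" unfolding F_Suc by (intro step) auto
    then show ?case using Suc by (simp add: F_Suc)
  qed
  then show ?thesis using final[of "F n"] by (simp add: F_def)
qed

text \<open>Arrays mark removed vertices, so an array of zeros stands for the full vertex
  set.\<close>

definition alive :: "nat \<Rightarrow> astate \<Rightarrow> nat set" where
  "alive q s = {i. i < n \<and> snd s q i = 0}"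

lemma finite_alive [simp]: "finite (alive q s)"
  by (simp add: alive_def)

definition least_in_class :: "nat set \<Rightarrow> nat \<Rightarrow> nat \<Rightarrow> bool" where
  "least_in_class X v u \<longleftrightarrow> adj v u \<and> \<not> (\<exists>t\<in>X. t < u \<and> adj v t \<and> adj u t)"

definition ldeg :: "nat set \<Rightarrow> nat \<Rightarrow> nat" where
  "ldeg X v = card {u \<in> X. least_in_class X v u}"

lemma ldeg_le: "X \<subseteq> {..<n} \<Longrightarrow> ldeg X v \<le> n"
  using card_mono[of "{..<n}" "{u \<in> X. least_in_class X v u}"] by (auto simp: ldeg_def)

lemma least_prog_val:
  assumes v: "v \<notin> {10, 11, 12}" and init: "fst s 12 = 1" and u: "adj (fst s v) (fst s 10)"
  shows "fst (exe (least_prog q v) s) 12 = of_bool (least_in_class (alive q s) (fst s v) (fst s 10))"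
  unfolding least_prog_def
proof (rule For_rule[where P = "\<lambda>i s'. fst s' 12 = of_bool (\<not> (\<exists>t\<in>alive q s. t < i \<and> t < fst s 10 \<and>
    adj (fst s v) t \<and> adj (fst s 10) t))"])
  fix i and s' :: astate
  assume i: "i < n" and "\<And>x. x \<notin> insert 11 (vmods (guard [Neg (Arr q 11), Adj v 11, Adj 10 11,
      Sub (Var 10) (Var 11)] (Set 12 (Num 0)))) \<Longrightarrow> fst s' x = fst s x"
    and "\<And>c. c \<notin> amods (guard [Neg (Arr q 11), Adj v 11, Adj 10 11,
      Sub (Var 10) (Var 11)] (Set 12 (Num 0))) \<Longrightarrow> snd s' c = snd s c"
    and P: "fst s' 12 = of_bool (\<not> (\<exists>t\<in>alive q s. t < i \<and> t < fst s 10 \<and>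
      adj (fst s v) t \<and> adj (fst s 10) t))"
  then have fr: "fst s' v = fst s v" "fst s' 10 = fst s 10" "snd s' q = snd s q" using v by auto
  show "fst (exe (guard [Neg (Arr q 11), Adj v 11, Adj 10 11, Sub (Var 10) (Var 11)] (Set 12 (Num 0)))
      (upd 11 i s')) 12 = of_bool (\<not> (\<exists>t\<in>alive q s. t < Suc i \<and> t < fst s 10 \<and>
      adj (fst s v) t \<and> adj (fst s 10) t))"
    using fr P v i by (auto simp: alive_def less_Suc_eq)
next
  fix s' :: astate assume "fst s' 12 = of_bool (\<not> (\<exists>t\<in>alive q s. t < n \<and> t < fst s 10 \<and>
    adj (fst s v) t \<and> adj (fst s 10) t))"
  then show "fst (upd 11 n s') 12 = of_bool (least_in_class (alive q s) (fst s v) (fst s 10))"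
    using u by (auto simp: least_in_class_def alive_def)
qed (use init in auto)

lemma deg_prog_val:
  assumes v: "v \<notin> {10, 11, 12, 13}"
  shows "fst (exe (deg_prog q v) s) 13 = ldeg (alive q s) (fst s v)"
proof -
  let ?X = "alive q s"
  let ?C = "\<lambda>i. {u \<in> ?X. u < i \<and> least_in_class ?X (fst s v) u}"
  let ?b = "guard [Neg (Arr q 10), Adj v 10]
     (PSeq (Set 12 (Num 1)) (PSeq (least_prog q v) (Set 13 (Add (Var 13) (Var 12)))))"
  have "fst (exe (For 10 ?b) (upd 13 0 s)) 13 = ldeg ?X (fst s v)"
  proof (rule For_rule[where P = "\<lambda>i s'. fst s' 13 = card (?C i)"])
    fix i and s' :: astate
    assume i: "i < n" and fv: "\<And>x. x \<notin> insert 10 (vmods ?b) \<Longrightarrow> fst s' x = fst (upd 13 0 s) x"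
      and fa: "\<And>c. c \<notin> amods ?b \<Longrightarrow> snd s' c = snd (upd 13 0 s) c" and P: "fst s' 13 = card (?C i)"
    have fr: "fst s' v = fst s v" "snd s' q = snd s q" using fv[of v] fa[of q] v by auto
    have X: "alive q s' = ?X" "\<And>x r. alive q (upd r x s') = ?X" using fr by (auto simp: alive_def)
    have iX: "i \<in> ?X \<longleftrightarrow> snd s q i = 0" using i by (auto simp: alive_def)
    have C: "?C (Suc i) = (if i \<in> ?X \<and> least_in_class ?X (fst s v) i then insert i (?C i) else ?C i)"
      by (auto simp: less_Suc_eq)
    have card: "card (?C (Suc i)) = card (?C i) + of_bool (i \<in> ?X \<and> least_in_class ?X (fst s v) i)"
      unfolding C by simp
    show "fst (exe ?b (upd 10 i s')) 13 = card (?C (Suc i))"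
    proof (cases "i \<in> ?X \<and> adj (fst s v) i")
      case True
      let ?s = "upd 12 (Suc 0) (upd 10 i s')"
      have "fst (exe (least_prog q v) ?s) 12 =
          of_bool (least_in_class (alive q ?s) (fst ?s v) (fst ?s 10))"
        by (rule least_prog_val) (use v fr True in auto)
      moreover have "alive q ?s = ?X" using fr by (auto simp: alive_def)
      ultimately show ?thesis using True card v fr P iX by simp
    next
      case False
      then have "\<not> (i \<in> ?X \<and> least_in_class ?X (fst s v) i)" by (auto simp: least_in_class_def)
      then show ?thesis using False card v fr P iX by auto
    qed
  next
    fix s' :: astate assume "fst s' 13 = card (?C n)"
    moreover have "?C n = {u \<in> ?X. least_in_class ?X (fst s v) u}" by (auto simp: alive_def)
    ultimately show "fst (upd 10 n s') 13 = ldeg ?X (fst s v)" by (simp add: ldeg_def)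
  qed auto
  then show ?thesis by (simp add: deg_prog_def)
qed

lemma mul_prog_val:
  assumes t: "t \<noteq> 10" and indep: "avars a \<inter> {10, t} = {}" "avars b \<inter> {10, t} = {}"
    and le: "aval adj a s \<le> n"
  shows "fst (exe (mul_prog t a b) s) t = aval adj a s * aval adj b s"
proof -
  let ?p = "guard [Sub a (Var 10)] (Set t (Add (Var t) b))"
  have "fst (exe (For 10 ?p) (upd t 0 s)) t = aval adj a s * aval adj b s"
  proof (rule For_rule[where P = "\<lambda>i s'. fst s' t = min i (aval adj a s) * aval adj b s"])
    fix i and s' :: astate
    assume fv: "\<And>x. x \<notin> insert 10 (vmods ?p) \<Longrightarrow> fst s' x = fst (upd t 0 s) x"
      and fa: "\<And>c. c \<notin> amods ?p \<Longrightarrow> snd s' c = snd (upd t 0 s) c"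
      and P: "fst s' t = min i (aval adj a s) * aval adj b s"
    have arrs: "snd s' = snd s" using fa by (intro ext) simp
    have vars: "fst (upd 10 i s') x = fst s x" if "x \<notin> {10, t}" for x using fv[of x] that by simp
    have "aval adj a (upd 10 i s') = aval adj a s" "aval adj b (upd 10 i s') = aval adj b s"
      by (rule aval_cong; use arrs vars indep in auto)+
    then show "fst (exe ?p (upd 10 i s')) t = min (Suc i) (aval adj a s) * aval adj b s"
      using P t by (auto simp: min_def)
  qed (use t le in \<open>auto simp: min_def\<close>)
  then show ?thesis by (simp add: mul_prog_def)
qed

lemma degrees_prog_val:
  assumes u: "u \<in> alive 3 s"
  shows "snd (exe degrees_prog s) 4 u = ldeg (alive 3 s) u"
proof -
  let ?b = "guard [Neg (Arr 3 2)] (PSeq (deg_prog 3 2) (Put 4 2 (Var 13)))"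
  show ?thesis
    unfolding degrees_prog_def
  proof (rule For_rule[where P = "\<lambda>i s'. u < i \<longrightarrow> snd s' 4 u = ldeg (alive 3 s) u"])
    fix i and s' :: astate
    assume i: "i < n" and fa: "\<And>c. c \<notin> amods ?b \<Longrightarrow> snd s' c = snd s c"
      and P: "u < i \<longrightarrow> snd s' 4 u = ldeg (alive 3 s) u"
    have a3: "snd s' 3 = snd s 3" using fa[of 3] by simp
    have "alive 3 (upd 2 i s') = alive 3 s" by (simp add: alive_def a3)
    then have "fst (exe (deg_prog 3 2) (upd 2 i s')) 13 = ldeg (alive 3 s) i"
      by (simp add: deg_prog_val)
    then show "u < Suc i \<longrightarrow> snd (exe ?b (upd 2 i s')) 4 u = ldeg (alive 3 s) u"
      using P u a3 by (auto simp: less_Suc_eq alive_def)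
  qed (use u in \<open>auto simp: alive_def\<close>)
qed

section \<open>One round of the local ratio phase\<close>

definition leaf_removed :: "astate \<Rightarrow> astate \<Rightarrow> bool" where
  "leaf_removed s s' \<longleftrightarrow> (\<exists>v\<in>alive 3 s. snd s 4 v \<le> 1 \<and> snd s' 3 = (snd s 3)(v := 1))"

lemma leaf_prog_spec:
  assumes init: "fst s 20 = 0"
  shows "(fst (exe leaf_prog s) 20 = 0 \<and> snd (exe leaf_prog s) 3 = snd s 3 \<and> (\<forall>v\<in>alive 3 s. 2 \<le> snd s 4 v)) \<or>
    (fst (exe leaf_prog s) 20 = 1 \<and> leaf_removed s (exe leaf_prog s))"
proof -
  let ?b = "guard [Neg (Var 20), Neg (Arr 3 2), Sub (Num 2) (Arr 4 2)] (PSeq (Set 20 (Num 1)) (Put 3 2 (Num 1)))"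
  show ?thesis
    unfolding leaf_prog_def
  proof (rule For_rule[where P = "\<lambda>i s'. (fst s' 20 = 0 \<and> snd s' 3 = snd s 3 \<and>
      (\<forall>v\<in>alive 3 s. v < i \<longrightarrow> 2 \<le> snd s 4 v)) \<or> (fst s' 20 = 1 \<and> leaf_removed s s')"])
    fix i and s' :: astate
    assume i: "i < n" and fa: "\<And>c. c \<notin> amods ?b \<Longrightarrow> snd s' c = snd s c"
      and P: "(fst s' 20 = 0 \<and> snd s' 3 = snd s 3 \<and>
        (\<forall>v\<in>alive 3 s. v < i \<longrightarrow> 2 \<le> snd s 4 v)) \<or> (fst s' 20 = 1 \<and> leaf_removed s s')"
    have a4: "snd s' 4 = snd s 4" using fa[of 4] by simp
    show "(fst (exe ?b (upd 2 i s')) 20 = 0 \<and> snd (exe ?b (upd 2 i s')) 3 = snd s 3 \<and>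
        (\<forall>v\<in>alive 3 s. v < Suc i \<longrightarrow> 2 \<le> snd s 4 v)) \<or>
        (fst (exe ?b (upd 2 i s')) 20 = 1 \<and> leaf_removed s (exe ?b (upd 2 i s')))"
    proof (cases "fst s' 20 = 0")
      case False
      then show ?thesis using P by (simp add: leaf_removed_def)
    next
      case True
      then have P': "snd s' 3 = snd s 3" "\<forall>v\<in>alive 3 s. v < i \<longrightarrow> 2 \<le> snd s 4 v" using P by auto
      show ?thesis
      proof (cases "i \<in> alive 3 s \<and> snd s 4 i \<le> 1")
        case found: True
        then have "leaf_removed s (exe ?b (upd 2 i s'))"
          unfolding leaf_removed_def
          by (intro bexI[of _ i]) (use True P' a4 in \<open>auto simp: alive_def\<close>)
        moreover have "fst (exe ?b (upd 2 i s')) 20 = 1"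
          using found True P' a4 by (auto simp: alive_def)
        ultimately show ?thesis by blast
      next
        case False
        then have "exe ?b (upd 2 i s') = upd 2 i s'"
          using True P' a4 i by (auto simp: alive_def)
        moreover have "\<forall>v\<in>alive 3 s. v < Suc i \<longrightarrow> 2 \<le> snd s 4 v"
          using P' False by (auto simp: less_Suc_eq)
        ultimately show ?thesis using True P' by simp
      qed
    qed
  next
    fix s' :: astate
    assume "(fst s' 20 = 0 \<and> snd s' 3 = snd s 3 \<and> (\<forall>v\<in>alive 3 s. v < n \<longrightarrow> 2 \<le> snd s 4 v)) \<or>
      (fst s' 20 = 1 \<and> leaf_removed s s')"
    then show "(fst (upd 2 n s') 20 = 0 \<and> snd (upd 2 n s') 3 = snd s 3 \<and> (\<forall>v\<in>alive 3 s. 2 \<le> snd s 4 v)) \<or>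
      (fst (upd 2 n s') 20 = 1 \<and> leaf_removed s (upd 2 n s'))"
      by (auto simp: alive_def leaf_removed_def)
  qed (use init in auto)
qed

text \<open>For positive degrees this says that \<open>v\<close> minimises weight divided by degree,
  with the quotients multiplied out.\<close>

definition min_ratio :: "astate \<Rightarrow> nat \<Rightarrow> bool" where
  "min_ratio s v \<longleftrightarrow> (\<forall>u\<in>alive 3 s. snd s 5 v * snd s 4 u \<le> snd s 5 u * snd s 4 v)"

lemma min_prog_val:
  assumes deg: "\<And>u. u \<in> alive 3 s \<Longrightarrow> snd s 4 u \<le> n" and v: "fst s 2 \<in> alive 3 s"
  shows "fst (exe min_prog s) 21 = of_bool (min_ratio s (fst s 2))"
proof -
  let ?m1 = "mul_prog 14 (Arr 4 3) (Arr 5 2)" and ?m2 = "mul_prog 15 (Arr 4 2) (Arr 5 3)"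
  let ?b = "guard [Neg (Arr 3 3)] (PSeq ?m1 (PSeq ?m2 (guard [Sub (Var 14) (Var 15)] (Set 21 (Num 0)))))"
  let ?ok = "\<lambda>u. snd s 5 (fst s 2) * snd s 4 u \<le> snd s 5 u * snd s 4 (fst s 2)"
  have "fst (exe (For 3 ?b) (upd 21 1 s)) 21 = of_bool (min_ratio s (fst s 2))"
  proof (rule For_rule[where P = "\<lambda>i s'. fst s' 21 = of_bool (\<forall>u\<in>alive 3 s. u < i \<longrightarrow> ?ok u)"])
    fix i and s' :: astate
    assume i: "i < n" and fv: "\<And>x. x \<notin> insert 3 (vmods ?b) \<Longrightarrow> fst s' x = fst (upd 21 1 s) x"
      and fa: "\<And>c. c \<notin> amods ?b \<Longrightarrow> snd s' c = snd (upd 21 1 s) c"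
      and P: "fst s' 21 = of_bool (\<forall>u\<in>alive 3 s. u < i \<longrightarrow> ?ok u)"
    let ?s = "upd 3 i s'"
    have arrs: "snd s' = snd s" using fa by (intro ext) simp
    have f2: "fst s' 2 = fst s 2" using fv[of 2] by simp
    show "fst (exe ?b ?s) 21 = of_bool (\<forall>u\<in>alive 3 s. u < Suc i \<longrightarrow> ?ok u)"
    proof (cases "i \<in> alive 3 s")
      case True
      have m1: "fst (exe ?m1 ?s) 14 = snd s 4 i * snd s 5 (fst s 2)"
        by (subst mul_prog_val) (use arrs f2 deg[OF True] in auto)
      have "fst (exe ?m2 (exe ?m1 ?s)) 15 = snd s 4 (fst s 2) * snd s 5 i"
        by (subst mul_prog_val) (use arrs f2 deg[OF v] in \<open>auto simp: frame_arrs\<close>)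
      moreover have "fst (exe ?m2 (exe ?m1 ?s)) 14 = snd s 4 i * snd s 5 (fst s 2)" using m1 by simp
      moreover have "fst (exe ?m2 (exe ?m1 ?s)) 21 = fst s' 21" by simp
      moreover have "snd s 3 i = 0" using True by (simp add: alive_def)
      ultimately show ?thesis
        using P True arrs by (auto simp: less_Suc_eq mult.commute)
    next
      case False
      then have "snd s 3 i \<noteq> 0" using i by (simp add: alive_def)
      moreover have "(\<forall>u\<in>alive 3 s. u < Suc i \<longrightarrow> ?ok u) \<longleftrightarrow> (\<forall>u\<in>alive 3 s. u < i \<longrightarrow> ?ok u)"
        using False by (auto simp: less_Suc_eq)
      ultimately show ?thesis using P arrs by simp
    qed
  next
    fix s' :: astate assume "fst s' 21 = of_bool (\<forall>u\<in>alive 3 s. u < n \<longrightarrow> ?ok u)"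
    then show "fst (upd 3 n s') 21 = of_bool (min_ratio s (fst s 2))"
      by (auto simp: min_ratio_def alive_def)
  qed auto
  then show ?thesis by (simp add: min_prog_def)
qed

definition pushed :: "astate \<Rightarrow> astate \<Rightarrow> nat \<Rightarrow> bool" where
  "pushed s s' v \<longleftrightarrow> snd s' 3 = (snd s 3)(v := 1) \<and> snd s' 6 = (snd s 6)(v := Suc (fst s 6)) \<and>
     (\<forall>u\<in>alive 3 s. snd s' 5 u = snd s 5 u * snd s 4 v - snd s 5 v * snd s 4 u)"

lemma split_prog_spec:
  assumes deg: "\<And>u. u \<in> alive 3 s \<Longrightarrow> snd s 4 u \<le> n" and v: "fst s 2 \<in> alive 3 s"
  shows "pushed s (exe split_prog s) (fst s 2)"
proof -
  let ?m1 = "mul_prog 14 (Arr 4 3) (Var 22)" and ?m2 = "mul_prog 15 (Var 23) (Arr 5 3)"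
  let ?b = "guard [Neg (Arr 3 3)] (PSeq ?m1 (PSeq ?m2 (Put 5 3 (Sub (Var 15) (Var 14)))))"
  let ?w = "snd s 5 (fst s 2)" and ?d = "snd s 4 (fst s 2)"
  let ?s0 = "upd 23 ?d (upd 22 ?w s)"
  have "\<forall>u\<in>alive 3 s. snd (exe (For 3 ?b) ?s0) 5 u = snd s 5 u * ?d - ?w * snd s 4 u"
  \<comment> \<open>Iteration \<open>i\<close> needs the old weight at \<open>i\<close>, so the
    invariant also fixes the part of the array not yet reached.\<close>
  proof (rule For_rule[where P = "\<lambda>i s'. snd s' 5 =
      (\<lambda>u. if u \<in> alive 3 s \<and> u < i then snd s 5 u * ?d - ?w * snd s 4 u else snd s 5 u)"])
    fix i and s' :: astate
    assume i: "i < n" and fv: "\<And>x. x \<notin> insert 3 (vmods ?b) \<Longrightarrow> fst s' x = fst ?s0 x"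
      and fa: "\<And>c. c \<notin> amods ?b \<Longrightarrow> snd s' c = snd ?s0 c"
      and P: "snd s' 5 = (\<lambda>u. if u \<in> alive 3 s \<and> u < i then snd s 5 u * ?d - ?w * snd s 4 u else snd s 5 u)"
    let ?s = "upd 3 i s'"
    have arrs: "snd s' 3 = snd s 3" "snd s' 4 = snd s 4" using fa[of 3] fa[of 4] by auto
    have vars: "fst s' 22 = ?w" "fst s' 23 = ?d" using fv[of 22] fv[of 23] by auto
    show "snd (exe ?b ?s) 5 = (\<lambda>u. if u \<in> alive 3 s \<and> u < Suc i
        then snd s 5 u * ?d - ?w * snd s 4 u else snd s 5 u)"
    proof (cases "i \<in> alive 3 s")
      case True
      have m1: "fst (exe ?m1 ?s) 14 = snd s 4 i * ?w"
        by (subst mul_prog_val) (use arrs vars deg[OF True] in auto)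
      have m2: "fst (exe ?m2 (exe ?m1 ?s)) 15 = ?d * snd s 5 i"
        by (subst mul_prog_val) (use arrs vars P deg[OF v] in \<open>auto simp: frame_arrs\<close>)
      have m3: "fst (exe ?m2 (exe ?m1 ?s)) 14 = snd s 4 i * ?w" using m1 by simp
      have "snd s 3 i = 0" using True by (simp add: alive_def)
      then have "snd (exe ?b ?s) 5 = (snd s' 5)(i := ?d * snd s 5 i - snd s 4 i * ?w)"
        using m2 m3 arrs by (simp add: frame_arrs)
      then show ?thesis using P True by (auto simp: fun_eq_iff less_Suc_eq mult.commute)
    next
      case False
      then have "snd s 3 i \<noteq> 0" using i by (simp add: alive_def)
      then show ?thesis using P False arrs by (auto simp: fun_eq_iff less_Suc_eq)
    qed
  next
    fix s' :: astate
    assume "snd s' 5 = (\<lambda>u. if u \<in> alive 3 s \<and> u < n then snd s 5 u * ?d - ?w * snd s 4 u else snd s 5 u)"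
    then show "\<forall>u\<in>alive 3 s. snd (upd 3 n s') 5 u = snd s 5 u * ?d - ?w * snd s 4 u"
      by (auto simp: alive_def)
  qed auto
  moreover have "exe split_prog s = exe (PSeq (Put 3 2 (Num 1)) (Put 6 2 (Add (Var 6) (Num 1)))) (exe (For 3 ?b) ?s0)"
    by (simp add: split_prog_def del: run.simps(6) guard.simps)
  ultimately show ?thesis
    by (simp add: pushed_def del: run.simps(6) guard.simps)
qed

lemma push_prog_idle:
  assumes "fst s 20 \<noteq> 0"
  shows "snd (exe push_prog s) = snd s"
proof -
  have "fst (exe push_prog s) 20 = fst s 20 \<and> snd (exe push_prog s) = snd s"
    unfolding push_prog_def
    by (rule For_rule[where P = "\<lambda>i s'. fst s' 20 = fst s 20 \<and> snd s' = snd s"]) (use assms in auto)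
  then show ?thesis by simp
qed

lemma push_prog_spec:
  assumes init: "fst s 20 = 0" and deg: "\<And>u. u \<in> alive 3 s \<Longrightarrow> snd s 4 u \<le> n"
  shows "(snd (exe push_prog s) = snd s \<and> (\<forall>v\<in>alive 3 s. \<not> min_ratio s v)) \<or>
    (\<exists>v\<in>alive 3 s. min_ratio s v \<and> pushed s (exe push_prog s) v)"
proof -
  let ?b = "guard [Neg (Var 20), Neg (Arr 3 2)] (PSeq min_prog (guard [Var 21]
     (PSeq (Set 20 (Num 1)) split_prog)))"
  let ?A = "\<lambda>i s'. fst s' 20 = 0 \<and> snd s' = snd s \<and> (\<forall>v\<in>alive 3 s. v < i \<longrightarrow> \<not> min_ratio s v)"
  let ?B = "\<lambda>s'. fst s' 20 = 1 \<and> (\<exists>v\<in>alive 3 s. min_ratio s v \<and> pushed s s' v)"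
  show ?thesis
    unfolding push_prog_def
  proof (rule For_rule[where P = "\<lambda>i s'. ?A i s' \<or> ?B s'"])
    fix i and s' :: astate
    assume i: "i < n" and fv: "\<And>x. x \<notin> insert 2 (vmods ?b) \<Longrightarrow> fst s' x = fst s x"
      and P: "?A i s' \<or> ?B s'"
    show "?A (Suc i) (exe ?b (upd 2 i s')) \<or> ?B (exe ?b (upd 2 i s'))"
    proof (cases "fst s' 20 = 0")
      case False
      then have "?B s'" using P by auto
      then show ?thesis by (simp add: pushed_def)
    next
      case True
      then have A: "snd s' = snd s" "\<forall>v\<in>alive 3 s. v < i \<longrightarrow> \<not> min_ratio s v" using P by auto
      let ?s = "upd 2 i s'"
      have al: "alive 3 ?s = alive 3 s" using A by (simp add: alive_def)
      show ?thesis
      proof (cases "i \<in> alive 3 s")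
        case False
        then have "snd s 3 i \<noteq> 0" using i by (simp add: alive_def)
        then show ?thesis using True A False by (auto simp: less_Suc_eq)
      next
        case iA: True
        then have s3: "snd s 3 i = 0" by (simp add: alive_def)
        have "min_ratio ?s i \<longleftrightarrow> min_ratio s i" unfolding min_ratio_def al by (simp add: A(1))
        moreover have "fst (exe min_prog ?s) 21 = of_bool (min_ratio ?s (fst ?s 2))"
        proof (rule min_prog_val)
          show "snd ?s 4 u \<le> n" if "u \<in> alive 3 ?s" for u
            using deg that unfolding al by (simp add: A(1))
          show "fst ?s 2 \<in> alive 3 ?s" unfolding al by (simp add: iA)
        qed
        ultimately have m: "fst (exe min_prog ?s) 21 = of_bool (min_ratio s i)" by simp
        show ?thesis
        proof (cases "min_ratio s i")
          case False
          then have "exe ?b ?s = exe min_prog ?s" using True A s3 m by simp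
          then show ?thesis using True A False by (auto simp: less_Suc_eq frame_arrs)
        next
          case mr: True
          let ?t = "upd 20 1 (exe min_prog ?s)"
          have t: "snd ?t = snd s" "fst ?t 2 = i" "fst ?t 6 = fst s 6"
            using A fv[of 6] by (auto simp: frame_arrs)
          then have al': "alive 3 ?t = alive 3 s" by (simp add: alive_def)
          have e: "exe ?b ?s = exe split_prog ?t" using True A s3 m mr by simp
          have "pushed ?t (exe split_prog ?t) (fst ?t 2)"
          proof (rule split_prog_spec)
            show "snd ?t 4 u \<le> n" if "u \<in> alive 3 ?t" for u
              using deg that unfolding al' t(1) by simp
            show "fst ?t 2 \<in> alive 3 ?t" unfolding al' t(2) by (rule iA)
          qed
          then have "pushed s (exe split_prog ?t) i"
            unfolding pushed_def al' t .
          moreover have "fst (exe split_prog ?t) 20 = 1" by simp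
          ultimately show ?thesis using iA mr unfolding e by blast
        qed
      qed
    qed
  next
    fix s' :: astate assume "?A n s' \<or> ?B s'"
    then show "(snd (upd 2 n s') = snd s \<and> (\<forall>v\<in>alive 3 s. \<not> min_ratio s v)) \<or>
      (\<exists>v\<in>alive 3 s. min_ratio s v \<and> pushed s (upd 2 n s') v)"
      by (auto simp: alive_def pushed_def)
  qed (use init in auto)
qed

lemma ex_min_ratio:
  assumes "alive 3 s \<noteq> {}" "\<And>u. u \<in> alive 3 s \<Longrightarrow> 0 < snd s 4 u"
  shows "\<exists>v\<in>alive 3 s. min_ratio s v"
proof -
  let ?f = "\<lambda>v. real (snd s 5 v) / real (snd s 4 v)"
  obtain v where v: "v \<in> alive 3 s" "\<And>u. u \<in> alive 3 s \<Longrightarrow> ?f v \<le> ?f u"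
    using arg_min_if_finite[OF finite_alive assms(1), of ?f] by (meson not_le)
  have "snd s 5 v * snd s 4 u \<le> snd s 5 u * snd s 4 v" if u: "u \<in> alive 3 s" for u
  proof -
    have "real (snd s 5 v * snd s 4 u) \<le> real (snd s 5 u * snd s 4 v)"
      using v(2)[OF u] assms(2)[OF u] assms(2)[OF v(1)] by (simp add: field_simps)
    then show ?thesis by (simp only: of_nat_le_iff)
  qed
  then show ?thesis using v(1) by (auto simp: min_ratio_def)
qed

text \<open>The three outcomes are those of \<open>ratio_inv_idle\<close>,
  \<open>ratio_inv_leaf\<close> and \<open>ratio_inv_push\<close>.\<close>

lemma ratio_step_prog_cases:
  fixes s defines "U \<equiv> alive 3 s" and "s' \<equiv> exe ratio_step_prog s"
  obtains
    (idle) "U = {}" "alive 3 s' = {}" "snd s' 5 = snd s 5" "snd s' 6 = snd s 6"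
  | (leaf) v where "v \<in> U" "ldeg U v \<le> 1" "alive 3 s' = U - {v}" "snd s' 5 = snd s 5" "snd s' 6 = snd s 6"
  | (push) v where "v \<in> U" "\<And>u. u \<in> U \<Longrightarrow> 2 \<le> ldeg U u" "alive 3 s' = U - {v}"
      "\<And>u. u \<in> U \<Longrightarrow> snd s 5 v * ldeg U u \<le> snd s 5 u * ldeg U v"
      "\<And>u. u \<in> U \<Longrightarrow> snd s' 5 u = snd s 5 u * ldeg U v - snd s 5 v * ldeg U u"
      "snd s' 6 = (snd s 6)(v := Suc (fst s 6))"
proof -
  define s1 where "s1 = upd 20 0 (exe degrees_prog s)"
  define s2 where "s2 = exe leaf_prog s1"
  have s': "s' = exe push_prog s2" by (simp add: s'_def ratio_step_prog_def s1_def s2_def)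
  have U1: "alive 3 s1 = U" by (simp add: alive_def U_def s1_def)
  have d1: "snd s1 4 u = ldeg U u" if "u \<in> U" for u
    using degrees_prog_val[of u s] that by (simp add: s1_def U_def)
  have a1: "snd s1 5 = snd s 5" "snd s1 6 = snd s 6" "snd s1 3 = snd s 3" "fst s1 6 = fst s 6"
    by (simp_all add: s1_def)
  have a2: "snd s2 4 = snd s1 4" "snd s2 5 = snd s1 5" "snd s2 6 = snd s1 6" "fst s2 6 = fst s1 6"
    by (simp_all add: s2_def)
  have remove: "alive 3 t = U - {v}" if "v \<in> U" "snd t 3 = (snd s 3)(v := 1)" for t v
    using that by (auto simp: alive_def U_def)
  have "fst s1 20 = 0" by (simp add: s1_def)
  from leaf_prog_spec[OF this] consider
    "fst s2 20 = 0" "snd s2 3 = snd s1 3" "\<forall>v\<in>U. 2 \<le> snd s1 4 v"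
    | "fst s2 20 = 1" "leaf_removed s1 s2"
    unfolding s2_def[symmetric] U1 by metis
  then show thesis
  proof cases
    case 2
    then obtain v where v: "v \<in> U" "snd s1 4 v \<le> 1" "snd s2 3 = (snd s1 3)(v := 1)"
      unfolding leaf_removed_def U1 by blast
    have "snd s' = snd s2" unfolding s' by (rule push_prog_idle) (use 2 in simp)
    then show thesis
      using v d1[OF v(1)] a1 a2 remove[of v s'] by (intro leaf[of v]) auto
  next
    case 1
    have U2: "alive 3 s2 = U" using 1 a1 by (simp add: alive_def U_def)
    have d2: "snd s2 4 u = ldeg U u" if "u \<in> U" for u using d1[OF that] a2 by simp
    have "U \<subseteq> {..<n}" by (auto simp: U_def alive_def)
    then have "snd s2 4 u \<le> n" if "u \<in> alive 3 s2" for u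
      using that unfolding U2 by (simp add: d2 ldeg_le)
    from push_prog_spec[OF 1(1) this] consider
      "snd s' = snd s2" "\<forall>v\<in>U. \<not> min_ratio s2 v" | v where "v \<in> U" "min_ratio s2 v" "pushed s2 s' v"
      unfolding s'[symmetric] U2 by metis
    then show thesis
    proof cases
      case a: 1
      \<comment> \<open>All degrees are positive here, so a nonempty \<open>U\<close> would contain
        a vertex of least ratio, which would have been pushed.\<close>
      have "U = {}"
      proof (rule ccontr)
        assume "U \<noteq> {}"
        moreover have "0 < snd s2 4 u" if "u \<in> U" for u using 1(3) that a2 by fastforce
        ultimately show False using ex_min_ratio[of s2] a(2) U2 by auto
      qed
      moreover have "alive 3 s' = U" using a(1) U2 by (simp add: alive_def)
      ultimately show thesis using a a1 a2 by (intro idle) auto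
    next
      case (2 v)
      show thesis
      proof (rule push[OF 2(1)])
        show "2 \<le> ldeg U u" if "u \<in> U" for u using 1(3) d1[OF that] that by auto
        show "alive 3 s' = U - {v}"
          by (rule remove[OF 2(1)]) (use 2(3) 1 a1 in \<open>simp add: pushed_def\<close>)
        show "snd s 5 v * ldeg U u \<le> snd s 5 u * ldeg U v" if "u \<in> U" for u
          using 2(2) that unfolding min_ratio_def U2 by (simp add: d1 2(1) a1 a2)
        show "snd s' 5 u = snd s 5 u * ldeg U v - snd s 5 v * ldeg U u" if "u \<in> U" for u
          using 2(3) that unfolding pushed_def U2 by (simp add: d1 2(1) a1 a2)
        show "snd s' 6 = (snd s 6)(v := Suc (fst s 6))"
          using 2(3) a1 a2 by (simp add: pushed_def)
      qed
    qed
  qed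
qed

lemma alive_cong: "snd s q = snd s' q \<Longrightarrow> alive q s = alive q s'"
  by (simp add: alive_def)

text \<open>Stands for a disjoint union of diamonds. Only the consequence is stored: a set that
  meets every diamond contains at least a quarter of \<open>D\<close>.\<close>

definition packing :: "nat set \<Rightarrow> bool" where
  "packing D \<longleftrightarrow> (\<forall>H. diamond_free ({..<n} - H) \<longrightarrow> card D \<le> 4 * card (D \<inter> H))"

text \<open>A specification for nested searches. The property is inherited by subsets and ignores
  variables that the program changes, so what one iteration achieves survives later ones, which only
  shrink the set of alive vertices.\<close>

definition establishes :: "nat set \<Rightarrow> prog \<Rightarrow> ((nat \<Rightarrow> nat) \<Rightarrow> nat set \<Rightarrow> bool) \<Rightarrow> bool" where
  "establishes I p \<psi> \<longleftrightarrow>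
     (\<forall>\<sigma> X Y. X \<subseteq> Y \<longrightarrow> \<psi> \<sigma> Y \<longrightarrow> \<psi> \<sigma> X) \<and>
     (\<forall>\<sigma> \<sigma>' X. (\<forall>x. x \<notin> vmods p \<longrightarrow> \<sigma> x = \<sigma>' x) \<longrightarrow> \<psi> \<sigma> X = \<psi> \<sigma>' X) \<and>
     (\<forall>s. (\<forall>i\<in>I. fst s i < n) \<longrightarrow> packing ({..<n} - alive 2 s) \<longrightarrow>
        packing ({..<n} - alive 2 (exe p s)) \<and> alive 2 (exe p s) \<subseteq> alive 2 s \<and>
        \<psi> (fst s) (alive 2 (exe p s)))"

lemma establishesD:
  assumes "establishes I p \<psi>" "\<forall>i\<in>I. fst s i < n" "packing ({..<n} - alive 2 s)"
  shows "packing ({..<n} - alive 2 (exe p s))" "alive 2 (exe p s) \<subseteq> alive 2 s"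
    "\<psi> (fst s) (alive 2 (exe p s))"
  using assms unfolding establishes_def by blast+

lemma establishes_For:
  assumes est: "establishes (insert r I) p \<psi>" and I: "I \<inter> insert r (vmods p) = {}"
  shows "establishes I (For r p) (\<lambda>\<sigma> X. \<forall>i<n. \<psi> (\<sigma>(r := i)) X)"
  unfolding establishes_def
proof (intro conjI allI impI)
  have anti: "\<psi> \<sigma> Y \<Longrightarrow> X \<subseteq> Y \<Longrightarrow> \<psi> \<sigma> X" for \<sigma> X Y
    using est unfolding establishes_def by blast
  have indep: "(\<And>x. x \<notin> vmods p \<Longrightarrow> \<sigma> x = \<sigma>' x) \<Longrightarrow> \<psi> \<sigma> X = \<psi> \<sigma>' X" for \<sigma> \<sigma>' X
    using est unfolding establishes_def by blast
  have body: "packing ({..<n} - alive 2 (exe p s)) \<and> alive 2 (exe p s) \<subseteq> alive 2 s \<and>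
      \<psi> (fst s) (alive 2 (exe p s))"
    if "\<forall>i\<in>insert r I. fst s i < n" "packing ({..<n} - alive 2 s)" for s
    using establishesD[OF est that] by blast
  show "\<psi> (\<sigma>(r := i)) X" if "\<forall>i<n. \<psi> (\<sigma>(r := i)) Y" "X \<subseteq> Y" "i < n" for \<sigma> X Y i
    using that anti by blast
  show "(\<forall>i<n. \<psi> (\<sigma>(r := i)) X) = (\<forall>i<n. \<psi> (\<sigma>'(r := i)) X)"
    if "\<forall>x. x \<notin> vmods (For r p) \<longrightarrow> \<sigma> x = \<sigma>' x" for \<sigma> \<sigma>' X
  proof -
    have "\<psi> (\<sigma>(r := i)) X = \<psi> (\<sigma>'(r := i)) X" for i by (rule indep) (use that in auto)
    then show ?thesis by simp
  qed
  fix s assume s: "\<forall>i\<in>I. fst s i < n" and pack: "packing ({..<n} - alive 2 s)"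
  have "packing ({..<n} - alive 2 (exe (For r p) s)) \<and> alive 2 (exe (For r p) s) \<subseteq> alive 2 s \<and>
      (\<forall>i<n. \<psi> ((fst s)(r := i)) (alive 2 (exe (For r p) s)))"
  proof (rule For_rule[where P = "\<lambda>i s'. packing ({..<n} - alive 2 s') \<and> alive 2 s' \<subseteq> alive 2 s \<and>
      (\<forall>j<i. \<psi> ((fst s)(r := j)) (alive 2 s'))"])
    fix i and s' :: astate
    assume i: "i < n" and fv: "\<And>x. x \<notin> insert r (vmods p) \<Longrightarrow> fst s' x = fst s x"
      and P: "packing ({..<n} - alive 2 s') \<and> alive 2 s' \<subseteq> alive 2 s \<and>
        (\<forall>j<i. \<psi> ((fst s)(r := j)) (alive 2 s'))"
    let ?s = "upd r i s'"
    have al: "alive 2 ?s = alive 2 s'" by (rule alive_cong) simp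
    have "fst ?s j < n" if "j \<in> insert r I" for j
    proof (cases "j = r")
      case False
      then have "j \<notin> insert r (vmods p)" "j \<in> I" using I that by auto
      then show ?thesis using s fv[of j] False by simp
    qed (simp add: i)
    then have b: "packing ({..<n} - alive 2 (exe p ?s)) \<and> alive 2 (exe p ?s) \<subseteq> alive 2 s' \<and>
      \<psi> (fst ?s) (alive 2 (exe p ?s))"
      using body[of ?s] P unfolding al by blast
    have "\<psi> ((fst s)(r := i)) X = \<psi> (fst ?s) X" for X
      by (rule indep) (use fv in auto)
    then show "packing ({..<n} - alive 2 (exe p ?s)) \<and> alive 2 (exe p ?s) \<subseteq> alive 2 s \<and>
        (\<forall>j<Suc i. \<psi> ((fst s)(r := j)) (alive 2 (exe p ?s)))"
      using b P anti unfolding less_Suc_eq by blast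
  next
    fix s' :: astate
    assume P: "packing ({..<n} - alive 2 s') \<and> alive 2 s' \<subseteq> alive 2 s \<and>
      (\<forall>j<n. \<psi> ((fst s)(r := j)) (alive 2 s'))"
    have "alive 2 (upd r n s') = alive 2 s'" by (rule alive_cong) simp
    then show "packing ({..<n} - alive 2 (upd r n s')) \<and> alive 2 (upd r n s') \<subseteq> alive 2 s \<and>
      (\<forall>i<n. \<psi> ((fst s)(r := i)) (alive 2 (upd r n s')))" using P by simp
  qed (use pack in simp)
  then show "packing ({..<n} - alive 2 (exe (For r p) s))" "alive 2 (exe (For r p) s) \<subseteq> alive 2 s"
    "\<And>i. i < n \<Longrightarrow> \<psi> ((fst s)(r := i)) (alive 2 (exe (For r p) s))" by blast+
qed

text \<open>Four vertices are added, and \<open>H\<close> must contain one of them; as they avoid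
  \<open>D\<close>, it has not been counted before.\<close>

lemma packing_diamond:
  assumes pack: "packing D" and D: "finite D" and dia: "diamond a b c d"
    and out: "{a, b, c, d} \<inter> D = {}" "{a, b, c, d} \<subseteq> {..<n}"
  shows "packing (D \<union> {a, b, c, d})"
  unfolding packing_def
proof (intro allI impI)
  fix H assume H: "diamond_free ({..<n} - H)"
  have "card (D \<union> {a, b, c, d}) = card D + card {a, b, c, d}"
    using out D by (intro card_Un_disjoint) auto
  moreover have "card {a, b, c, d} \<le> 4" by (simp add: card_insert_if)
  moreover have "card D \<le> 4 * card (D \<inter> H)" using pack H by (simp add: packing_def)
  moreover have "card (D \<inter> H) + 1 \<le> card ((D \<union> {a, b, c, d}) \<inter> H)"
  proof -
    have "\<not> {a, b, c, d} \<subseteq> {..<n} - H"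
    proof
      assume "{a, b, c, d} \<subseteq> {..<n} - H"
      then have "a \<in> {..<n} - H" "b \<in> {..<n} - H" "c \<in> {..<n} - H" "d \<in> {..<n} - H" by auto
      then show False using H dia unfolding diamond_free_def by blast
    qed
    then obtain x where x: "x \<in> {a, b, c, d}" "x \<in> H"
      using out(2) by blast
    then have "card (insert x (D \<inter> H)) = card (D \<inter> H) + 1" using D out by auto
    moreover have "card (insert x (D \<inter> H)) \<le> card ((D \<union> {a, b, c, d}) \<inter> H)"
      using D x by (intro card_mono) auto
    ultimately show ?thesis by simp
  qed
  ultimately show "card (D \<union> {a, b, c, d}) \<le> 4 * card ((D \<union> {a, b, c, d}) \<inter> H)" by linarith
qed

lemma establishes_diamond_step:
  "establishes {5, 4, 3, 2} diamond_step_prog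
     (\<lambda>\<sigma> X. \<not> (diamond (\<sigma> 2) (\<sigma> 3) (\<sigma> 4) (\<sigma> 5) \<and> {\<sigma> 2, \<sigma> 3, \<sigma> 4, \<sigma> 5} \<subseteq> X))"
  unfolding establishes_def
proof (intro conjI allI impI)
  have mods: "vmods diamond_step_prog = {}" by (simp add: diamond_step_prog_def)
  show "(\<not> (diamond (\<sigma> 2) (\<sigma> 3) (\<sigma> 4) (\<sigma> 5) \<and> {\<sigma> 2, \<sigma> 3, \<sigma> 4, \<sigma> 5} \<subseteq> X)) =
      (\<not> (diamond (\<sigma>' 2) (\<sigma>' 3) (\<sigma>' 4) (\<sigma>' 5) \<and> {\<sigma>' 2, \<sigma>' 3, \<sigma>' 4, \<sigma>' 5} \<subseteq> X))"
    if "\<forall>x. x \<notin> vmods diamond_step_prog \<longrightarrow> \<sigma> x = \<sigma>' x" for \<sigma> \<sigma>' :: "nat \<Rightarrow> nat" and X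
    using that by (simp add: mods)
  fix s assume s: "\<forall>i\<in>{5, 4, 3, 2}. fst s i < n" and pack: "packing ({..<n} - alive 2 s)"
  let ?D = "{fst s 2, fst s 3, fst s 4, fst s 5}"
  have *: "packing ({..<n} - alive 2 (exe diamond_step_prog s)) \<and>
      alive 2 (exe diamond_step_prog s) \<subseteq> alive 2 s \<and>
      \<not> (diamond (fst s 2) (fst s 3) (fst s 4) (fst s 5) \<and> ?D \<subseteq> alive 2 (exe diamond_step_prog s))"
  proof (cases "diamond (fst s 2) (fst s 3) (fst s 4) (fst s 5) \<and> ?D \<subseteq> alive 2 s")
    case True
    then have "fst s 2 \<noteq> fst s 5" by (auto simp: diamond_def)
    then have "exe diamond_step_prog s = (fst s, (snd s)(2 := (snd s 2)(fst s 2 := 1, fst s 3 := 1, fst s 4 := 1, fst s 5 := 1)))"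
      using True by (auto simp: diamond_step_prog_def diamond_def alive_def)
    then have al: "alive 2 (exe diamond_step_prog s) = alive 2 s - ?D"
      by (auto simp: alive_def)
    have "packing (({..<n} - alive 2 s) \<union> ?D)"
      by (rule packing_diamond[OF pack]) (use True s in auto)
    moreover have "{..<n} - (alive 2 s - ?D) = ({..<n} - alive 2 s) \<union> ?D" using s by auto
    ultimately show ?thesis by (simp add: al)
  next
    case False
    then have "exe diamond_step_prog s = s"
      using s by (auto simp: diamond_step_prog_def diamond_def alive_def)
    then show ?thesis using pack False by simp
  qed
  from * show "packing ({..<n} - alive 2 (exe diamond_step_prog s))" by blast
  from * show "alive 2 (exe diamond_step_prog s) \<subseteq> alive 2 s" by blast
  from * show "\<not> (diamond (fst s 2) (fst s 3) (fst s 4) (fst s 5) \<and> ?D \<subseteq> alive 2 (exe diamond_step_prog s))" by blast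
qed blast

lemma diamond_prog_spec:
  assumes "snd s 2 = (\<lambda>_. 0)"
  shows "packing ({..<n} - alive 2 (exe diamond_prog s))" "diamond_free (alive 2 (exe diamond_prog s))"
proof -
  have mods: "vmods diamond_step_prog = {}" by (simp add: diamond_step_prog_def)
  let ?\<psi> = "\<lambda>\<sigma> X. \<not> (diamond (\<sigma> 2) (\<sigma> 3) (\<sigma> 4) (\<sigma> 5) \<and> {\<sigma> 2, \<sigma> 3, \<sigma> 4, \<sigma> 5} \<subseteq> X)"
  have "establishes {4, 3, 2} (For 5 diamond_step_prog) (\<lambda>\<sigma> X. \<forall>d<n. ?\<psi> (\<sigma>(5 := d)) X)"
    by (rule establishes_For[OF establishes_diamond_step]) (simp add: mods)
  then have "establishes {3, 2} (For 4 (For 5 diamond_step_prog))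
      (\<lambda>\<sigma> X. \<forall>c<n. \<forall>d<n. ?\<psi> (\<sigma>(4 := c, 5 := d)) X)"
    by (rule establishes_For) (simp add: mods)
  then have "establishes {2} (For 3 (For 4 (For 5 diamond_step_prog)))
      (\<lambda>\<sigma> X. \<forall>b<n. \<forall>c<n. \<forall>d<n. ?\<psi> (\<sigma>(3 := b, 4 := c, 5 := d)) X)"
    by (rule establishes_For) (simp add: mods)
  then have est: "establishes {} diamond_prog
      (\<lambda>\<sigma> X. \<forall>a<n. \<forall>b<n. \<forall>c<n. \<forall>d<n. ?\<psi> (\<sigma>(2 := a, 3 := b, 4 := c, 5 := d)) X)"
    unfolding diamond_prog_def by (rule establishes_For) (simp add: mods)
  have "alive 2 s = {..<n}" using assms by (auto simp: alive_def)
  then have init: "packing ({..<n} - alive 2 s)" by (simp add: packing_def)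
  have free: "\<forall>a<n. \<forall>b<n. \<forall>c<n. \<forall>d<n.
      ?\<psi> ((fst s)(2 := a, 3 := b, 4 := c, 5 := d)) (alive 2 (exe diamond_prog s))"
    by (rule establishesD(3)[OF est _ init]) simp
  show "packing ({..<n} - alive 2 (exe diamond_prog s))"
    by (rule establishesD(1)[OF est _ init]) simp
  show "diamond_free (alive 2 (exe diamond_prog s))"
    unfolding diamond_free_def
  proof (intro ballI notI)
    fix a b c d
    assume "a \<in> alive 2 (exe diamond_prog s)" "b \<in> alive 2 (exe diamond_prog s)"
      "c \<in> alive 2 (exe diamond_prog s)" "d \<in> alive 2 (exe diamond_prog s)" "diamond a b c d"
    moreover from this have "a < n" "b < n" "c < n" "d < n" by (simp_all add: alive_def)
    ultimately show False using free[rule_format, of a b c d] by simp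
  qed
qed

end

section \<open>Tests by leaf elimination and the two phases on a diamond-free graph\<close>

locale diamond_free_program = graph_program adj n + diamond_free_graph adj V
  for adj :: "nat \<Rightarrow> nat \<Rightarrow> bool" and n :: nat and V :: "nat set" +
  assumes V_less: "V \<subseteq> {..<n}"
begin

lemma hdeg_eq_ldeg:
  assumes "X \<subseteq> V" "v \<in> V"
  shows "hdeg X v = ldeg X v"
  using hdeg_eq_card_least[OF assms, of id] by (simp add: ldeg_def least_in_class_def)

text \<open>If a sweep leaves the set as it was, all its degrees were taken in the same set and
  found to be at least two.\<close>

lemma sweep_prog_spec:
  assumes V: "alive 8 s \<subseteq> V"
  shows "alive 8 (exe sweep_prog s) \<subseteq> alive 8 s \<and> cyc (alive 8 (exe sweep_prog s)) = cyc (alive 8 s) \<and>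
    (alive 8 (exe sweep_prog s) = alive 8 s \<longrightarrow> (\<forall>v\<in>alive 8 s. 2 \<le> hdeg (alive 8 s) v))"
proof -
  let ?b = "guard [Neg (Arr 8 2)] (PSeq (deg_prog 8 2) (guard [Sub (Num 2) (Var 13)] (Put 8 2 (Num 1))))"
  let ?P = "\<lambda>i s'. alive 8 s' \<subseteq> alive 8 s \<and> cyc (alive 8 s') = cyc (alive 8 s) \<and>
    (alive 8 s' = alive 8 s \<longrightarrow> (\<forall>v\<in>alive 8 s. v < i \<longrightarrow> 2 \<le> hdeg (alive 8 s) v))"
  show ?thesis
    unfolding sweep_prog_def
  proof (rule For_rule[where P = ?P])
    fix i and s' :: astate
    assume i: "i < n" and P: "?P i s'"
    let ?s = "upd 2 i s'"
    have al: "alive 8 ?s = alive 8 s'" by (rule alive_cong) simp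
    show "?P (Suc i) (exe ?b ?s)"
    proof (cases "i \<in> alive 8 s'")
      case False
      then have "snd s' 8 i \<noteq> 0" using i by (simp add: alive_def)
      then have "alive 8 (exe ?b ?s) = alive 8 s'" by (simp add: al)
      then show ?thesis using P False unfolding less_Suc_eq by auto
    next
      case True
      then have i0: "snd s' 8 i = 0" by (simp add: alive_def)
      have iV: "i \<in> V" "alive 8 s' \<subseteq> V" using True P V by auto
      have deg: "fst (exe (deg_prog 8 2) ?s) 13 = hdeg (alive 8 s') i"
        using deg_prog_val[of 2 8 ?s] hdeg_eq_ldeg[OF iV(2,1)] by (simp add: al)
      show ?thesis
      proof (cases "hdeg (alive 8 s') i \<le> 1")
        case leaf: True
        have "snd (exe ?b ?s) 8 = (snd s' 8)(i := 1)" using i0 deg leaf by simp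
        then have e: "alive 8 (exe ?b ?s) = alive 8 s' - {i}" by (auto simp: alive_def)
        have "cyc (alive 8 s' - {i}) = cyc (alive 8 s')"
          by (rule cyc_remove_leaf) (use leaf in auto)
        moreover have "alive 8 s' - {i} \<noteq> alive 8 s" using True P by auto
        ultimately show ?thesis using P unfolding e by auto
      next
        case False
        then have "snd (exe ?b ?s) 8 = snd s' 8" using i0 deg by simp
        then have "alive 8 (exe ?b ?s) = alive 8 s'" by (rule alive_cong)
        then show ?thesis using P False unfolding less_Suc_eq by auto
      qed
    qed
  next
    fix s' :: astate assume P: "?P n s'"
    have "alive 8 (upd 2 n s') = alive 8 s'" by (rule alive_cong) simp
    then show "alive 8 (upd 2 n s') \<subseteq> alive 8 s \<and> cyc (alive 8 (upd 2 n s')) = cyc (alive 8 s) \<and>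
      (alive 8 (upd 2 n s') = alive 8 s \<longrightarrow> (\<forall>v\<in>alive 8 s. 2 \<le> hdeg (alive 8 s) v))"
      using P by (auto simp: alive_def)
  qed auto
qed

text \<open>The rank never changes. If it is zero, every nonempty set has a leaf, so each sweep
  removes a vertex and \<open>n\<close> sweeps suffice; if it is positive, the set cannot become
  empty.\<close>

lemma eliminate_prog_spec:
  assumes V: "alive 8 s \<subseteq> V"
  shows "alive 8 (exe eliminate_prog s) = {} \<longleftrightarrow> cyc (alive 8 s) = 0"
proof -
  let ?P = "\<lambda>i s'. alive 8 s' \<subseteq> alive 8 s \<and> cyc (alive 8 s') = cyc (alive 8 s) \<and>
    (cyc (alive 8 s) = 0 \<longrightarrow> alive 8 s' = {} \<or> card (alive 8 s') + i \<le> n)"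
  show ?thesis
    unfolding eliminate_prog_def
  proof (rule For_rule[where P = ?P])
    have "card (alive 8 s) \<le> card {..<n}" by (rule card_mono) (auto simp: alive_def)
    then show "?P 0 s" by simp
    fix i and s' :: astate
    assume P: "?P i s'"
    let ?s = "upd 4 i s'"
    have al: "alive 8 ?s = alive 8 s'" by (rule alive_cong) simp
    note sweep = sweep_prog_spec[of ?s, unfolded al]
    have sub: "alive 8 s' \<subseteq> V" using P V by auto
    show "?P (Suc i) (exe sweep_prog ?s)"
    proof (intro conjI impI)
      show "alive 8 (exe sweep_prog ?s) \<subseteq> alive 8 s" "cyc (alive 8 (exe sweep_prog ?s)) = cyc (alive 8 s)"
        using sweep[OF sub] P by auto
      assume 0: "cyc (alive 8 s) = 0"
      show "alive 8 (exe sweep_prog ?s) = {} \<or> card (alive 8 (exe sweep_prog ?s)) + Suc i \<le> n"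
      proof (cases "alive 8 s' = {}")
        case True
        then show ?thesis using sweep[OF sub] by auto
      next
        case False
        then obtain v where "v \<in> alive 8 s'" "hdeg (alive 8 s') v \<le> 1"
          using ex_leaf[of "alive 8 s'"] P 0 by auto
        then have "alive 8 (exe sweep_prog ?s) \<noteq> alive 8 s'" using sweep[OF sub] by force
        then have "alive 8 (exe sweep_prog ?s) \<subset> alive 8 s'" using sweep[OF sub] by auto
        then have "card (alive 8 (exe sweep_prog ?s)) < card (alive 8 s')" by (intro psubset_card_mono) auto
        then show ?thesis using P 0 False by auto
      qed
    qed
  next
    fix s' :: astate assume P: "?P n s'"
    have "alive 8 (upd 4 n s') = alive 8 s'" by (rule alive_cong) simp
    then show "alive 8 (upd 4 n s') = {} \<longleftrightarrow> cyc (alive 8 s) = 0" using P by auto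
  qed
qed

lemma test_prog_val:
  assumes V: "insert (fst s 7) (alive 7 s) \<subseteq> V"
  shows "fst (exe test_prog s) 24 = 0 \<longleftrightarrow> cyc (insert (fst s 7) (alive 7 s)) = 0"
proof -
  define s1 where "s1 = exe (For 2 (Put 8 2 (Arr 7 2))) s"
  define s2 where "s2 = exe (Put 8 7 (Num 0)) s1"
  define s3 where "s3 = upd 24 0 (exe eliminate_prog s2)"
  have "\<forall>i<n. snd s1 8 i = snd s 7 i"
    unfolding s1_def
  proof (rule For_rule[where P = "\<lambda>i s'. \<forall>j<i. snd s' 8 j = snd s 7 j"])
    fix i and s' :: astate
    assume fa: "\<And>c. c \<notin> amods (Put 8 2 (Arr 7 2)) \<Longrightarrow> snd s' c = snd s c"
      and P: "\<forall>j<i. snd s' 8 j = snd s 7 j"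
    have "snd s' 7 = snd s 7" using fa[of 7] by simp
    then show "\<forall>j<Suc i. snd (exe (Put 8 2 (Arr 7 2)) (upd 2 i s')) 8 j = snd s 7 j"
      using P by (auto simp: less_Suc_eq)
  qed auto
  moreover have "fst s1 7 = fst s 7" by (simp add: s1_def del: run.simps(6))
  moreover have "fst s 7 < n" using V V_less by auto
  ultimately have a2: "alive 8 s2 = insert (fst s 7) (alive 7 s)"
    by (auto simp: s2_def alive_def)
  have "fst (exe (For 2 (guard [Neg (Arr 8 2)] (Set 24 (Num 1)))) s3) 24 = of_bool (alive 8 s3 \<noteq> {})"
  proof (rule For_rule[where P = "\<lambda>i s'. fst s' 24 = of_bool (\<exists>j\<in>alive 8 s3. j < i)"])
    fix i and s' :: astate
    assume i: "i < n" and fa: "\<And>c. c \<notin> amods (guard [Neg (Arr 8 2)] (Set 24 (Num 1))) \<Longrightarrow> snd s' c = snd s3 c"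
      and P: "fst s' 24 = of_bool (\<exists>j\<in>alive 8 s3. j < i)"
    have "snd s' 8 = snd s3 8" using fa[of 8] by simp
    moreover have "i \<in> alive 8 s3 \<longleftrightarrow> snd s3 8 i = 0" using i by (simp add: alive_def)
    ultimately show "fst (exe (guard [Neg (Arr 8 2)] (Set 24 (Num 1))) (upd 2 i s')) 24 =
        of_bool (\<exists>j\<in>alive 8 s3. j < Suc i)"
      using P by (auto simp: less_Suc_eq)
  next
    fix s' :: astate assume "fst s' 24 = of_bool (\<exists>j\<in>alive 8 s3. j < n)"
    then show "fst (upd 2 n s') 24 = of_bool (alive 8 s3 \<noteq> {})" by (auto simp: alive_def)
  qed (simp add: s3_def)
  moreover have "exe test_prog s = exe (For 2 (guard [Neg (Arr 8 2)] (Set 24 (Num 1)))) s3"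
    by (simp add: test_prog_def s1_def s2_def s3_def del: run.simps(6) guard.simps)
  moreover have "alive 8 s3 = alive 8 (exe eliminate_prog s2)" unfolding s3_def by (rule alive_cong) simp
  moreover have "alive 8 (exe eliminate_prog s2) = {} \<longleftrightarrow> cyc (alive 8 s2) = 0"
    by (rule eliminate_prog_spec) (use a2 V in simp)
  ultimately show ?thesis by (simp add: a2)
qed

lemma ratio_prog_spec:
  assumes "alive 3 s = V" "\<And>v. v \<in> V \<Longrightarrow> snd s 5 v = 1" "snd s 6 = (\<lambda>_. 0)"
  shows "ratio_inv n {} (snd (exe ratio_prog s) 5) (snd (exe ratio_prog s) 6)"
proof -
  let ?P = "\<lambda>t s'. ratio_inv t (alive 3 s') (snd s' 5) (snd s' 6) \<and> card (alive 3 s') \<le> n - t"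
  show ?thesis
    unfolding ratio_prog_def
  proof (rule For_rule[where P = ?P])
    have "card V \<le> n" using card_mono[OF _ V_less] by simp
    then show "?P 0 s" using ratio_inv_init[of "snd s 5"] assms by simp
    fix t and s' :: astate
    assume t: "t < n" and P: "?P t s'"
    let ?s = "upd 6 t s'" and ?s' = "exe ratio_step_prog (upd 6 t s')"
    have al: "alive 3 ?s = alive 3 s'" by (simp add: alive_def)
    have inv: "ratio_inv t (alive 3 s') (snd s' 5) (snd s' 6)" using P by simp
    have UV: "alive 3 s' \<subseteq> V" by (rule ratio_invD[OF inv])
    then have deg: "hdeg (alive 3 s') u = ldeg (alive 3 s') u" if "u \<in> alive 3 s'" for u
      using hdeg_eq_ldeg that by blast
    have card: "card (alive 3 s' - {v}) \<le> n - Suc t" if "v \<in> alive 3 s'" for v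
    proof -
      have "card (alive 3 s' - {v}) = card (alive 3 s') - 1" using that by simp
      then show ?thesis using P by linarith
    qed
    show "?P (Suc t) ?s'"
    proof (cases rule: ratio_step_prog_cases[of ?s, unfolded al, case_names idle leaf push])
      case idle
      then show ?thesis using ratio_inv_idle[of t] inv by simp
    next
      case (leaf v)
      have "ratio_inv (Suc t) (alive 3 s' - {v}) (snd s' 5) (snd s' 6)"
        by (rule ratio_inv_leaf[OF inv leaf(1)]) (use leaf(2) deg[OF leaf(1)] in simp)
      then show ?thesis using leaf card[OF leaf(1)] by simp
    next
      case (push v)
      have "ratio_inv (Suc t) (alive 3 s' - {v}) (snd ?s' 5) ((snd s' 6)(v := Suc t))"
        by (rule ratio_inv_push[OF inv _ push(1)]) (use push deg in simp_all)
      then show ?thesis using push card[OF push(1)] by simp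
    qed
  next
    fix s' :: astate assume "?P n s'"
    moreover from this have "alive 3 s' = {}" by simp
    ultimately show "ratio_inv n {} (snd (upd 6 n s') 5) (snd (upd 6 n s') 6)" by simp
  qed
qed

text \<open>
  The reverse delete phase processes the stack in decreasing order of the stamps. In round \<open>t\<close>, the
  vertices with stamp \<open>n - t\<close> are tested one by one; \<open>X\<close> is the complement of the current solution.
\<close>

definition reverse_inv :: "(nat \<Rightarrow> nat) \<Rightarrow> nat \<Rightarrow> nat \<Rightarrow> nat set \<Rightarrow> bool" where
  "reverse_inv T t i X \<longleftrightarrow> X \<subseteq> V \<and> cyc X = 0 \<and> V - X \<subseteq> {v. 0 < T v} \<and>
     (\<forall>v\<in>X. 0 < T v \<longrightarrow> n - t < T v \<or> (T v = n - t \<and> v < i)) \<and>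
     (\<forall>v\<in>V - X. n - t < T v \<or> (T v = n - t \<and> v < i) \<longrightarrow>
        \<not> feasible V ((V - X - {v}) \<union> {u. 0 < T u \<and> T u < T v}))"

lemma reverse_inv_skip:
  assumes "reverse_inv T t i X" "T i \<noteq> n - t"
  shows "reverse_inv T t (Suc i) X"
proof -
  have *: "n - t < T v \<or> (T v = n - t \<and> v < Suc i) \<longleftrightarrow> n - t < T v \<or> (T v = n - t \<and> v < i)" for v
    using assms(2) by (auto simp: less_Suc_eq)
  show ?thesis unfolding reverse_inv_def * using assms(1) unfolding reverse_inv_def .
qed

lemma reverse_inv_next:
  assumes inv: "reverse_inv T t n X" and t: "t < n"
  shows "reverse_inv T (Suc t) 0 X"
proof -
  \<comment> \<open>All positions are below \<open>n\<close>, so a full round settles stamp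
    \<open>n - t\<close>; by \<open>t < n\<close> the next threshold is smaller by exactly
    one.\<close>
  have *: "n - Suc t < T v \<or> (T v = n - Suc t \<and> v < 0) \<longleftrightarrow> n - t < T v \<or> (T v = n - t \<and> v < n)"
    if "v \<in> V" for v
    using that V_less t by auto
  note I = inv[unfolded reverse_inv_def]
  show ?thesis
    unfolding reverse_inv_def
  proof (intro conjI ballI impI)
    show "X \<subseteq> V" "cyc X = 0" "V - X \<subseteq> {v. 0 < T v}" using I by auto
    show "n - Suc t < T v \<or> (T v = n - Suc t \<and> v < 0)" if v: "v \<in> X" "0 < T v" for v
    proof -
      have "v \<in> V" using I v(1) by auto
      moreover have "n - t < T v \<or> (T v = n - t \<and> v < n)" using I v by simp
      ultimately show ?thesis by (simp only: *)
    qed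
    show "\<not> feasible V ((V - X - {v}) \<union> {u. 0 < T u \<and> T u < T v})"
      if v: "v \<in> V - X" "n - Suc t < T v \<or> (T v = n - Suc t \<and> v < 0)" for v
    proof -
      have "v \<in> V" using v(1) by auto
      then have "n - t < T v \<or> (T v = n - t \<and> v < n)" using v(2) by (simp only: *)
      then show ?thesis using I v(1) by auto
    qed
  qed
qed

text \<open>Restoring \<open>i\<close> shrinks the solution, and infeasibility passes to smaller
  sets, so earlier failed tests stay valid.\<close>

lemma reverse_inv_delete:
  assumes inv: "reverse_inv T t i X" and i: "i \<in> V" and cyc: "cyc (insert i X) = 0" and T: "T i = n - t"
  shows "reverse_inv T t (Suc i) (insert i X)"
  unfolding reverse_inv_def
proof (intro conjI ballI impI)
  note I = inv[unfolded reverse_inv_def]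
  show "insert i X \<subseteq> V" "V - insert i X \<subseteq> {v. 0 < T v}" using I i by auto
  show "cyc (insert i X) = 0" by fact
  show "n - t < T v \<or> (T v = n - t \<and> v < Suc i)" if "v \<in> insert i X" "0 < T v" for v
    using that I T by auto
  fix v assume v: "v \<in> V - insert i X" "n - t < T v \<or> (T v = n - t \<and> v < Suc i)"
  then have "\<not> feasible V ((V - X - {v}) \<union> {u. 0 < T u \<and> T u < T v})"
    using I by (auto simp: less_Suc_eq)
  then show "\<not> feasible V ((V - insert i X - {v}) \<union> {u. 0 < T u \<and> T u < T v})"
    using feasible_mono[of V "(V - insert i X - {v}) \<union> {u. 0 < T u \<and> T u < T v}" V
        "(V - X - {v}) \<union> {u. 0 < T u \<and> T u < T v}"] by auto
qed

text \<open>No vertex with a smaller stamp has been restored yet, so the tested set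
  \<open>insert i X\<close> is exactly the one that the minimality condition speaks of.\<close>

lemma reverse_inv_keep:
  assumes inv: "reverse_inv T t i X" and i: "i \<in> V" and cyc: "cyc (insert i X) \<noteq> 0" and T: "T i = n - t"
    and TV: "\<And>v. 0 < T v \<Longrightarrow> v \<in> V"
  shows "reverse_inv T t (Suc i) X"
  unfolding reverse_inv_def
proof (intro conjI ballI impI)
  note I = inv[unfolded reverse_inv_def]
  show "X \<subseteq> V" "V - X \<subseteq> {v. 0 < T v}" "cyc X = 0" using I by auto
  show "n - t < T v \<or> (T v = n - t \<and> v < Suc i)" if "v \<in> X" "0 < T v" for v
    using that I by auto
  fix v assume v: "v \<in> V - X" "n - t < T v \<or> (T v = n - t \<and> v < Suc i)"
  show "\<not> feasible V ((V - X - {v}) \<union> {u. 0 < T u \<and> T u < T v})"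
  proof (cases "v = i")
    case False
    then show ?thesis using I v by (auto simp: less_Suc_eq)
  next
    case True
    have "u \<notin> X" if "0 < T u" "T u < T i" for u using I that T by fastforce
    then have "V - ((V - X - {v}) \<union> {u. 0 < T u \<and> T u < T v}) = insert i X"
      using I i True by auto
    then show ?thesis using cyc by (simp add: feasible_def)
  qed
qed

lemma reverse_step_prog_spec:
  assumes inv: "reverse_inv (snd s 6) t i (alive 7 s)" and t: "t < n" "fst s 6 = t" "fst s 9 = n"
    and i: "i < n" "fst s 7 = i" and TV: "\<And>v. 0 < snd s 6 v \<Longrightarrow> v \<in> V"
  shows "reverse_inv (snd s 6) t (Suc i) (alive 7 (exe reverse_step_prog s))"
proof (cases "snd s 6 i = n - t")
  case False
  then have "exe reverse_step_prog s = s" using t i by (auto simp: reverse_step_prog_def)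
  then show ?thesis using reverse_inv_skip[OF inv False] by simp
next
  case True
  then have iV: "i \<in> V" using TV[of i] t by simp
  have "insert (fst s 7) (alive 7 s) \<subseteq> V" using inv iV i by (simp add: reverse_inv_def)
  note test = test_prog_val[OF this, unfolded i(2)]
  show ?thesis
  proof (cases "cyc (insert i (alive 7 s)) = 0")
    case cyc: True
    then have "snd (exe reverse_step_prog s) 7 = (snd s 7)(i := 0)"
      using test True t i by (simp add: reverse_step_prog_def)
    then have "alive 7 (exe reverse_step_prog s) = insert i (alive 7 s)"
      using i by (auto simp: alive_def)
    then show ?thesis using reverse_inv_delete[OF inv iV cyc True] by simp
  next
    case cyc: False
    then have "snd (exe reverse_step_prog s) 7 = snd s 7"
      using test True t i by (simp add: reverse_step_prog_def)
    then have "alive 7 (exe reverse_step_prog s) = alive 7 s" by (rule alive_cong)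
    then show ?thesis using reverse_inv_keep[OF inv iV cyc True TV] by simp
  qed
qed

lemma reverse_prog_spec:
  assumes init: "reverse_inv (snd s 6) 0 0 (alive 7 s)" and TV: "\<And>v. 0 < snd s 6 v \<Longrightarrow> v \<in> V"
  shows "reverse_inv (snd s 6) n 0 (alive 7 (exe reverse_prog s))"
proof -
  let ?T = "snd s 6"
  define s1 where "s1 = exe (For 9 PSkip) s"
  have s1: "fst s1 9 = n" by (simp add: s1_def)
  have s1': "snd s1 = snd s" unfolding s1_def by (rule frame_arrs) simp
  have "alive 7 s1 = alive 7 s" using s1' by (intro alive_cong) simp
  have "reverse_inv ?T n 0 (alive 7 (exe (For 6 (For 7 reverse_step_prog)) s1))"
  proof (rule For_rule[where P = "\<lambda>t s'. reverse_inv ?T t 0 (alive 7 s')"])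
    show "reverse_inv ?T 0 0 (alive 7 s1)" using init \<open>alive 7 s1 = alive 7 s\<close> by simp
    fix t and s' :: astate
    assume t: "t < n" and fv: "\<And>x. x \<notin> insert 6 (vmods (For 7 reverse_step_prog)) \<Longrightarrow> fst s' x = fst s1 x"
      and fa: "\<And>c. c \<notin> amods (For 7 reverse_step_prog) \<Longrightarrow> snd s' c = snd s1 c"
      and P: "reverse_inv ?T t 0 (alive 7 s')"
    have s': "fst s' 9 = n" "snd s' 6 = ?T" using fv[of 9] fa[of 6] s1 s1' by auto
    have "reverse_inv ?T t n (alive 7 (exe (For 7 reverse_step_prog) (upd 6 t s')))"
    proof (rule For_rule[where P = "\<lambda>i s'. reverse_inv ?T t i (alive 7 s')"])
      have "alive 7 (upd 6 t s') = alive 7 s'" by (rule alive_cong) simp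
      then show "reverse_inv ?T t 0 (alive 7 (upd 6 t s'))" using P by simp
      fix i and s'' :: astate
      assume i: "i < n" and fv: "\<And>x. x \<notin> insert 7 (vmods reverse_step_prog) \<Longrightarrow> fst s'' x = fst (upd 6 t s') x"
        and fa: "\<And>c. c \<notin> amods reverse_step_prog \<Longrightarrow> snd s'' c = snd (upd 6 t s') c"
        and P: "reverse_inv ?T t i (alive 7 s'')"
      let ?s = "upd 7 i s''"
      have s'': "fst ?s 9 = n" "fst ?s 6 = t" "snd ?s 6 = ?T" "fst ?s 7 = i"
        using fv[of 9] fv[of 6] fa[of 6] s' by auto
      have "alive 7 ?s = alive 7 s''" by (rule alive_cong) simp
      then show "reverse_inv ?T t (Suc i) (alive 7 (exe reverse_step_prog ?s))"
        using reverse_step_prog_spec[of ?s t i, unfolded s''] P t i TV by simp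
    next
      fix s'' :: astate assume P: "reverse_inv ?T t n (alive 7 s'')"
      have "alive 7 (upd 7 n s'') = alive 7 s''" by (rule alive_cong) simp
      then show "reverse_inv ?T t n (alive 7 (upd 7 n s''))" using P by simp
    qed
    then show "reverse_inv ?T (Suc t) 0 (alive 7 (exe (For 7 reverse_step_prog) (upd 6 t s')))"
      by (rule reverse_inv_next[OF _ t])
  next
    fix s' :: astate assume P: "reverse_inv ?T n 0 (alive 7 s')"
    have "alive 7 (upd 6 n s') = alive 7 s'" by (rule alive_cong) simp
    then show "reverse_inv ?T n 0 (alive 7 (upd 6 n s'))" using P by simp
  qed
  then show ?thesis by (simp add: reverse_prog_def s1_def del: run.simps(6))
qed

text \<open>The program enters only through the implication \<open>init\<close>. The initial
  solution, all stamped vertices, is feasible because the local ratio phase ended with an empty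
  \<open>U\<close>.\<close>

lemma ratio_reverse:
  assumes inv: "ratio_inv n {} w T" and init: "reverse_inv T 0 0 X \<Longrightarrow> reverse_inv T n 0 X'"
    and X: "X = V - {v. 0 < T v}" and H: "feasible V H"
  shows "X' \<subseteq> V \<and> cyc X' = 0 \<and> card (V - X') \<le> 4 * card (H \<inter> V)"
proof -
  note D = ratio_invD[OF inv]
  have st: "stamped T n = {v. 0 < T v}" using D(3) by (auto simp: stamped_def)
  have "feasible (V - stamped T n) {} \<longleftrightarrow> feasible {} {}" by (rule D)
  then have "cyc X = 0" by (simp add: st X feasible_def)
  moreover have "\<not> n < T v" for v using D(3)[of v] by simp
  ultimately have "reverse_inv T 0 0 X" by (auto simp: reverse_inv_def X)
  then have R: "reverse_inv T n 0 X'" by (rule init)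
  then have X': "X' \<subseteq> V" "cyc X' = 0" "V - X' \<subseteq> stamped T n" by (auto simp: reverse_inv_def st)
  have "V - (V - X') = X'" using X' by auto
  then have "card (V - X') \<le> 4 * card (H \<inter> V)"
    using R X' by (intro ratio_inv_final[OF inv X'(3) _ _ H]) (auto simp: reverse_inv_def feasible_def)
  then show ?thesis using X' by simp
qed

end

section \<open>Correctness of the complete program\<close>

context graph_program
begin

lemma init_prog_spec: "\<forall>i<n. snd (exe init_prog s) 3 i = snd s 2 i \<and> snd (exe init_prog s) 5 i = 1"
  unfolding init_prog_def
proof (rule For_rule[where P = "\<lambda>i s'. \<forall>j<i. snd s' 3 j = snd s 2 j \<and> snd s' 5 j = 1"])
  fix i and s' :: astate
  assume fa: "\<And>c. c \<notin> amods (PSeq (Put 3 2 (Arr 2 2)) (Put 5 2 (Num 1))) \<Longrightarrow> snd s' c = snd s c"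
    and P: "\<forall>j<i. snd s' 3 j = snd s 2 j \<and> snd s' 5 j = 1"
  have "snd s' 2 = snd s 2" using fa[of 2] by simp
  then show "\<forall>j<Suc i. snd (exe (PSeq (Put 3 2 (Arr 2 2)) (Put 5 2 (Num 1))) (upd 2 i s')) 3 j = snd s 2 j \<and>
      snd (exe (PSeq (Put 3 2 (Arr 2 2)) (Put 5 2 (Num 1))) (upd 2 i s')) 5 j = 1"
    using P by (auto simp: less_Suc_eq)
qed auto

lemma mark_prog_spec: "\<forall>i<n. snd (exe mark_prog s) 7 i = snd s 2 i + snd s 6 i"
  unfolding mark_prog_def
proof (rule For_rule[where P = "\<lambda>i s'. \<forall>j<i. snd s' 7 j = snd s 2 j + snd s 6 j"])
  fix i and s' :: astate
  assume fa: "\<And>c. c \<notin> amods (Put 7 2 (Add (Arr 2 2) (Arr 6 2))) \<Longrightarrow> snd s' c = snd s c"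
    and P: "\<forall>j<i. snd s' 7 j = snd s 2 j + snd s 6 j"
  have "snd s' 2 = snd s 2" "snd s' 6 = snd s 6" using fa[of 2] fa[of 6] by auto
  then show "\<forall>j<Suc i. snd (exe (Put 7 2 (Add (Arr 2 2) (Arr 6 2))) (upd 2 i s')) 7 j = snd s 2 j + snd s 6 j"
    using P by (auto simp: less_Suc_eq)
qed auto

end

text \<open>A solution \<open>H\<close> splits into its parts outside and inside \<open>V\<close>.
  The outer part pays for the deleted diamonds by the packing property, the inner part for the local
  ratio solution.\<close>

lemma (in graph_program) block_deletion_prog_spec:
  fixes s defines "X \<equiv> alive 7 (exe block_deletion_prog s)"
  assumes init: "snd s 2 = (\<lambda>_. 0)" "snd s 6 = (\<lambda>_. 0)"
  shows "block_set X" "block_set ({..<n} - H) \<Longrightarrow> card ({..<n} - X) \<le> 4 * card ({..<n} \<inter> H)"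
proof -
  define s1 where "s1 = exe diamond_prog s"
  define V where "V = alive 2 s1"
  have pack: "packing ({..<n} - V)" and free: "diamond_free V"
    using diamond_prog_spec[OF init(1)] by (simp_all add: V_def s1_def)
  have Vn: "V \<subseteq> {..<n}" by (auto simp: V_def alive_def)
  then have finV: "finite V" using finite_subset by blast
  interpret D: diamond_free_program adj n V
    by unfold_locales (use free Vn finV in auto)
  define s2 where "s2 = exe init_prog s1"
  define s3 where "s3 = exe ratio_prog s2"
  define s4 where "s4 = exe mark_prog s3"
  let ?T = "snd s3 6"
  have X: "X = alive 7 (exe reverse_prog s4)"
    by (simp add: X_def block_deletion_prog_def s1_def s2_def s3_def s4_def)
  have a2: "alive 3 s2 = V" using init_prog_spec[of s1] by (auto simp: alive_def V_def s2_def)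
  have "snd s2 5 v = 1" if "v \<in> V" for v
    using init_prog_spec[of s1] that Vn by (auto simp: s2_def)
  moreover have "snd s2 6 = (\<lambda>_. 0)" by (simp add: s2_def s1_def init)
  ultimately have inv: "D.ratio_inv n {} (snd s3 5) ?T"
    unfolding s3_def by (intro D.ratio_prog_spec a2)
  have "snd s3 2 = snd s1 2" by (simp add: s3_def s2_def)
  then have a4: "alive 7 s4 = V - {v. 0 < ?T v}"
    using mark_prog_spec[of s3] by (auto simp: alive_def V_def s4_def)
  have T4: "snd s4 6 = ?T" by (simp add: s4_def)
  have "D.reverse_inv ?T n 0 X" if "D.reverse_inv ?T 0 0 (alive 7 s4)"
    unfolding X using D.reverse_prog_spec[of s4, unfolded T4, OF that] D.ratio_invD(4)[OF inv] by simp
  then have main: "X \<subseteq> V \<and> D.cyc X = 0 \<and> card (V - X) \<le> 4 * card (H' \<inter> V)"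
    if "D.feasible V H'" for H'
    by (rule D.ratio_reverse[OF inv _ a4 that])
  \<comment> \<open>Some feasible set has to be supplied to extract the conclusions of
    \<open>main\<close> that do not depend on it.\<close>
  have "D.feasible V V" by (simp add: D.feasible_def)
  then have XV: "X \<subseteq> V" and cyc: "D.cyc X = 0" using main by blast+
  show "block_set X" by (rule D.cyc_0_block_set[OF XV cyc])
  assume H: "block_set ({..<n} - H)"
  have "card ({..<n} - V) \<le> 4 * card (({..<n} - V) \<inter> H)"
    using pack block_set_diamond_free[OF H] by (simp add: packing_def)
  moreover have "card (V - X) \<le> 4 * card (H \<inter> V)"
  proof -
    have "block_set (V - H)" by (rule block_set_mono[OF H]) (use Vn in auto)
    then have "D.feasible V H" unfolding D.feasible_def by (intro D.block_set_cyc_0) auto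
    then show ?thesis using main by blast
  qed
  moreover have "card ({..<n} - X) = card ({..<n} - V) + card (V - X)"
  proof -
    have "{..<n} - X = ({..<n} - V) \<union> (V - X)" using XV Vn by auto
    then show ?thesis using finV by (subst card_Un_disjoint[symmetric]) auto
  qed
  moreover have "card ({..<n} \<inter> H) = card (({..<n} - V) \<inter> H) + card (H \<inter> V)"
  proof -
    have "{..<n} \<inter> H = (({..<n} - V) \<inter> H) \<union> (H \<inter> V)" using Vn by auto
    then show ?thesis using finV by (subst card_Un_disjoint[symmetric]) auto
  qed
  ultimately show "card ({..<n} - X) \<le> 4 * card ({..<n} \<inter> H)" by linarith
qed

theorem theorem6:
  shows "\<exists>alg. poly_time_graph_algorithm alg
           (\<lambda>G S. S \<subseteq> pverts G \<and> block_graph (with_proj G \<restriction> (pverts G - S)) \<and>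
                  card S \<le> 4 * block_deletion_opt G)"
proof (intro exI, rule poly_time_graph_algorithmI[OF wf_block_deletion_prog])
  fix G :: "nat pair_pre_digraph" and vs
  assume G: "pair_graph G" and vs: "distinct vs" "set vs = pverts G"
  let ?n = "length vs" and ?f = "(!) vs"
  let ?adj = "\<lambda>i j. (vs ! i, vs ! j) \<in> parcs G"
  let ?s = "run ?n ?adj block_deletion_prog (\<lambda>_. 0, \<lambda>_ _. 0)"
  interpret G: pair_graph_adj G using G by (simp add: pair_graph_adj_def)
  interpret P: graph_program ?adj ?n
    by unfold_locales (auto intro: G.sg.E_sym simp: G.sg.E_irrefl)
  define X where "X = P.alive 7 ?s"
  have inj: "inj_on ?f {..<?n}" using vs(1) by (auto intro: inj_on_nth)
  have range: "?f ` {..<?n} = pverts G" using vs(2) by (auto simp: set_conv_nth)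
  have block: "block_graph (with_proj G \<restriction> (?f ` Y)) \<longleftrightarrow> P.block_set Y" if Y: "Y \<subseteq> {..<?n}" for Y
  proof -
    have "?f ` Y \<subseteq> pverts G" using Y range by blast
    then have "block_graph (with_proj G \<restriction> (?f ` Y)) \<longleftrightarrow> G.sg.block_set (?f ` Y)"
      by (rule G.block_graph_iff)
    also have "\<dots> \<longleftrightarrow> P.block_set Y"
      by (rule block_set_image[OF G.sg.simple_graph_axioms P.simple_graph_axioms inj_on_subset[OF inj Y]])
    finally show ?thesis .
  qed
  have diff: "pverts G - ?f ` Y = ?f ` ({..<?n} - Y)" if "Y \<subseteq> {..<?n}" for Y
    using inj_on_image_set_diff[OF inj _ that, of "{..<?n}"] range by simp
  have XV: "X \<subseteq> {..<?n}" by (auto simp: X_def P.alive_def)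
  let ?S = "{vs ! i | i. i < ?n \<and> snd ?s 7 i \<noteq> 0}"
  have S: "?S = ?f ` ({..<?n} - X)" by (auto simp: X_def P.alive_def)
  have "pverts G - ?S = ?f ` X" unfolding S using XV by (subst diff) (auto simp: double_diff)
  moreover have "P.block_set X" unfolding X_def by (rule P.block_deletion_prog_spec) simp_all
  ultimately have del: "block_graph (with_proj G \<restriction> (pverts G - ?S))" using block[OF XV] by simp
  have sub: "?S \<subseteq> pverts G" unfolding S range[symmetric] by auto
  \<comment> \<open>The minimum is attained because the set is finite and nonempty; the computed
    output itself is a member.\<close>
  have "finite {S. block_deletion_set G S}"
    by (rule finite_subset[of _ "Pow (pverts G)"]) (auto simp: block_deletion_set_def G.pair_finite_verts)
  moreover have "?S \<in> {S. block_deletion_set G S}" using del sub by (simp add: block_deletion_set_def)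
  ultimately have "block_deletion_opt G \<in> card ` {S. block_deletion_set G S}"
    unfolding block_deletion_opt_def by (intro Min_in) auto
  then obtain H0 where H0: "block_deletion_set G H0" "card H0 = block_deletion_opt G" by auto
  \<comment> \<open>An optimal solution is pulled back to positions of the enumeration, where the
    guarantee was proved.\<close>
  define H where "H = {i. i < ?n \<and> vs ! i \<in> H0}"
  have Hn: "H \<subseteq> {..<?n}" by (auto simp: H_def)
  have "?f ` H = H0"
  proof -
    have "H0 \<subseteq> ?f ` {..<?n}" using H0(1) range by (simp add: block_deletion_set_def)
    then show ?thesis by (auto simp: H_def)
  qed
  then have "block_graph (with_proj G \<restriction> (?f ` ({..<?n} - H)))"
    using H0(1) diff[OF Hn] by (simp add: block_deletion_set_def)
  then have "P.block_set ({..<?n} - H)" using block[of "{..<?n} - H"] by blast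
  then have "card ({..<?n} - X) \<le> 4 * card ({..<?n} \<inter> H)"
    unfolding X_def by (rule P.block_deletion_prog_spec(2)[rotated 2]) simp_all
  moreover have "card ?S = card ({..<?n} - X)"
    unfolding S by (rule card_image) (rule inj_on_subset[OF inj], auto)
  moreover have "card ({..<?n} \<inter> H) = card H0"
  proof -
    have "{..<?n} \<inter> H = H" using Hn by auto
    moreover have "card (?f ` H) = card H" by (rule card_image) (rule inj_on_subset[OF inj Hn])
    ultimately show ?thesis using \<open>?f ` H = H0\<close> by simp
  qed
  ultimately have "card ?S \<le> 4 * block_deletion_opt G" using H0(2) by simp
  then show "?S \<subseteq> pverts G \<and> block_graph (with_proj G \<restriction> (pverts G - ?S)) \<and>
      card ?S \<le> 4 * block_deletion_opt G"
    using sub del by blast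
qed

end
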